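(* Let $R$ be a commutative Noetherian ring and $\mathfrak{a}$ an ideal of $R$. Let $M$ be an $R$-module such that $\operatorname{Ext}^i_R(R/\mathfrak{a}, M)$ is a finitely generated $R$-module for all $i\ge 0$. Let $t$ be a non-negative integer such that the local cohomology module $H^i_{\mathfrak{a}}(M)$ is $\mathfrak{a}$-cofinite for all $i<t$. Then the following statements are equivalent: (a) $\operatorname{Hom}_R(R/\mathfrak{a}, H^{t+1}_{\mathfrak{a}}(M))$ is a finitely generated $R$-module; (b) $\operatorname{Ext}^2_R(R/\mathfrak{a}, H^t_{\mathfrak{a}}(M))$ is a finitely generated $R$-module.
   Context: $H^i_{\mathfrak{a}}(M)$ denotes the $i$-th local cohomology module of $M$ with respect to $\mathfrak{a}$ (the $i$-th right derived functor of the $\mathfrak{a}$-torsion functor $\Gamma_{\mathfrak{a}}$, where $\Gamma_{\mathfrak a}(M)$ is the submodule of elements annihilated by some power of $\mathfrak{a}$). An $R$-module $X$ is called $\mathfrak{a}$-cofinite if (i) $\operatorname{Supp}(X)\subseteq V(\mathfrak{a})$, where $V(\mathfrak{a})$ is the set of prime ideals containing $\mathfrak{a}$, and (ii) $\operatorname{Ext}^i_R(R/\mathfrak{a}, X)$ is a finitely generated $R$-module for all $i\ge 0$. *)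

theory Defs
  imports "HOL-Algebra.Module" "HOL-Algebra.Ideal_Product" "HOL-Algebra.Ring_Divisibility"
begin

text \<open>
  Modules are the \<open>('a, 'm) module\<close> records of HOL-Algebra. Such a record extends a ring record, so
  it has fields \<open>mult\<close> and \<open>one\<close>, which the locale \<open>module\<close> ignores; we leave them undefined.
\<close>

section \<open>Modules\<close>

definition fin_gen :: "('a, 'r) ring_scheme \<Rightarrow> ('a, 'm, 'x) module_scheme \<Rightarrow> bool" where
  "fin_gen R M \<longleftrightarrow> (\<exists>A \<subseteq> carrier M. finite A \<and>
     (\<forall>N. submodule N R M \<and> A \<subseteq> N \<longrightarrow> N = carrier M))"

definition mod_hom ::
  "('a, 'r) ring_scheme \<Rightarrow> ('a, 'm, 'x) module_scheme \<Rightarrow> ('a, 'n, 'y) module_scheme \<Rightarrow> ('m \<Rightarrow> 'n) set"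
where
  "mod_hom R M N = {f \<in> carrier M \<rightarrow> carrier N.
     (\<forall>x\<in>carrier M. \<forall>y\<in>carrier M. f (x \<oplus>\<^bsub>M\<^esub> y) = f x \<oplus>\<^bsub>N\<^esub> f y) \<and>
     (\<forall>r\<in>carrier R. \<forall>x\<in>carrier M. f (r \<odot>\<^bsub>M\<^esub> x) = r \<odot>\<^bsub>N\<^esub> f x)}"

text \<open>
  Elements of the module \<open>Hom\<^sub>R(M, N)\<close> are restricted to be \<open>undefined\<close> outside \<open>carrier M\<close>, so that
  a homomorphism is represented by exactly one HOL function.
\<close>

definition Hom ::
  "('a, 'r) ring_scheme \<Rightarrow> ('a, 'm, 'x) module_scheme \<Rightarrow> ('a, 'n, 'y) module_scheme
    \<Rightarrow> ('a, 'm \<Rightarrow> 'n) module"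
where
  "Hom R M N =
    \<lparr>carrier = mod_hom R M N \<inter> extensional (carrier M),
     monoid.mult = undefined, one = undefined,
     ring.zero = (\<lambda>x\<in>carrier M. \<zero>\<^bsub>N\<^esub>),
     add = (\<lambda>f g. \<lambda>x\<in>carrier M. f x \<oplus>\<^bsub>N\<^esub> g x),
     smult = (\<lambda>r f. \<lambda>x\<in>carrier M. r \<odot>\<^bsub>N\<^esub> f x)\<rparr>"

definition quot_module :: "('a, 'm, 'x) module_scheme \<Rightarrow> 'm set \<Rightarrow> ('a, 'm set) module" where
  "quot_module M N =
    \<lparr>carrier = a_rcosets\<^bsub>M\<^esub> N,
     monoid.mult = undefined, one = undefined,
     ring.zero = N,
     add = set_add M,
     smult = (\<lambda>r X. \<Union>x\<in>X. N +>\<^bsub>M\<^esub> (r \<odot>\<^bsub>M\<^esub> x))\<rparr>"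

definition regular_module :: "('a, 'r) ring_scheme \<Rightarrow> ('a, 'a) module" where
  "regular_module R =
    \<lparr>carrier = carrier R, monoid.mult = monoid.mult R, one = one R, ring.zero = ring.zero R, add = add R,
     smult = monoid.mult R\<rparr>"

abbreviation quot_ring_module :: "('a, 'r) ring_scheme \<Rightarrow> 'a set \<Rightarrow> ('a, 'a set) module" where
  "quot_ring_module R \<aa> \<equiv> quot_module (regular_module R) \<aa>"


section \<open>Support\<close>

text \<open>
  The localization of \<open>M\<close> at a multiplicative set \<open>S\<close>, as an \<open>R\<close>-module: \<open>(x, s)\<close> stands for the
  fraction \<open>x / s\<close>.
\<close>

definition loc_rel ::
  "('a, 'r) ring_scheme \<Rightarrow> 'a set \<Rightarrow> ('a, 'm, 'x) module_scheme \<Rightarrow> (('m \<times> 'a) \<times> ('m \<times> 'a)) set"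
where
  "loc_rel R S M = {((x, s), (y, t)) | x s y t.
     x \<in> carrier M \<and> s \<in> S \<and> y \<in> carrier M \<and> t \<in> S \<and>
     (\<exists>u\<in>S. u \<odot>\<^bsub>M\<^esub> (t \<odot>\<^bsub>M\<^esub> x) = u \<odot>\<^bsub>M\<^esub> (s \<odot>\<^bsub>M\<^esub> y))}"

definition loc_module ::
  "('a, 'r) ring_scheme \<Rightarrow> 'a set \<Rightarrow> ('a, 'm, 'x) module_scheme \<Rightarrow> ('a, ('m \<times> 'a) set) module"
where
  "loc_module R S M =
    \<lparr>carrier = (carrier M \<times> S) // loc_rel R S M,
     monoid.mult = undefined, one = undefined,
     ring.zero = loc_rel R S M `` {(\<zero>\<^bsub>M\<^esub>, \<one>\<^bsub>R\<^esub>)},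
     add = (\<lambda>X Y. \<Union>(x, s)\<in>X. \<Union>(y, t)\<in>Y.
       loc_rel R S M `` {((t \<odot>\<^bsub>M\<^esub> x) \<oplus>\<^bsub>M\<^esub> (s \<odot>\<^bsub>M\<^esub> y), s \<otimes>\<^bsub>R\<^esub> t)}),
     smult = (\<lambda>r X. \<Union>(x, s)\<in>X. loc_rel R S M `` {(r \<odot>\<^bsub>M\<^esub> x, s)})\<rparr>"

definition Supp :: "('a, 'r) ring_scheme \<Rightarrow> ('a, 'm, 'x) module_scheme \<Rightarrow> 'a set set" where
  "Supp R M = {\<pp>. primeideal \<pp> R \<and>
     carrier (loc_module R (carrier R - \<pp>) M) \<noteq> {\<zero>\<^bsub>loc_module R (carrier R - \<pp>) M\<^esub>}}"

definition V :: "('a, 'r) ring_scheme \<Rightarrow> 'a set \<Rightarrow> 'a set set" where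
  "V R \<aa> = {\<pp>. primeideal \<pp> R \<and> \<aa> \<subseteq> \<pp>}"


section \<open>Resolutions\<close>

definition free_module :: "('a, 'r) ring_scheme \<Rightarrow> ('a, 'm, 'x) module_scheme \<Rightarrow> bool" where
  "free_module R F \<longleftrightarrow> module R F \<and> (\<exists>B \<subseteq> carrier F. \<forall>x\<in>carrier F.
     \<exists>!c. c \<in> B \<rightarrow>\<^sub>E carrier R \<and> finite {b \<in> B. c b \<noteq> \<zero>\<^bsub>R\<^esub>} \<and>
       x = (\<Oplus>\<^bsub>F\<^esub>b\<in>{b \<in> B. c b \<noteq> \<zero>\<^bsub>R\<^esub>}. c b \<odot>\<^bsub>F\<^esub> b))"

text \<open>
  A definition in HOL cannot quantify over all types, so the test modules \<open>A\<close> and \<open>B\<close> have their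
  carriers in the type \<open>'a\<close> of ring elements. This includes the inclusions of ideals of \<open>R\<close> into \<open>R\<close>,
  so by Baer's criterion the extension property then holds for modules over every type.
\<close>

definition injective_module :: "('a, 'r) ring_scheme \<Rightarrow> ('a, 'm, 'x) module_scheme \<Rightarrow> bool" where
  "injective_module R E \<longleftrightarrow> module R E \<and>
     (\<forall>(A :: ('a, 'a) module) (B :: ('a, 'a) module) j f.
        module R A \<and> module R B \<and> j \<in> mod_hom R A B \<and> inj_on j (carrier A) \<and> f \<in> mod_hom R A E \<longrightarrow>
        (\<exists>g\<in>mod_hom R B E. \<forall>x\<in>carrier A. g (j x) = f x))"

text \<open>
  \<open>\<dots> \<rightarrow> F 2 \<rightarrow> F 1 \<rightarrow> F 0 \<rightarrow> N \<rightarrow> 0\<close> is exact, with differentials \<open>d n : F (n + 1) \<rightarrow> F n\<close> and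
  augmentation \<open>\<epsilon>\<close>.
\<close>

definition free_resolution ::
  "('a, 'r) ring_scheme \<Rightarrow> ('a, 'n, 'y) module_scheme
    \<Rightarrow> (nat \<Rightarrow> ('a, 'f, 'x) module_scheme) \<Rightarrow> (nat \<Rightarrow> 'f \<Rightarrow> 'f) \<Rightarrow> ('f \<Rightarrow> 'n) \<Rightarrow> bool"
where
  "free_resolution R N F d \<epsilon> \<longleftrightarrow>
     (\<forall>n. free_module R (F n) \<and> d n \<in> mod_hom R (F (Suc n)) (F n)) \<and>
     \<epsilon> \<in> mod_hom R (F 0) N \<and>
     \<epsilon> ` carrier (F 0) = carrier N \<and>
     a_kernel (F 0) N \<epsilon> = d 0 ` carrier (F 1) \<and>
     (\<forall>n. a_kernel (F (Suc n)) (F n) (d n) = d (Suc n) ` carrier (F (Suc (Suc n))))"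

text \<open>
  \<open>0 \<rightarrow> M \<rightarrow> E 0 \<rightarrow> E 1 \<rightarrow> E 2 \<rightarrow> \<dots>\<close> is exact, with coaugmentation \<open>\<eta>\<close> and differentials
  \<open>\<delta> n : E n \<rightarrow> E (n + 1)\<close>.
\<close>

definition injective_resolution ::
  "('a, 'r) ring_scheme \<Rightarrow> ('a, 'm, 'y) module_scheme
    \<Rightarrow> (nat \<Rightarrow> ('a, 'e, 'x) module_scheme) \<Rightarrow> (nat \<Rightarrow> 'e \<Rightarrow> 'e) \<Rightarrow> ('m \<Rightarrow> 'e) \<Rightarrow> bool"
where
  "injective_resolution R M E \<delta> \<eta> \<longleftrightarrow>
     (\<forall>n. injective_module R (E n) \<and> \<delta> n \<in> mod_hom R (E n) (E (Suc n))) \<and>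
     \<eta> \<in> mod_hom R M (E 0) \<and>
     inj_on \<eta> (carrier M) \<and>
     a_kernel (E 0) (E 1) (\<delta> 0) = \<eta> ` carrier M \<and>
     (\<forall>n. a_kernel (E (Suc n)) (E (Suc (Suc n))) (\<delta> (Suc n)) = \<delta> n ` carrier (E n))"


section \<open>Derived functors\<close>

definition cohomology ::
  "(nat \<Rightarrow> ('a, 'm, 'x) module_scheme) \<Rightarrow> (nat \<Rightarrow> 'm \<Rightarrow> 'm) \<Rightarrow> nat \<Rightarrow> ('a, 'm set) module"
where
  "cohomology C d i =
     quot_module (C i\<lparr>carrier := a_kernel (C i) (C (Suc i)) (d i)\<rparr>)
       (case i of 0 \<Rightarrow> {\<zero>\<^bsub>C 0\<^esub>} | Suc j \<Rightarrow> d j ` carrier (C j))"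

text \<open>
  A derived functor is computed from a chosen resolution and depends on the choice only up to
  isomorphism; the resolution is an explicit argument here. If \<open>(F, d)\<close> is a free resolution of \<open>N\<close>,
  then \<open>Ext R F d X i\<close> is \<open>Ext\<^sup>i\<^sub>R(N, X)\<close>. If \<open>(E, \<delta>)\<close> is an injective resolution of \<open>M\<close>, then
  \<open>local_cohomology R \<aa> E \<delta> i\<close> is \<open>H\<^sup>i\<^sub>\<aa>(M)\<close>.
\<close>

definition Ext ::
  "('a, 'r) ring_scheme \<Rightarrow> (nat \<Rightarrow> ('a, 'f, 'x) module_scheme) \<Rightarrow> (nat \<Rightarrow> 'f \<Rightarrow> 'f)
    \<Rightarrow> ('a, 'm, 'y) module_scheme \<Rightarrow> nat \<Rightarrow> ('a, ('f \<Rightarrow> 'm) set) module"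
where
  "Ext R F d X = cohomology (\<lambda>n. Hom R (F n) X) (\<lambda>n \<phi>. compose (carrier (F (Suc n))) \<phi> (d n))"

definition torsion_part ::
  "('a, 'r) ring_scheme \<Rightarrow> 'a set \<Rightarrow> ('a, 'm, 'x) module_scheme \<Rightarrow> ('a, 'm, 'x) module_scheme"
where
  "torsion_part R \<aa> M =
     M\<lparr>carrier := {x \<in> carrier M. \<exists>n::nat. \<forall>r \<in> \<aa> [^]\<^bsub>ideals_set R\<^esub> n. r \<odot>\<^bsub>M\<^esub> x = \<zero>\<^bsub>M\<^esub>}\<rparr>"

definition local_cohomology ::
  "('a, 'r) ring_scheme \<Rightarrow> 'a set \<Rightarrow> (nat \<Rightarrow> ('a, 'e, 'x) module_scheme) \<Rightarrow> (nat \<Rightarrow> 'e \<Rightarrow> 'e)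
    \<Rightarrow> nat \<Rightarrow> ('a, 'e set) module"
where
  "local_cohomology R \<aa> E \<delta> = cohomology (\<lambda>n. torsion_part R \<aa> (E n)) \<delta>"

text \<open>Here \<open>(F, d)\<close> is meant to be a free resolution of \<open>R/\<aa>\<close>.\<close>

definition cofinite_module ::
  "('a, 'r) ring_scheme \<Rightarrow> 'a set \<Rightarrow> (nat \<Rightarrow> ('a, 'f, 'x) module_scheme) \<Rightarrow> (nat \<Rightarrow> 'f \<Rightarrow> 'f)
    \<Rightarrow> ('a, 'm, 'y) module_scheme \<Rightarrow> bool"
where
  "cofinite_module R \<aa> F d X \<longleftrightarrow> Supp R X \<subseteq> V R \<aa> \<and> (\<forall>i. fin_gen R (Ext R F d X i))"

end

theory Submission
  imports Defs
begin

text \<open>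
  Write \<open>T\<^sup>i = Ext\<^sup>i(R/\<aa>, -)\<close>, \<open>C\<^sup>n = ker(E\<^sup>n \<rightarrow> E\<^sup>n\<^sup>+\<^sup>1)\<close>, \<open>I\<^sup>n = \<Gamma>\<^sub>\<aa>(E\<^sup>n)\<close>, and let \<open>Z\<^sup>n\<close> and \<open>B\<^sup>n\<close> be the cocycles and
  coboundaries of the complex \<open>I\<close>, so that \<open>H\<^sup>n = Z\<^sup>n/B\<^sup>n\<close> is the local cohomology. As \<open>I\<^sup>n\<close> is injective, the
  sequences \<open>0 \<rightarrow> Z\<^sup>n \<rightarrow> I\<^sup>n \<rightarrow> B\<^sup>n\<^sup>+\<^sup>1 \<rightarrow> 0\<close> and \<open>0 \<rightarrow> B\<^sup>n \<rightarrow> Z\<^sup>n \<rightarrow> H\<^sup>n \<rightarrow> 0\<close> show by induction that \<open>T\<^sup>i(B\<^sup>n)\<close> is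
  finitely generated for \<open>i \<ge> 1\<close> and \<open>n \<le> t\<close>. Up to finitely generated modules, \<open>T\<^sup>2(H\<^sup>t)\<close> is therefore
  \<open>T\<^sup>2(Z\<^sup>t) = T\<^sup>1(B\<^sup>t\<^sup>+\<^sup>1)\<close>, and this is compared with \<open>T\<^sup>0(H\<^sup>t\<^sup>+\<^sup>1)\<close> by the exact sequence
  \<open>T\<^sup>0(Z\<^sup>t\<^sup>+\<^sup>1) \<rightarrow> T\<^sup>0(H\<^sup>t\<^sup>+\<^sup>1) \<rightarrow> T\<^sup>1(B\<^sup>t\<^sup>+\<^sup>1) \<rightarrow> T\<^sup>1(Z\<^sup>t\<^sup>+\<^sup>1)\<close>. The two outer terms are controlled by dimension
  shifting: \<open>T\<^sup>n\<^sup>+\<^sup>1(M) = T\<^sup>1(C\<^sup>n)\<close>, the submodule \<open>T\<^sup>1(Z\<^sup>n)\<close> of \<open>T\<^sup>1(C\<^sup>n)\<close> is finitely generated, and the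
  quotient of \<open>T\<^sup>1(C\<^sup>n)\<close> by it is \<open>T\<^sup>0(Z\<^sup>n\<^sup>+\<^sup>1)/T\<^sup>0(B\<^sup>n\<^sup>+\<^sup>1)\<close>.
\<close>

section \<open>Submodules and linear relations\<close>

text \<open>The delicate point is degree 0: \<open>T\<^sup>0(Z\<^sup>t\<^sup>+\<^sup>1)\<close> is
  not known to be finitely generated, so it can enter an exact sequence only after division by the
  maps with values in \<open>B\<^sup>t\<^sup>+\<^sup>1\<close>, which die in
  \<open>H\<^sup>t\<^sup>+\<^sup>1\<close>. Both outer terms are tamed by one fact: a map from
  \<open>R/\<aa>\<close> to \<open>E\<^sup>n\<close> has torsion values, hence lands in
  \<open>I\<^sup>n\<close>. Noetherianity serves two purposes: submodules of finitely generated
  modules are finitely generated, and \<open>I\<^sup>n\<close> is injective. Full long exact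
  sequences are never formed. The modules concerned live over many carrier types and are quotients
  built on quotients, so each \<open>Ext\<close> is kept as a pair \<open>N \<subseteq> L\<close>
  inside a module of homomorphisms, and the maps between such pairs, connecting homomorphisms
  included, are linear relations. All exactness arguments then pass through one criterion: the
  middle term of a three-term exact sequence is finitely generated when the outer ones are. That
  \<open>Ext\<close> vanishes on injectives comes from Baer's criterion, applied directly to a
  cocycle.\<close>

lemma (in module) submodule_iff:
  "submodule H R M \<longleftrightarrow> H \<subseteq> carrier M \<and> \<zero>\<^bsub>M\<^esub> \<in> H \<and> (\<forall>x\<in>H. \<forall>y\<in>H. x \<oplus>\<^bsub>M\<^esub> y \<in> H)
    \<and> (\<forall>r\<in>carrier R. \<forall>x\<in>H. r \<odot>\<^bsub>M\<^esub> x \<in> H)" (is "_ \<longleftrightarrow> ?rhs")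
proof
  assume H: "submodule H R M"
  then have "\<zero>\<^bsub>M\<^esub> \<in> H"
    using subgroup.one_closed[OF submodule.axioms(1)[OF H]] by simp
  with submoduleE[OF H] show ?rhs by auto
next
  assume H: ?rhs
  show "submodule H R M"
  proof (rule submoduleI)
    fix x assume x: "x \<in> H"
    then have "(\<ominus> \<one>) \<odot>\<^bsub>M\<^esub> x \<in> H" using H by simp
    moreover have "(\<ominus> \<one>) \<odot>\<^bsub>M\<^esub> x = \<ominus>\<^bsub>M\<^esub> x"
      using x H smult_l_minus[of \<one> x] by auto
    ultimately show "\<ominus>\<^bsub>M\<^esub> x \<in> H" by simp
  qed (use H in auto)
qed

lemma (in abelian_group) a_inv_zero [simp]: "\<ominus> \<zero> = \<zero>"
  using r_neg[of \<zero>] by simp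

lemma (in module) submodule_sub:
  assumes "submodule H R M" "x \<in> H" "y \<in> H"
  shows "x \<oplus>\<^bsub>M\<^esub> \<ominus>\<^bsub>M\<^esub> y \<in> H"
  using assms submoduleE by metis

lemma (in module) submodule_diff_cancel:
  assumes "submodule H R M" "x \<in> carrier M" "y \<in> H" "x \<oplus>\<^bsub>M\<^esub> \<ominus>\<^bsub>M\<^esub> y \<in> H"
  shows "x \<in> H"
proof -
  have "y \<in> carrier M" using assms(1,3) submodule_iff by auto
  then have "(x \<oplus>\<^bsub>M\<^esub> \<ominus>\<^bsub>M\<^esub> y) \<oplus>\<^bsub>M\<^esub> y = x" using assms(2) by (simp add: M.a_assoc M.l_neg)
  then show ?thesis using assms submodule_iff by metis
qed

lemma (in module) submodule_zero: "submodule {\<zero>\<^bsub>M\<^esub>} R M"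
  by (auto simp: submodule_iff)

lemma (in module) submodule_Int:
  "submodule H R M \<Longrightarrow> submodule K R M \<Longrightarrow> submodule (H \<inter> K) R M"
  by (auto simp: submodule_iff)

lemma submodule_imp_module:
  assumes "module R M" "submodule H R M" shows "module R (M\<lparr>carrier := H\<rparr>)"
  using submodule.submodule_is_module[OF assms(2,1)] .

text \<open>These are the submodules of \<open>X \<oplus> Y\<close>. Graphs of homomorphisms, their
  converses, homomorphisms defined only on a submodule, and connecting homomorphisms before a lift
  is chosen are all of this kind.\<close>

definition lin_rel ::
  "('a, 'r) ring_scheme \<Rightarrow> ('a, 'm, 'x) module_scheme \<Rightarrow> ('a, 'n, 'y) module_scheme \<Rightarrow> ('m \<times> 'n) set \<Rightarrow> bool"
where
  "lin_rel R X Y G \<longleftrightarrow> G \<subseteq> carrier X \<times> carrier Y \<and> (\<zero>\<^bsub>X\<^esub>, \<zero>\<^bsub>Y\<^esub>) \<in> G \<and>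
     (\<forall>x y x' y'. (x, y) \<in> G \<longrightarrow> (x', y') \<in> G \<longrightarrow> (x \<oplus>\<^bsub>X\<^esub> x', y \<oplus>\<^bsub>Y\<^esub> y') \<in> G) \<and>
     (\<forall>r x y. r \<in> carrier R \<longrightarrow> (x, y) \<in> G \<longrightarrow> (r \<odot>\<^bsub>X\<^esub> x, r \<odot>\<^bsub>Y\<^esub> y) \<in> G)"

lemma lin_relD:
  assumes "lin_rel R X Y G"
  shows "(x, y) \<in> G \<Longrightarrow> x \<in> carrier X" "(x, y) \<in> G \<Longrightarrow> y \<in> carrier Y"
    and "(\<zero>\<^bsub>X\<^esub>, \<zero>\<^bsub>Y\<^esub>) \<in> G"
    and "(x, y) \<in> G \<Longrightarrow> (x', y') \<in> G \<Longrightarrow> (x \<oplus>\<^bsub>X\<^esub> x', y \<oplus>\<^bsub>Y\<^esub> y') \<in> G"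
    and "r \<in> carrier R \<Longrightarrow> (x, y) \<in> G \<Longrightarrow> (r \<odot>\<^bsub>X\<^esub> x, r \<odot>\<^bsub>Y\<^esub> y) \<in> G"
  using assms unfolding lin_rel_def by blast+

lemma lin_relI:
  assumes "\<And>x y. (x, y) \<in> G \<Longrightarrow> x \<in> carrier X \<and> y \<in> carrier Y"
    and "(\<zero>\<^bsub>X\<^esub>, \<zero>\<^bsub>Y\<^esub>) \<in> G"
    and "\<And>x y x' y'. (x, y) \<in> G \<Longrightarrow> (x', y') \<in> G \<Longrightarrow> (x \<oplus>\<^bsub>X\<^esub> x', y \<oplus>\<^bsub>Y\<^esub> y') \<in> G"
    and "\<And>r x y. r \<in> carrier R \<Longrightarrow> (x, y) \<in> G \<Longrightarrow> (r \<odot>\<^bsub>X\<^esub> x, r \<odot>\<^bsub>Y\<^esub> y) \<in> G"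
  shows "lin_rel R X Y G"
  using assms unfolding lin_rel_def by auto

lemma lin_rel_minus:
  assumes X: "module R X" and Y: "module R Y" and G: "lin_rel R X Y G" and xy: "(x, y) \<in> G"
  shows "(\<ominus>\<^bsub>X\<^esub> x, \<ominus>\<^bsub>Y\<^esub> y) \<in> G"
proof -
  interpret X: module R X by (rule X)
  interpret Y: module R Y by (rule Y)
  have "((\<ominus>\<^bsub>R\<^esub> \<one>\<^bsub>R\<^esub>) \<odot>\<^bsub>X\<^esub> x, (\<ominus>\<^bsub>R\<^esub> \<one>\<^bsub>R\<^esub>) \<odot>\<^bsub>Y\<^esub> y) \<in> G"
    using lin_relD(5)[OF G _ xy] by simp
  then show ?thesis
    using lin_relD(1,2)[OF G xy] X.smult_l_minus[of "\<one>\<^bsub>R\<^esub>" x] Y.smult_l_minus[of "\<one>\<^bsub>R\<^esub>" y] by simp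
qed

lemma lin_rel_diff:
  assumes "module R X" "module R Y" "lin_rel R X Y G" "(x, y) \<in> G" "(x', y') \<in> G"
  shows "(x \<oplus>\<^bsub>X\<^esub> \<ominus>\<^bsub>X\<^esub> x', y \<oplus>\<^bsub>Y\<^esub> \<ominus>\<^bsub>Y\<^esub> y') \<in> G"
  using lin_rel_minus[OF assms(1-3,5)] lin_relD(4)[OF assms(3,4)] by blast

text \<open>Two values at one point differ by a value at zero, so single-valuedness, exact or modulo
  a submodule, need only be tested at zero.\<close>

lemma lin_rel_same_left:
  assumes X: "module R X" and Y: "module R Y" and G: "lin_rel R X Y G"
    and "(x, y) \<in> G" "(x, y') \<in> G"
  shows "(\<zero>\<^bsub>X\<^esub>, y \<oplus>\<^bsub>Y\<^esub> \<ominus>\<^bsub>Y\<^esub> y') \<in> G"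
proof -
  interpret X: module R X by (rule X)
  show ?thesis using lin_rel_diff[OF assms] lin_relD(1)[OF G assms(4)] by (simp add: X.M.r_neg)
qed

lemma lin_rel_same_right:
  assumes X: "module R X" and Y: "module R Y" and G: "lin_rel R X Y G"
    and "(x, y) \<in> G" "(x', y) \<in> G"
  shows "(x \<oplus>\<^bsub>X\<^esub> \<ominus>\<^bsub>X\<^esub> x', \<zero>\<^bsub>Y\<^esub>) \<in> G"
proof -
  interpret Y: module R Y by (rule Y)
  show ?thesis using lin_rel_diff[OF assms] lin_relD(2)[OF G assms(4)] by (simp add: Y.M.r_neg)
qed

lemma submodule_lin_rel_preimage:
  assumes X: "module R X" and Y: "module R Y" and G: "lin_rel R X Y G"
    and L: "submodule L R X" and L': "submodule L' R Y"
  shows "submodule {x \<in> L. \<exists>y\<in>L'. (x, y) \<in> G} R X"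
    and "submodule {y \<in> L'. \<exists>x\<in>L. (x, y) \<in> G} R Y"
proof -
  interpret X: module R X by (rule X)
  interpret Y: module R Y by (rule Y)
  show "submodule {x \<in> L. \<exists>y\<in>L'. (x, y) \<in> G} R X"
    using L L' lin_relD(3-5)[OF G] unfolding X.submodule_iff Y.submodule_iff
    by (auto; blast)
  show "submodule {y \<in> L'. \<exists>x\<in>L. (x, y) \<in> G} R Y"
    using L L' lin_relD(3-5)[OF G] unfolding X.submodule_iff Y.submodule_iff
    by (auto; blast)
qed

section \<open>Finitely generated subquotients\<close>

text \<open>Finite generation and noetherianity of \<open>L/N\<close>, without forming the quotient.\<close>

definition rel_fg :: "('a, 'r) ring_scheme \<Rightarrow> ('a, 'm, 'x) module_scheme \<Rightarrow> 'm set \<Rightarrow> 'm set \<Rightarrow> bool" where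
  "rel_fg R X L N \<longleftrightarrow> (\<exists>A \<subseteq> L. finite A \<and> (\<forall>P. submodule P R X \<and> A \<subseteq> P \<and> N \<subseteq> P \<longrightarrow> L \<subseteq> P))"

lemma rel_fgI:
  assumes "A \<subseteq> L" "finite A"
    and "\<And>P. submodule P R X \<Longrightarrow> A \<subseteq> P \<Longrightarrow> N \<subseteq> P \<Longrightarrow> L \<subseteq> P"
  shows "rel_fg R X L N"
  unfolding rel_fg_def using assms by meson

lemma rel_fgE:
  assumes "rel_fg R X L N"
  obtains A where "A \<subseteq> L" "finite A"
    "\<And>P. submodule P R X \<Longrightarrow> A \<subseteq> P \<Longrightarrow> N \<subseteq> P \<Longrightarrow> L \<subseteq> P"
  using assms unfolding rel_fg_def by meson

definition rel_noeth :: "('a, 'r) ring_scheme \<Rightarrow> ('a, 'm, 'x) module_scheme \<Rightarrow> 'm set \<Rightarrow> 'm set \<Rightarrow> bool" where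
  "rel_noeth R X L N \<longleftrightarrow> (\<forall>P. submodule P R X \<and> P \<subseteq> L \<longrightarrow> rel_fg R X P (P \<inter> N))"

lemma rel_noeth_mono: "rel_noeth R X L N \<Longrightarrow> L' \<subseteq> L \<Longrightarrow> rel_noeth R X L' N"
  unfolding rel_noeth_def by blast

text \<open>Generators of the part of \<open>L''\<close> met by \<open>L\<close> are lifted,
  generators of the part of \<open>L'\<close> that \<open>G\<close> relates to \<open>L\<close> are
  pushed forward; together they generate \<open>L\<close> modulo \<open>N\<close>. The outer terms
  are taken Noetherian, not just finitely generated, because only the submodules \<open>Q'\<close>
  and \<open>Q''\<close> take part.\<close>

lemma rel_noeth_exact:
  assumes W: "module R W" and X: "module R X" and Y: "module R Y"
    and G: "lin_rel R W X G" and H: "lin_rel R X Y H"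
    and L': "submodule L' R W" and L: "submodule L R X" and L'': "submodule L'' R Y"
    and N': "submodule N' R W" and N: "N \<subseteq> L" and N'': "submodule N'' R Y"
    and noeth': "rel_noeth R W L' N'" and noeth'': "rel_noeth R Y L'' N''"
    and GN: "\<And>z x. z \<in> N' \<Longrightarrow> x \<in> L \<Longrightarrow> (z, x) \<in> G \<Longrightarrow> x \<in> N"
    and H_total: "\<And>x. x \<in> L \<Longrightarrow> \<exists>y\<in>L''. (x, y) \<in> H"
    and exact: "\<And>x y. x \<in> L \<Longrightarrow> y \<in> N'' \<Longrightarrow> (x, y) \<in> H \<Longrightarrow>
      \<exists>z\<in>L'. \<exists>x'\<in>L. (z, x') \<in> G \<and> x \<oplus>\<^bsub>X\<^esub> \<ominus>\<^bsub>X\<^esub> x' \<in> N"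
  shows "rel_fg R X L N"
proof -
  interpret W: module R W by (rule W)
  interpret X: module R X by (rule X)
  interpret Y: module R Y by (rule Y)
  define Q' where "Q' = {z \<in> L'. \<exists>x\<in>L. (z, x) \<in> G}"
  define Q'' where "Q'' = {y \<in> L''. \<exists>x\<in>L. (x, y) \<in> H}"
  have Q': "submodule Q' R W" and Q'': "submodule Q'' R Y"
    unfolding Q'_def Q''_def using submodule_lin_rel_preimage assms by blast+
  have "Q' \<subseteq> L'" "Q'' \<subseteq> L''" unfolding Q'_def Q''_def by auto
  then have "rel_fg R W Q' (Q' \<inter> N')" "rel_fg R Y Q'' (Q'' \<inter> N'')"
    using noeth' noeth'' Q' Q'' unfolding rel_noeth_def by auto
  then obtain A' A'' where A': "A' \<subseteq> Q'" "finite A'"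
      "\<And>P. submodule P R W \<Longrightarrow> A' \<subseteq> P \<Longrightarrow> Q' \<inter> N' \<subseteq> P \<Longrightarrow> Q' \<subseteq> P"
    and A'': "A'' \<subseteq> Q''" "finite A''"
      "\<And>P. submodule P R Y \<Longrightarrow> A'' \<subseteq> P \<Longrightarrow> Q'' \<inter> N'' \<subseteq> P \<Longrightarrow> Q'' \<subseteq> P"
    unfolding rel_fg_def by meson
  have "\<forall>a\<in>A'. \<exists>x\<in>L. (a, x) \<in> G" "\<forall>a\<in>A''. \<exists>x\<in>L. (x, a) \<in> H"
    using A'(1) A''(1) unfolding Q'_def Q''_def by auto
  then obtain w v where w: "\<And>a. a \<in> A' \<Longrightarrow> w a \<in> L \<and> (a, w a) \<in> G"
    and v: "\<And>a. a \<in> A'' \<Longrightarrow> v a \<in> L \<and> (v a, a) \<in> H"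
    by metis
  have "L \<subseteq> P" if P: "submodule P R X" and sub: "w ` A' \<union> v ` A'' \<subseteq> P" "N \<subseteq> P" for P
  proof -
    have LX: "x \<in> carrier X" if "x \<in> L" for x using that L X.submodule_iff by auto
    \<comment> \<open>Two partners of the same \<open>z\<close> differ by an element of
      \<open>N \<subseteq> P\<close>, so a single partner in \<open>P\<close> forces all of them
      into \<open>P\<close>. This makes \<open>?S'\<close> a submodule, and it contains the
      generators \<open>A'\<close> by the choice of \<open>w\<close>.\<close>
    let ?S' = "{z \<in> Q'. \<forall>x\<in>L. (z, x) \<in> G \<longrightarrow> x \<in> P}"
    have in_P: "x \<in> P" if "x0 \<in> L" "x0 \<in> P" "x \<in> L" "(a, x0) \<in> G" "(a, x) \<in> G" for a x x0
    proof -
      have "(\<zero>\<^bsub>W\<^esub>, x \<oplus>\<^bsub>X\<^esub> \<ominus>\<^bsub>X\<^esub> x0) \<in> G" using lin_rel_same_left[OF W X G] that by blast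
      moreover have "\<zero>\<^bsub>W\<^esub> \<in> N'" using N' W.submodule_iff by auto
      ultimately have "x \<oplus>\<^bsub>X\<^esub> \<ominus>\<^bsub>X\<^esub> x0 \<in> P"
        using GN sub X.submodule_sub[OF L that(3,1)] by blast
      then show ?thesis using X.submodule_diff_cancel[OF P] that LX by blast
    qed
    have wP: "\<exists>x0\<in>L. x0 \<in> P \<and> (z, x0) \<in> G" if "z \<in> ?S'" for z
      using that unfolding Q'_def by auto
    have "submodule ?S' R W"
      unfolding W.submodule_iff
    proof (intro conjI ballI)
      show "?S' \<subseteq> carrier W" using Q' W.submodule_iff by auto
      have z: "\<zero>\<^bsub>W\<^esub> \<in> Q'" "\<zero>\<^bsub>X\<^esub> \<in> L" "\<zero>\<^bsub>X\<^esub> \<in> P"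
        using Q' W.submodule_iff L P X.submodule_iff by auto
      then show "\<zero>\<^bsub>W\<^esub> \<in> ?S'" using in_P lin_relD(3)[OF G] by blast
    next
      fix z1 z2 assume z: "z1 \<in> ?S'" "z2 \<in> ?S'"
      obtain x1 x2 where x: "x1 \<in> L" "x1 \<in> P" "(z1, x1) \<in> G" "x2 \<in> L" "x2 \<in> P" "(z2, x2) \<in> G"
        using wP z by meson
      then have "x1 \<oplus>\<^bsub>X\<^esub> x2 \<in> L" "x1 \<oplus>\<^bsub>X\<^esub> x2 \<in> P" "(z1 \<oplus>\<^bsub>W\<^esub> z2, x1 \<oplus>\<^bsub>X\<^esub> x2) \<in> G"
        using L P X.submodule_iff lin_relD(4)[OF G] by auto
      moreover have "z1 \<oplus>\<^bsub>W\<^esub> z2 \<in> Q'" using z Q' W.submodule_iff by auto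
      ultimately show "z1 \<oplus>\<^bsub>W\<^esub> z2 \<in> ?S'" using in_P by blast
    next
      fix r z assume r: "r \<in> carrier R" and z: "z \<in> ?S'"
      obtain x where x: "x \<in> L" "x \<in> P" "(z, x) \<in> G" using wP z by meson
      then have "r \<odot>\<^bsub>X\<^esub> x \<in> L" "r \<odot>\<^bsub>X\<^esub> x \<in> P" "(r \<odot>\<^bsub>W\<^esub> z, r \<odot>\<^bsub>X\<^esub> x) \<in> G"
        using L P X.submodule_iff lin_relD(5)[OF G] r by auto
      moreover have "r \<odot>\<^bsub>W\<^esub> z \<in> Q'" using r z Q' W.submodule_iff by auto
      ultimately show "r \<odot>\<^bsub>W\<^esub> z \<in> ?S'" using in_P by blast
    qed
    moreover have "A' \<subseteq> ?S'"
    proof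
      fix a assume a: "a \<in> A'"
      have "w a \<in> L" "w a \<in> P" "(a, w a) \<in> G" using w[OF a] sub(1) a by auto
      then show "a \<in> ?S'" using in_P A'(1) a by blast
    qed
    moreover have "Q' \<inter> N' \<subseteq> ?S'" using GN sub by auto
    ultimately have "Q' \<subseteq> ?S'" using A'(3) by blast
    then have GP: "x \<in> P" if "z \<in> L'" "x \<in> L" "(z, x) \<in> G" for z x
      using that unfolding Q'_def by auto
    \<comment> \<open>The same argument one place to the right: exactness puts every element lying
      over \<open>N''\<close> into \<open>P\<close>, in particular the difference of two elements
      with a common partner.\<close>
    let ?S = "{y \<in> Q''. \<forall>x\<in>L. (x, y) \<in> H \<longrightarrow> x \<in> P}"
    have HN: "x \<in> P" if x: "x \<in> L" "y \<in> N''" "(x, y) \<in> H" for x y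
      using exact[OF x] GP X.submodule_diff_cancel[OF P LX[OF x(1)]] sub by blast
    have in_P: "x \<in> P" if "x0 \<in> L" "x0 \<in> P" "x \<in> L" "(x0, a) \<in> H" "(x, a) \<in> H" for a x x0
    proof -
      have "(x \<oplus>\<^bsub>X\<^esub> \<ominus>\<^bsub>X\<^esub> x0, \<zero>\<^bsub>Y\<^esub>) \<in> H" using lin_rel_same_right[OF X Y H] that by blast
      moreover have "\<zero>\<^bsub>Y\<^esub> \<in> N''" using N'' Y.submodule_iff by auto
      ultimately have "x \<oplus>\<^bsub>X\<^esub> \<ominus>\<^bsub>X\<^esub> x0 \<in> P"
        using HN X.submodule_sub[OF L that(3,1)] by blast
      then show ?thesis using X.submodule_diff_cancel[OF P] that LX by blast
    qed
    have vP: "\<exists>x0\<in>L. x0 \<in> P \<and> (x0, y) \<in> H" if "y \<in> ?S" for y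
      using that unfolding Q''_def by auto
    have "submodule ?S R Y"
      unfolding Y.submodule_iff
    proof (intro conjI ballI)
      show "?S \<subseteq> carrier Y" using Q'' Y.submodule_iff by auto
      have z: "\<zero>\<^bsub>Y\<^esub> \<in> Q''" "\<zero>\<^bsub>X\<^esub> \<in> L" "\<zero>\<^bsub>X\<^esub> \<in> P"
        using Q'' Y.submodule_iff L P X.submodule_iff by auto
      then show "\<zero>\<^bsub>Y\<^esub> \<in> ?S" using in_P lin_relD(3)[OF H] by blast
    next
      fix z1 z2 assume z: "z1 \<in> ?S" "z2 \<in> ?S"
      obtain x1 x2 where x: "x1 \<in> L" "x1 \<in> P" "(x1, z1) \<in> H" "x2 \<in> L" "x2 \<in> P" "(x2, z2) \<in> H"
        using vP z by meson
      then have "x1 \<oplus>\<^bsub>X\<^esub> x2 \<in> L" "x1 \<oplus>\<^bsub>X\<^esub> x2 \<in> P" "(x1 \<oplus>\<^bsub>X\<^esub> x2, z1 \<oplus>\<^bsub>Y\<^esub> z2) \<in> H"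
        using L P X.submodule_iff lin_relD(4)[OF H] by auto
      moreover have "z1 \<oplus>\<^bsub>Y\<^esub> z2 \<in> Q''" using z Q'' Y.submodule_iff by auto
      ultimately show "z1 \<oplus>\<^bsub>Y\<^esub> z2 \<in> ?S" using in_P by blast
    next
      fix r z assume r: "r \<in> carrier R" and z: "z \<in> ?S"
      obtain x where x: "x \<in> L" "x \<in> P" "(x, z) \<in> H" using vP z by meson
      then have "r \<odot>\<^bsub>X\<^esub> x \<in> L" "r \<odot>\<^bsub>X\<^esub> x \<in> P" "(r \<odot>\<^bsub>X\<^esub> x, r \<odot>\<^bsub>Y\<^esub> z) \<in> H"
        using L P X.submodule_iff lin_relD(5)[OF H] r by auto
      moreover have "r \<odot>\<^bsub>Y\<^esub> z \<in> Q''" using r z Q'' Y.submodule_iff by auto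
      ultimately show "r \<odot>\<^bsub>Y\<^esub> z \<in> ?S" using in_P by blast
    qed
    moreover have "A'' \<subseteq> ?S"
    proof
      fix a assume a: "a \<in> A''"
      have "v a \<in> L" "v a \<in> P" "(v a, a) \<in> H" using v[OF a] sub(1) a by auto
      then show "a \<in> ?S" using in_P A''(1) a by blast
    qed
    moreover have "Q'' \<inter> N'' \<subseteq> ?S" using HN by auto
    ultimately have "Q'' \<subseteq> ?S" using A''(3) by blast
    then show "L \<subseteq> P" using H_total unfolding Q''_def by blast
  qed
  moreover have "w ` A' \<union> v ` A'' \<subseteq> L" "finite (w ` A' \<union> v ` A'')"
    using w v A'(2) A''(2) by auto
  ultimately show ?thesis unfolding rel_fg_def by meson
qed

section \<open>Finitely generated modules over a Noetherian ring are Noetherian\<close>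

locale noetherian_cring = noetherian_ring R + cring R for R (structure)

lemma regular_module_simps [simp]:
  "carrier (regular_module R) = carrier R"
  "\<zero>\<^bsub>regular_module R\<^esub> = \<zero>\<^bsub>R\<^esub>"
  "x \<oplus>\<^bsub>regular_module R\<^esub> y = x \<oplus>\<^bsub>R\<^esub> y"
  "r \<odot>\<^bsub>regular_module R\<^esub> x = r \<otimes>\<^bsub>R\<^esub> x"
  by (simp_all add: regular_module_def)

lemma (in cring) regular_module: "module R (regular_module R)"
proof (rule moduleI)
  show "abelian_group (regular_module R)"
  proof (rule abelian_groupI)
    fix x assume "x \<in> carrier (regular_module R)"
    then show "\<exists>y\<in>carrier (regular_module R). y \<oplus>\<^bsub>regular_module R\<^esub> x = \<zero>\<^bsub>regular_module R\<^esub>"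
      using l_neg by auto
  qed (simp_all add: a_ac)
qed (simp_all add: l_distr r_distr m_assoc is_cring)

lemma (in cring) submodule_regular_iff_ideal: "submodule J R (regular_module R) \<longleftrightarrow> ideal J R"
proof -
  interpret S: module R "regular_module R" by (rule regular_module)
  show ?thesis
  proof
    assume J: "submodule J R (regular_module R)"
    show "ideal J R"
    proof (rule idealI)
      show "subgroup J (add_monoid R)"
      proof (rule add.subgroupI)
        show "J \<subseteq> carrier R" "J \<noteq> {}" using S.submoduleE(1,2)[OF J] by simp_all
        fix x assume x: "x \<in> J"
        then have "(\<ominus> \<one>) \<otimes> x \<in> J" "x \<in> carrier R"
          using S.submoduleE(4)[OF J, of "\<ominus> \<one>" x] S.submoduleE(1)[OF J] by auto
        then show "\<ominus> x \<in> J" by (simp add: l_minus)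
      next
        fix x y assume "x \<in> J" "y \<in> J"
        then show "x \<oplus> y \<in> J" using S.submoduleE(5)[OF J, of x y] by simp
      qed
      fix a x assume a: "a \<in> J" and x: "x \<in> carrier R"
      show xa: "x \<otimes> a \<in> J" using S.submoduleE(4)[OF J x a] by simp
      have "a \<in> carrier R" using S.submoduleE(1)[OF J] a by auto
      then show "a \<otimes> x \<in> J" using xa x m_comm by simp
    qed (rule ring_axioms)
  next
    assume J: "ideal J R"
    then interpret J: ideal J R .
    show "submodule J R (regular_module R)"
      using J.Icarr J.I_l_closed by (simp add: S.submodule_iff subset_iff)
  qed
qed

lemma (in noetherian_cring) rel_noeth_regular:
  "rel_noeth R (regular_module R) (carrier R) {\<zero>}"
  unfolding rel_noeth_def
proof (intro allI impI)
  fix J assume "submodule J R (regular_module R) \<and> J \<subseteq> carrier R"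
  then have "ideal J R" by (simp add: submodule_regular_iff_ideal)
  then obtain A where A: "A \<subseteq> carrier R" "finite A" "J = Idl A" using finetely_gen by blast
  have "A \<subseteq> J" using genideal_self[OF A(1)] A(3) by simp
  moreover have "J \<subseteq> P" if "submodule P R (regular_module R)" "A \<subseteq> P" for P
    using genideal_minimal[of P A] that A(3) by (simp add: submodule_regular_iff_ideal)
  ultimately show "rel_fg R (regular_module R) J (J \<inter> {\<zero>})"
    unfolding rel_fg_def using A(2) by (intro exI[of _ A]) simp
qed

text \<open>Here \<open>T = S + Ra\<close>. Relating \<open>x\<close> to every \<open>r\<close> with
  \<open>x - ra \<in> S\<close> has fibre \<open>S\<close> over zero, so \<open>T/N\<close> is
  squeezed between \<open>S/N\<close> and \<open>R\<close>. Such an \<open>r\<close> is determined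
  only modulo \<open>(S : a)\<close>, which is why \<open>H\<close> is a relation.\<close>

lemma (in noetherian_cring) submodule_adjoin_rel_noeth:
  assumes X: "module R X" and N: "submodule N R X" and S: "submodule S R X" "N \<subseteq> S"
    and noeth: "rel_noeth R X S N" and a: "a \<in> carrier X"
  defines "T \<equiv> {x \<in> carrier X. \<exists>r\<in>carrier R. x \<oplus>\<^bsub>X\<^esub> \<ominus>\<^bsub>X\<^esub> (r \<odot>\<^bsub>X\<^esub> a) \<in> S}"
  shows "submodule T R X" "S \<subseteq> T" "a \<in> T" "rel_noeth R X T N"
proof -
  interpret X: module R X by (rule X)
  interpret S: module R "regular_module R" by (rule regular_module)
  define H where "H = {(x, r). x \<in> carrier X \<and> r \<in> carrier R \<and> x \<oplus>\<^bsub>X\<^esub> \<ominus>\<^bsub>X\<^esub> (r \<odot>\<^bsub>X\<^esub> a) \<in> S}"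
  have Sc: "\<And>x. x \<in> S \<Longrightarrow> x \<in> carrier X" and Sz: "\<zero>\<^bsub>X\<^esub> \<in> S"
    and Sadd: "\<And>x y. x \<in> S \<Longrightarrow> y \<in> S \<Longrightarrow> x \<oplus>\<^bsub>X\<^esub> y \<in> S"
    and Ssm: "\<And>r x. r \<in> carrier R \<Longrightarrow> x \<in> S \<Longrightarrow> r \<odot>\<^bsub>X\<^esub> x \<in> S"
    using S(1) unfolding X.submodule_iff by blast+
  have H: "lin_rel R X (regular_module R) H"
  proof (rule lin_relI)
    show "(\<zero>\<^bsub>X\<^esub>, \<zero>\<^bsub>regular_module R\<^esub>) \<in> H"
      unfolding H_def using a Sz by simp
  next
    fix x r x' r' assume "(x, r) \<in> H" "(x', r') \<in> H"
    then have xr: "x \<in> carrier X" "x' \<in> carrier X" "r \<in> carrier R" "r' \<in> carrier R"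
      and "(x \<oplus>\<^bsub>X\<^esub> \<ominus>\<^bsub>X\<^esub> (r \<odot>\<^bsub>X\<^esub> a)) \<oplus>\<^bsub>X\<^esub> (x' \<oplus>\<^bsub>X\<^esub> \<ominus>\<^bsub>X\<^esub> (r' \<odot>\<^bsub>X\<^esub> a)) \<in> S"
      unfolding H_def using Sadd by simp_all
    moreover have "(x \<oplus>\<^bsub>X\<^esub> \<ominus>\<^bsub>X\<^esub> (r \<odot>\<^bsub>X\<^esub> a)) \<oplus>\<^bsub>X\<^esub> (x' \<oplus>\<^bsub>X\<^esub> \<ominus>\<^bsub>X\<^esub> (r' \<odot>\<^bsub>X\<^esub> a))
        = (x \<oplus>\<^bsub>X\<^esub> x') \<oplus>\<^bsub>X\<^esub> \<ominus>\<^bsub>X\<^esub> ((r \<oplus> r') \<odot>\<^bsub>X\<^esub> a)"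
      using xr a by (simp add: X.smult_l_distr X.M.minus_add X.M.a_ac)
    ultimately show "(x \<oplus>\<^bsub>X\<^esub> x', r \<oplus>\<^bsub>regular_module R\<^esub> r') \<in> H"
      unfolding H_def by simp
  next
    fix s x r assume s: "s \<in> carrier R" and "(x, r) \<in> H"
    then have xr: "x \<in> carrier X" "r \<in> carrier R"
      and "s \<odot>\<^bsub>X\<^esub> (x \<oplus>\<^bsub>X\<^esub> \<ominus>\<^bsub>X\<^esub> (r \<odot>\<^bsub>X\<^esub> a)) \<in> S"
      unfolding H_def using Ssm[OF s] by simp_all
    then show "(s \<odot>\<^bsub>X\<^esub> x, s \<odot>\<^bsub>regular_module R\<^esub> r) \<in> H"
      using s a unfolding H_def
      by (simp add: X.smult_r_distr X.smult_r_minus X.smult_assoc1)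
  qed (auto simp: H_def)
  have T_eq: "T = {x \<in> carrier X. \<exists>r\<in>carrier (regular_module R). (x, r) \<in> H}"
    unfolding T_def H_def by auto
  show T: "submodule T R X"
    unfolding T_eq
    by (rule submodule_lin_rel_preimage(1)[OF X regular_module H X.carrier_is_submodule S.carrier_is_submodule])
  have zero_r: "x \<oplus>\<^bsub>X\<^esub> \<ominus>\<^bsub>X\<^esub> (\<zero> \<odot>\<^bsub>X\<^esub> a) = x" if "x \<in> carrier X" for x using that a by simp
  show "S \<subseteq> T"
  proof
    fix x assume "x \<in> S"
    then show "x \<in> T" unfolding T_def by (auto simp: zero_r Sc intro!: bexI[of _ \<zero>])
  qed
  have "a \<oplus>\<^bsub>X\<^esub> \<ominus>\<^bsub>X\<^esub> (\<one> \<odot>\<^bsub>X\<^esub> a) \<in> S" using a Sz by (simp add: X.M.r_neg)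
  then show "a \<in> T" unfolding T_def using a by blast
  show "rel_noeth R X T N"
    unfolding rel_noeth_def
  proof (intro allI impI)
    fix L assume L: "submodule L R X \<and> L \<subseteq> T"
    show "rel_fg R X L (L \<inter> N)"
    \<comment> \<open>Noetherianity quantifies over submodules, so the sequence is set up for each
      \<open>L \<subseteq> T\<close> separately, with \<open>L \<inter> N\<close> in the middle. The
      identity serves as left map; as a relation from \<open>S\<close> to \<open>L\<close> it is
      only partially defined.\<close>
    proof (rule rel_noeth_exact[where G = "Id_on (carrier X)" and H = H and L' = S and N' = N
          and L'' = "carrier (regular_module R)" and N'' = "{\<zero>\<^bsub>regular_module R\<^esub>}"])
      show "rel_noeth R (regular_module R) (carrier (regular_module R)) {\<zero>\<^bsub>regular_module R\<^esub>}"
        using rel_noeth_regular by simp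
      show "lin_rel R X X (Id_on (carrier X))" by (rule lin_relI) (auto simp: Id_on_def)
      fix x assume "x \<in> L"
      then show "\<exists>y\<in>carrier (regular_module R). (x, y) \<in> H" using L unfolding T_eq by auto
    next
      fix x y assume x: "x \<in> L" "y \<in> {\<zero>\<^bsub>regular_module R\<^esub>}" "(x, y) \<in> H"
      then have "x \<in> carrier X" "x \<oplus>\<^bsub>X\<^esub> \<ominus>\<^bsub>X\<^esub> (\<zero> \<odot>\<^bsub>X\<^esub> a) \<in> S"
        unfolding H_def by auto
      then have "x \<in> S" "x \<in> carrier X" using zero_r by auto
      moreover have "\<zero>\<^bsub>X\<^esub> \<in> L" "\<zero>\<^bsub>X\<^esub> \<in> N" using L N X.submodule_iff by auto
      ultimately show "\<exists>z\<in>S. \<exists>x'\<in>L. (z, x') \<in> Id_on (carrier X) \<and> x \<oplus>\<^bsub>X\<^esub> \<ominus>\<^bsub>X\<^esub> x' \<in> L \<inter> N"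
        using x(1) by (intro bexI[of _ x] conjI) (auto simp: X.M.r_neg)
    next
      show "x \<in> L \<inter> N" if "z \<in> N" "x \<in> L" "(z, x) \<in> Id_on (carrier X)" for z x
        using that by auto
    qed (use X regular_module H S L N noeth S.carrier_is_submodule S.submodule_zero in simp_all)
  qed
qed

text \<open>Induction on the generators, starting from \<open>N/N = 0\<close> and adjoining one at a
  time. The last submodule contains \<open>N\<close> and all generators, hence
  \<open>L\<close>.\<close>

lemma (in noetherian_cring) rel_fg_imp_rel_noeth:
  assumes X: "module R X" and N: "submodule N R X" and L: "L \<subseteq> carrier X" and fg: "rel_fg R X L N"
  shows "rel_noeth R X L N"
proof -
  interpret X: module R X by (rule X)
  obtain A where A: "A \<subseteq> L" "finite A" "\<And>P. submodule P R X \<Longrightarrow> A \<subseteq> P \<Longrightarrow> N \<subseteq> P \<Longrightarrow> L \<subseteq> P"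
    by (rule rel_fgE[OF fg]) (rule that; assumption)
  have "A \<subseteq> carrier X" using A L by auto
  from A(2) this have "\<exists>S. submodule S R X \<and> A \<subseteq> S \<and> N \<subseteq> S \<and> rel_noeth R X S N"
  proof (induction A)
    case empty
    have "rel_fg R X P (P \<inter> N)" if "P \<subseteq> N" for P
      by (rule rel_fgI[of "{}"]) (use that in auto)
    then have "rel_noeth R X N N" unfolding rel_noeth_def by blast
    with N show ?case by blast
  next
    case (insert a A)
    then obtain S where S: "submodule S R X" "A \<subseteq> S" "N \<subseteq> S" "rel_noeth R X S N" by blast
    have a: "a \<in> carrier X" using insert.prems by simp
    obtain T where T: "submodule T R X" "S \<subseteq> T" "a \<in> T" "rel_noeth R X T N"
      using submodule_adjoin_rel_noeth[OF X N S(1,3,4) a] by (rule that)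
    show ?case by (rule exI[of _ T]) (use S(2,3) T in blast)
  qed
  then show ?thesis using A(3) rel_noeth_mono by metis
qed

text \<open>Linear relations \<open>G\<close> and \<open>H\<close> stand for homomorphisms \<open>L'/N' \<rightarrow> L/N \<rightarrow> L''/N''\<close>; this covers
  connecting homomorphisms without choosing lifts.\<close>

lemma (in noetherian_cring) rel_fg_exact:
  assumes "module R W" "module R X" "module R Y"
    and "lin_rel R W X G" "lin_rel R X Y H"
    and "submodule L' R W" "submodule L R X" "submodule L'' R Y"
    and "submodule N' R W" "N \<subseteq> L" "submodule N'' R Y"
    and "rel_fg R W L' N'" "rel_fg R Y L'' N''"
    and "\<And>z x. z \<in> N' \<Longrightarrow> x \<in> L \<Longrightarrow> (z, x) \<in> G \<Longrightarrow> x \<in> N"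
    and "\<And>x. x \<in> L \<Longrightarrow> \<exists>y\<in>L''. (x, y) \<in> H"
    and "\<And>x y. x \<in> L \<Longrightarrow> y \<in> N'' \<Longrightarrow> (x, y) \<in> H \<Longrightarrow>
      \<exists>z\<in>L'. \<exists>x'\<in>L. (z, x') \<in> G \<and> x \<oplus>\<^bsub>X\<^esub> \<ominus>\<^bsub>X\<^esub> x' \<in> N"
  shows "rel_fg R X L N"
proof -
  interpret W: module R W by fact
  interpret Y: module R Y by fact
  show ?thesis
    by (rule rel_noeth_exact[OF assms(1-11) rel_fg_imp_rel_noeth[OF assms(1,9) _ assms(12)]
          rel_fg_imp_rel_noeth[OF assms(3,11) _ assms(13)] assms(14-16)])
      (use W.submoduleE(1) Y.submoduleE(1) assms(6,8) in blast)+
qed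

text \<open>The zero at the left end of \<open>0 \<rightarrow> L/N \<rightarrow> L''/N''\<close> is
  realised as \<open>N/N\<close>. Only the preimage of \<open>N''\<close> is confined to
  \<open>N\<close>, so \<open>N\<close> may exceed the kernel of \<open>H\<close>; then
  \<open>L/N\<close> is a quotient of a submodule of \<open>L''/N''\<close>.\<close>

lemma (in noetherian_cring) rel_fg_inj:
  assumes X: "module R X" and Y: "module R Y" and H: "lin_rel R X Y H"
    and L: "submodule L R X" and L'': "submodule L'' R Y" and N: "submodule N R X" "N \<subseteq> L"
    and N'': "submodule N'' R Y" and fg: "rel_fg R Y L'' N''"
    and total: "\<And>x. x \<in> L \<Longrightarrow> \<exists>y\<in>L''. (x, y) \<in> H"
    and inj: "\<And>x y. x \<in> L \<Longrightarrow> y \<in> N'' \<Longrightarrow> (x, y) \<in> H \<Longrightarrow> x \<in> N"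
  shows "rel_fg R X L N"
proof -
  interpret X: module R X by (rule X)
  show ?thesis
  proof (rule rel_fg_exact[OF X X Y _ H N(1) L L'' N(1,2) N'' _ fg])
    show "lin_rel R X X (Id_on (carrier X))" by (rule lin_relI) (auto simp: Id_on_def)
    show "rel_fg R X N N" by (rule rel_fgI[of "{}"]) auto
    fix x y assume x: "x \<in> L" "y \<in> N''" "(x, y) \<in> H"
    then show "\<exists>z\<in>N. \<exists>x'\<in>L. (z, x') \<in> Id_on (carrier X) \<and> x \<oplus>\<^bsub>X\<^esub> \<ominus>\<^bsub>X\<^esub> x' \<in> N"
      using inj[OF x] lin_relD(1)[OF H x(3)] subgroup.one_closed[OF submodule.axioms(1)[OF N(1)]]
      by (intro bexI[of _ x] conjI) (simp_all add: X.M.r_neg x Id_onI)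
  next
    show "x \<in> N" if "z \<in> N" "x \<in> L" "(z, x) \<in> Id_on (carrier X)" for z x
      using that by auto
  qed (use total in simp_all)
qed

lemma (in module) rel_fg_carrier_iff: "rel_fg R M (carrier M) {\<zero>\<^bsub>M\<^esub>} \<longleftrightarrow> fin_gen R M"
proof
  assume "rel_fg R M (carrier M) {\<zero>\<^bsub>M\<^esub>}"
  then obtain A where A: "A \<subseteq> carrier M" "finite A"
    "\<And>P. submodule P R M \<Longrightarrow> A \<subseteq> P \<Longrightarrow> {\<zero>\<^bsub>M\<^esub>} \<subseteq> P \<Longrightarrow> carrier M \<subseteq> P"
    by (rule rel_fgE) (rule that; assumption)
  have "P = carrier M" if "submodule P R M \<and> A \<subseteq> P" for P
    using A(3)[of P] that by (simp add: submodule_iff subset_antisym)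
  with A(1,2) show "fin_gen R M" unfolding fin_gen_def by meson
next
  assume "fin_gen R M"
  then obtain A where A: "A \<subseteq> carrier M" "finite A"
    "\<And>P. submodule P R M \<and> A \<subseteq> P \<longrightarrow> P = carrier M"
    unfolding fin_gen_def by meson
  then show "rel_fg R M (carrier M) {\<zero>\<^bsub>M\<^esub>}" by (intro rel_fgI[of A]) simp_all
qed

lemma lin_rel_converse: "lin_rel R X Y G \<Longrightarrow> lin_rel R Y X (G\<inverse>)"
  unfolding lin_rel_def by auto

text \<open>The relation and its converse are both injective modulo the given submodules, so finite
  generation passes in either direction.\<close>

lemma (in noetherian_cring) rel_fg_cong:
  assumes X: "module R X" and Y: "module R Y" and H: "lin_rel R X Y H"
    and L: "submodule L R X" and L'': "submodule L'' R Y"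
    and N: "submodule N R X" "N \<subseteq> L" and N'': "submodule N'' R Y" "N'' \<subseteq> L''"
    and total: "\<And>x. x \<in> L \<Longrightarrow> \<exists>y\<in>L''. (x, y) \<in> H"
    and surj: "\<And>y. y \<in> L'' \<Longrightarrow> \<exists>x\<in>L. (x, y) \<in> H"
    and iff: "\<And>x y. x \<in> L \<Longrightarrow> y \<in> L'' \<Longrightarrow> (x, y) \<in> H \<Longrightarrow> x \<in> N \<longleftrightarrow> y \<in> N''"
  shows "rel_fg R X L N \<longleftrightarrow> rel_fg R Y L'' N''"
proof
  assume "rel_fg R Y L'' N''"
  then show "rel_fg R X L N"
    by (rule rel_fg_inj[OF X Y H L L'' N N''(1)]) (use total iff N''(2) in blast)+
next
  assume "rel_fg R X L N"
  then show "rel_fg R Y L'' N''"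
    by (rule rel_fg_inj[OF Y X lin_rel_converse[OF H] L'' L N'' N(1)]) (use surj iff N(2) in blast)+
qed

section \<open>Homomorphisms and quotients\<close>

lemma mod_homI:
  assumes "\<And>x. x \<in> carrier M \<Longrightarrow> f x \<in> carrier N"
    and "\<And>x y. x \<in> carrier M \<Longrightarrow> y \<in> carrier M \<Longrightarrow> f (x \<oplus>\<^bsub>M\<^esub> y) = f x \<oplus>\<^bsub>N\<^esub> f y"
    and "\<And>r x. r \<in> carrier R \<Longrightarrow> x \<in> carrier M \<Longrightarrow> f (r \<odot>\<^bsub>M\<^esub> x) = r \<odot>\<^bsub>N\<^esub> f x"
  shows "f \<in> mod_hom R M N"
  using assms unfolding mod_hom_def by simp

lemma mod_homD:
  assumes "f \<in> mod_hom R M N"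
  shows "x \<in> carrier M \<Longrightarrow> f x \<in> carrier N"
    and "x \<in> carrier M \<Longrightarrow> y \<in> carrier M \<Longrightarrow> f (x \<oplus>\<^bsub>M\<^esub> y) = f x \<oplus>\<^bsub>N\<^esub> f y"
    and "r \<in> carrier R \<Longrightarrow> x \<in> carrier M \<Longrightarrow> f (r \<odot>\<^bsub>M\<^esub> x) = r \<odot>\<^bsub>N\<^esub> f x"
  using assms unfolding mod_hom_def by auto

lemma mod_hom_zero:
  assumes M: "module R M" and N: "module R N" and f: "f \<in> mod_hom R M N"
  shows "f \<zero>\<^bsub>M\<^esub> = \<zero>\<^bsub>N\<^esub>"
proof -
  interpret M: module R M by (rule M)
  interpret N: module R N by (rule N)
  have "f (\<zero>\<^bsub>R\<^esub> \<odot>\<^bsub>M\<^esub> \<zero>\<^bsub>M\<^esub>) = \<zero>\<^bsub>R\<^esub> \<odot>\<^bsub>N\<^esub> f \<zero>\<^bsub>M\<^esub>" by (rule mod_homD(3)[OF f]) auto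
  then show ?thesis using mod_homD(1)[OF f] by simp
qed

lemma mod_hom_minus:
  assumes M: "module R M" and N: "module R N" and f: "f \<in> mod_hom R M N" and x: "x \<in> carrier M"
  shows "f (\<ominus>\<^bsub>M\<^esub> x) = \<ominus>\<^bsub>N\<^esub> f x"
proof -
  interpret M: module R M by (rule M)
  interpret N: module R N by (rule N)
  have "f ((\<ominus>\<^bsub>R\<^esub> \<one>\<^bsub>R\<^esub>) \<odot>\<^bsub>M\<^esub> x) = (\<ominus>\<^bsub>R\<^esub> \<one>\<^bsub>R\<^esub>) \<odot>\<^bsub>N\<^esub> f x" by (rule mod_homD(3)[OF f]) (auto simp: x)
  then show ?thesis using mod_homD(1)[OF f x] x by (simp add: M.smult_l_minus N.smult_l_minus)
qed

lemma mod_hom_diff: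
  assumes "module R M" "module R N" "f \<in> mod_hom R M N" "x \<in> carrier M" "y \<in> carrier M"
  shows "f (x \<oplus>\<^bsub>M\<^esub> \<ominus>\<^bsub>M\<^esub> y) = f x \<oplus>\<^bsub>N\<^esub> \<ominus>\<^bsub>N\<^esub> f y"
proof -
  interpret M: module R M by fact
  show ?thesis using assms by (simp add: mod_homD(2)[OF assms(3)] mod_hom_minus[OF assms(1-3)])
qed

lemma mod_hom_comp:
  "f \<in> mod_hom R M N \<Longrightarrow> g \<in> mod_hom R N P \<Longrightarrow> (\<lambda>x. g (f x)) \<in> mod_hom R M P"
  by (rule mod_homI) (simp_all add: mod_homD)

lemma submodule_kernel:
  assumes M: "module R M" and N: "module R N" and f: "f \<in> mod_hom R M N"
  shows "submodule (a_kernel M N f) R M"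
proof -
  interpret M: module R M by (rule M)
  interpret N: module R N by (rule N)
  show ?thesis
    unfolding M.submodule_iff a_kernel_def'
    using mod_homD[OF f] mod_hom_zero[OF M N f] by auto
qed

lemma submodule_image:
  assumes M: "module R M" and N: "module R N" and f: "f \<in> mod_hom R M N" and K: "submodule K R M"
  shows "submodule (f ` K) R N"
proof -
  interpret M: module R M by (rule M)
  interpret N: module R N by (rule N)
  have K': "K \<subseteq> carrier M" "\<zero>\<^bsub>M\<^esub> \<in> K" "\<And>x y. x \<in> K \<Longrightarrow> y \<in> K \<Longrightarrow> x \<oplus>\<^bsub>M\<^esub> y \<in> K"
    "\<And>r x. r \<in> carrier R \<Longrightarrow> x \<in> K \<Longrightarrow> r \<odot>\<^bsub>M\<^esub> x \<in> K"
    using K unfolding M.submodule_iff by blast+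
  show ?thesis
    unfolding N.submodule_iff
  proof (intro conjI ballI)
    show "f ` K \<subseteq> carrier N" using mod_homD(1)[OF f] K' by auto
    show "\<zero>\<^bsub>N\<^esub> \<in> f ` K" using mod_hom_zero[OF M N f] K'(2) by (metis image_eqI)
  next
    fix u v assume "u \<in> f ` K" "v \<in> f ` K"
    then obtain x y where "x \<in> K" "y \<in> K" "u = f x" "v = f y" by auto
    then have "u \<oplus>\<^bsub>N\<^esub> v = f (x \<oplus>\<^bsub>M\<^esub> y)" "x \<oplus>\<^bsub>M\<^esub> y \<in> K" using mod_homD(2)[OF f] K' by (auto simp: subset_iff)
    then show "u \<oplus>\<^bsub>N\<^esub> v \<in> f ` K" by simp
  next
    fix r u assume r: "r \<in> carrier R" "u \<in> f ` K"
    then obtain x where "x \<in> K" "u = f x" by auto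
    then have "r \<odot>\<^bsub>N\<^esub> u = f (r \<odot>\<^bsub>M\<^esub> x)" "r \<odot>\<^bsub>M\<^esub> x \<in> K" using r mod_homD(3)[OF f] K' by (auto simp: subset_iff)
    then show "r \<odot>\<^bsub>N\<^esub> u \<in> f ` K" by simp
  qed
qed

lemma submodule_of_submodule:
  assumes M: "module R M" and H: "submodule H R M"
  shows "submodule K R (M\<lparr>carrier := H\<rparr>) \<longleftrightarrow> submodule K R M \<and> K \<subseteq> H"
proof -
  interpret M: module R M by (rule M)
  interpret H: module R "M\<lparr>carrier := H\<rparr>" by (rule submodule_imp_module[OF M H])
  show ?thesis unfolding H.submodule_iff M.submodule_iff using M.submoduleE(1)[OF H] by auto
qed

lemma coset_carrier_update [simp]: "N +>\<^bsub>M\<lparr>carrier := H\<rparr>\<^esub> x = N +>\<^bsub>M\<^esub> x"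
  by (simp add: a_r_coset_def')

context
  fixes R :: "('a, 'r) ring_scheme" and M :: "('a, 'm, 'x) module_scheme" and N :: "'m set"
  assumes M: "module R M" and N: "submodule N R M"
begin

interpretation M: module R M by (rule M)

interpretation N: abelian_subgroup N M
proof (rule abelian_subgroupI3)
  show "additive_subgroup N M" by (rule additive_subgroup.intro) (rule submodule.axioms(1)[OF N])
qed (rule M.abelian_group_axioms)

lemma quot_module_carrier: "carrier (quot_module M N) = (\<lambda>x. N +>\<^bsub>M\<^esub> x) ` carrier M"
  unfolding quot_module_def A_RCOSETS_def' by auto

lemma quot_module_zero: "\<zero>\<^bsub>quot_module M N\<^esub> = N"
  by (simp add: quot_module_def)

lemma coset_eq_iff:
  assumes "x \<in> carrier M" "y \<in> carrier M"
  shows "N +>\<^bsub>M\<^esub> x = N +>\<^bsub>M\<^esub> y \<longleftrightarrow> x \<oplus>\<^bsub>M\<^esub> \<ominus>\<^bsub>M\<^esub> y \<in> N"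
proof
  assume "N +>\<^bsub>M\<^esub> x = N +>\<^bsub>M\<^esub> y"
  then have "x \<in> N +>\<^bsub>M\<^esub> y" using N.a_rcos_self[OF assms(1)] by simp
  then show "x \<oplus>\<^bsub>M\<^esub> \<ominus>\<^bsub>M\<^esub> y \<in> N" using N.a_rcos_module_imp[OF assms(2)] by (simp add: a_minus_def)
next
  assume "x \<oplus>\<^bsub>M\<^esub> \<ominus>\<^bsub>M\<^esub> y \<in> N"
  then have "x \<in> N +>\<^bsub>M\<^esub> y" using N.a_rcos_module_rev[OF assms(2,1)] by (simp add: a_minus_def)
  then show "N +>\<^bsub>M\<^esub> x = N +>\<^bsub>M\<^esub> y" using M.a_repr_independence[OF _ assms(2) N.a_subgroup] by simp
qed

lemma coset_zero_iff:
  assumes "x \<in> carrier M"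
  shows "N +>\<^bsub>M\<^esub> x = N \<longleftrightarrow> x \<in> N"
proof -
  have "N +>\<^bsub>M\<^esub> \<zero>\<^bsub>M\<^esub> = N" by (rule M.a_coset_add_zero) (rule N.a_subset)
  then show ?thesis using coset_eq_iff[OF assms, of "\<zero>\<^bsub>M\<^esub>"] assms by simp
qed

lemma quot_module_add:
  assumes "x \<in> carrier M" "y \<in> carrier M"
  shows "(N +>\<^bsub>M\<^esub> x) \<oplus>\<^bsub>quot_module M N\<^esub> (N +>\<^bsub>M\<^esub> y) = N +>\<^bsub>M\<^esub> (x \<oplus>\<^bsub>M\<^esub> y)"
  using N.a_rcos_sum[OF assms] by (simp add: quot_module_def)

lemma quot_module_smult:
  assumes r: "r \<in> carrier R" and x: "x \<in> carrier M"
  shows "r \<odot>\<^bsub>quot_module M N\<^esub> (N +>\<^bsub>M\<^esub> x) = N +>\<^bsub>M\<^esub> (r \<odot>\<^bsub>M\<^esub> x)"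
proof -
  have "N +>\<^bsub>M\<^esub> (r \<odot>\<^bsub>M\<^esub> y) = N +>\<^bsub>M\<^esub> (r \<odot>\<^bsub>M\<^esub> x)" if y: "y \<in> N +>\<^bsub>M\<^esub> x" for y
  proof -
    have yc: "y \<in> carrier M" using y N.a_elemrcos_carrier[OF x] by simp
    have "y \<oplus>\<^bsub>M\<^esub> \<ominus>\<^bsub>M\<^esub> x \<in> N" using N.a_rcos_module_imp[OF x y] by (simp add: a_minus_def)
    then have "r \<odot>\<^bsub>M\<^esub> (y \<oplus>\<^bsub>M\<^esub> \<ominus>\<^bsub>M\<^esub> x) \<in> N" using M.submoduleE(4)[OF N r] by simp
    then show ?thesis
      using r x yc by (simp add: coset_eq_iff M.smult_r_distr M.smult_r_minus)
  qed
  moreover have "x \<in> N +>\<^bsub>M\<^esub> x" using N.a_rcos_self[OF x] .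
  \<comment> \<open>All cosets in the union that defines scalar multiplication coincide, so the
    union is that one coset.\<close>
  ultimately have "(\<Union>y\<in>N +>\<^bsub>M\<^esub> x. N +>\<^bsub>M\<^esub> (r \<odot>\<^bsub>M\<^esub> y)) = N +>\<^bsub>M\<^esub> (r \<odot>\<^bsub>M\<^esub> x)"
    by (intro SUP_eq_const) blast+
  then show ?thesis by (simp add: quot_module_def)
qed

lemma quot_module_is_module: "module R (quot_module M N)"
proof -
  note [simp] = quot_module_add quot_module_smult quot_module_carrier
  have [simp]: "\<zero>\<^bsub>quot_module M N\<^esub> = N +>\<^bsub>M\<^esub> \<zero>\<^bsub>M\<^esub>"
    using M.a_coset_add_zero[OF N.a_subset] by (simp add: quot_module_zero)
  show ?thesis
  proof (rule moduleI)
    show "abelian_group (quot_module M N)"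
    proof (rule abelian_groupI)
      fix X assume "X \<in> carrier (quot_module M N)"
      then obtain x where x: "x \<in> carrier M" "X = N +>\<^bsub>M\<^esub> x" by auto
      then have "(N +>\<^bsub>M\<^esub> (\<ominus>\<^bsub>M\<^esub> x)) \<oplus>\<^bsub>quot_module M N\<^esub> X = \<zero>\<^bsub>quot_module M N\<^esub>"
        by (simp add: M.l_neg)
      with x show "\<exists>Y\<in>carrier (quot_module M N). Y \<oplus>\<^bsub>quot_module M N\<^esub> X = \<zero>\<^bsub>quot_module M N\<^esub>"
        by (intro bexI[of _ "N +>\<^bsub>M\<^esub> (\<ominus>\<^bsub>M\<^esub> x)"]) simp_all
    qed (auto simp: M.a_ac)
  qed (auto simp: M.smult_l_distr M.smult_r_distr M.smult_assoc1 M.is_cring)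
qed

lemma quot_module_proj:
  "(\<lambda>x. N +>\<^bsub>M\<^esub> x) \<in> mod_hom R M (quot_module M N)"
  by (rule mod_homI) (simp_all add: quot_module_carrier quot_module_add quot_module_smult)

end

text \<open>The passage from a quotient record to the pair of submodules behind it, along the graph
  of the projection \<open>K \<rightarrow> K/N\<close>.\<close>

lemma (in noetherian_cring) fin_gen_subquotient_iff:
  assumes M: "module R M" and K: "submodule K R M" and N: "submodule N R M" "N \<subseteq> K"
  shows "fin_gen R (quot_module (M\<lparr>carrier := K\<rparr>) N) \<longleftrightarrow> rel_fg R M K N"
proof -
  let ?K = "M\<lparr>carrier := K\<rparr>" let ?Q = "quot_module ?K N"
  interpret M: module R M by (rule M)
  have K': "module R ?K" by (rule submodule_imp_module[OF M K])
  have N': "submodule N R ?K" using N by (simp add: submodule_of_submodule[OF M K])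
  have Q: "module R ?Q" by (rule quot_module_is_module[OF K' N'])
  interpret Q: module R ?Q by (rule Q)
  note c = quot_module_carrier[OF K' N', simplified]
  let ?H = "{(x, N +>\<^bsub>M\<^esub> x) | x. x \<in> K}"
  have "rel_fg R M K N \<longleftrightarrow> rel_fg R ?Q (carrier ?Q) {\<zero>\<^bsub>?Q\<^esub>}"
  proof (rule rel_fg_cong[OF M Q])
    show "lin_rel R M ?Q ?H"
    proof (rule lin_relI)
      fix x X y Y assume "(x, X) \<in> ?H" "(y, Y) \<in> ?H"
      then show "(x \<oplus>\<^bsub>M\<^esub> y, X \<oplus>\<^bsub>?Q\<^esub> Y) \<in> ?H"
        using quot_module_add[OF K' N', of x y] M.submoduleE(5)[OF K] by auto
    next
      fix r x X assume "r \<in> carrier R" "(x, X) \<in> ?H"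
      then show "(r \<odot>\<^bsub>M\<^esub> x, r \<odot>\<^bsub>?Q\<^esub> X) \<in> ?H"
        using quot_module_smult[OF K' N', of r x] M.submoduleE(4)[OF K] by auto
    next
      have "\<zero>\<^bsub>M\<^esub> \<in> K" using K by (simp add: M.submodule_iff)
      moreover have "N +>\<^bsub>M\<^esub> \<zero>\<^bsub>M\<^esub> = N"
        by (rule M.a_coset_add_zero) (use N M.submoduleE(1) in blast)
      ultimately show "(\<zero>\<^bsub>M\<^esub>, \<zero>\<^bsub>?Q\<^esub>) \<in> ?H" by (auto simp: quot_module_zero[OF K' N'])
    qed (use M.submoduleE(1)[OF K] c in auto)
    show "x \<in> N \<longleftrightarrow> y \<in> {\<zero>\<^bsub>?Q\<^esub>}" if "x \<in> K" "y \<in> carrier ?Q" "(x, y) \<in> ?H" for x y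
      using that coset_zero_iff[OF K' N', of x] by (auto simp: quot_module_zero[OF K' N'])
  qed (use K N c Q.carrier_is_submodule Q.submodule_zero in auto)
  then show ?thesis by (simp add: Q.rel_fg_carrier_iff)
qed

section \<open>Modules of homomorphisms\<close>

lemma Hom_carrier_iff: "f \<in> carrier (Hom R M N) \<longleftrightarrow> f \<in> mod_hom R M N \<and> f \<in> extensional (carrier M)"
  by (simp add: Hom_def)

lemma Hom_eqI:
  "f \<in> carrier (Hom R M N) \<Longrightarrow> g \<in> carrier (Hom R M N') \<Longrightarrow> (\<And>x. x \<in> carrier M \<Longrightarrow> f x = g x) \<Longrightarrow> f = g"
  unfolding Hom_carrier_iff by (blast intro: extensionalityI)

lemma Hom_apply [simp]:
  assumes "x \<in> carrier M"
  shows "\<zero>\<^bsub>Hom R M N\<^esub> x = \<zero>\<^bsub>N\<^esub>"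
    and "(f \<oplus>\<^bsub>Hom R M N\<^esub> g) x = f x \<oplus>\<^bsub>N\<^esub> g x"
    and "(r \<odot>\<^bsub>Hom R M N\<^esub> f) x = r \<odot>\<^bsub>N\<^esub> f x"
  using assms by (simp_all add: Hom_def)

lemma Hom_mod_hom: "f \<in> carrier (Hom R M N) \<Longrightarrow> f \<in> mod_hom R M N"
  by (simp add: Hom_carrier_iff)

lemma restrict_Hom:
  assumes M: "module R M" and f: "f \<in> mod_hom R M N"
  shows "restrict f (carrier M) \<in> carrier (Hom R M N)"
proof -
  interpret M: module R M by (rule M)
  show ?thesis
    unfolding Hom_carrier_iff by (auto intro!: mod_homI simp: mod_homD[OF f])
qed

lemma Hom_closed:
  assumes M: "module R M" and N: "module R N"
  shows "\<zero>\<^bsub>Hom R M N\<^esub> \<in> carrier (Hom R M N)"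
    and "f \<in> carrier (Hom R M N) \<Longrightarrow> g \<in> carrier (Hom R M N) \<Longrightarrow> f \<oplus>\<^bsub>Hom R M N\<^esub> g \<in> carrier (Hom R M N)"
    and "r \<in> carrier R \<Longrightarrow> f \<in> carrier (Hom R M N) \<Longrightarrow> r \<odot>\<^bsub>Hom R M N\<^esub> f \<in> carrier (Hom R M N)"
proof -
  interpret M: module R M by (rule M)
  interpret N: module R N by (rule N)
  have ext: "\<zero>\<^bsub>Hom R M N\<^esub> \<in> extensional (carrier M)" "f \<oplus>\<^bsub>Hom R M N\<^esub> g \<in> extensional (carrier M)"
    "r \<odot>\<^bsub>Hom R M N\<^esub> f \<in> extensional (carrier M)" for f g r
    by (simp_all add: Hom_def)
  show "\<zero>\<^bsub>Hom R M N\<^esub> \<in> carrier (Hom R M N)"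
    unfolding Hom_carrier_iff using ext by (auto intro: mod_homI)
  show "f \<oplus>\<^bsub>Hom R M N\<^esub> g \<in> carrier (Hom R M N)"
    if "f \<in> carrier (Hom R M N)" "g \<in> carrier (Hom R M N)"
    using that ext unfolding Hom_carrier_iff
    by (auto intro!: mod_homI simp: mod_homD N.a_ac N.smult_r_distr)
  show "r \<odot>\<^bsub>Hom R M N\<^esub> f \<in> carrier (Hom R M N)"
    if "r \<in> carrier R" "f \<in> carrier (Hom R M N)"
    using that ext unfolding Hom_carrier_iff
    by (auto intro!: mod_homI simp: mod_homD N.smult_r_distr N.smult_assoc1[symmetric] M.m_comm)
qed

lemma Hom_module:
  assumes M: "module R M" and N: "module R N"
  shows "module R (Hom R M N)"
proof -
  interpret M: module R M by (rule M)
  interpret N: module R N by (rule N)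
  let ?H = "Hom R M N"
  have c: "f x \<in> carrier N" if "f \<in> carrier ?H" "x \<in> carrier M" for f x
    by (rule mod_homD(1)[OF Hom_mod_hom[OF that(1)] that(2)])
  note cl = Hom_closed[OF M N]
  show ?thesis
  proof (rule moduleI)
    show "abelian_group ?H"
    proof (rule abelian_groupI)
      fix f assume f: "f \<in> carrier ?H"
      have "(\<ominus>\<^bsub>R\<^esub> \<one>\<^bsub>R\<^esub>) \<odot>\<^bsub>?H\<^esub> f \<oplus>\<^bsub>?H\<^esub> f = \<zero>\<^bsub>?H\<^esub>"
        by (rule Hom_eqI[of _ R M N _ N])
          (use f c in \<open>simp_all add: cl N.smult_l_minus N.l_neg\<close>)
      then show "\<exists>g\<in>carrier ?H. g \<oplus>\<^bsub>?H\<^esub> f = \<zero>\<^bsub>?H\<^esub>"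
        using cl(3)[OF _ f, of "\<ominus>\<^bsub>R\<^esub> \<one>\<^bsub>R\<^esub>"] by auto
      show "\<zero>\<^bsub>?H\<^esub> \<oplus>\<^bsub>?H\<^esub> f = f"
        by (rule Hom_eqI[of _ R M N _ N]) (use f c in \<open>simp_all add: cl\<close>)
    next
      fix f g assume fg: "f \<in> carrier ?H" "g \<in> carrier ?H"
      show "f \<oplus>\<^bsub>?H\<^esub> g = g \<oplus>\<^bsub>?H\<^esub> f"
        by (rule Hom_eqI[of _ R M N _ N]) (use fg c in \<open>simp_all add: cl N.a_comm\<close>)
      fix h assume h: "h \<in> carrier ?H"
      show "f \<oplus>\<^bsub>?H\<^esub> g \<oplus>\<^bsub>?H\<^esub> h = f \<oplus>\<^bsub>?H\<^esub> (g \<oplus>\<^bsub>?H\<^esub> h)"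
        by (rule Hom_eqI[of _ R M N _ N]) (use fg h c in \<open>simp_all add: cl N.a_assoc\<close>)
    qed (simp_all add: cl)
  next
    fix r s f assume rs: "r \<in> carrier R" "s \<in> carrier R" and f: "f \<in> carrier ?H"
    show "(r \<oplus>\<^bsub>R\<^esub> s) \<odot>\<^bsub>?H\<^esub> f = r \<odot>\<^bsub>?H\<^esub> f \<oplus>\<^bsub>?H\<^esub> s \<odot>\<^bsub>?H\<^esub> f"
      by (rule Hom_eqI[of _ R M N _ N]) (use rs f c in \<open>simp_all add: cl N.smult_l_distr\<close>)
    show "(r \<otimes>\<^bsub>R\<^esub> s) \<odot>\<^bsub>?H\<^esub> f = r \<odot>\<^bsub>?H\<^esub> (s \<odot>\<^bsub>?H\<^esub> f)"
      by (rule Hom_eqI[of _ R M N _ N]) (use rs f c in \<open>simp_all add: cl N.smult_assoc1\<close>)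
  next
    fix r f g assume r: "r \<in> carrier R" and fg: "f \<in> carrier ?H" "g \<in> carrier ?H"
    show "r \<odot>\<^bsub>?H\<^esub> (f \<oplus>\<^bsub>?H\<^esub> g) = r \<odot>\<^bsub>?H\<^esub> f \<oplus>\<^bsub>?H\<^esub> r \<odot>\<^bsub>?H\<^esub> g"
      by (rule Hom_eqI[of _ R M N _ N]) (use r fg c in \<open>simp_all add: cl N.smult_r_distr\<close>)
  next
    fix f assume f: "f \<in> carrier ?H"
    show "\<one>\<^bsub>R\<^esub> \<odot>\<^bsub>?H\<^esub> f = f"
      by (rule Hom_eqI[of _ R M N _ N]) (use f c in \<open>simp_all add: cl\<close>)
  qed (simp_all add: cl M.is_cring)
qed

text \<open>The inverse in the \<open>Hom\<close> record is given only abstractly, as a group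
  inverse; rewriting it as multiplication by \<open>-1\<close> makes it pointwise.\<close>

lemma Hom_minus_apply:
  assumes M: "module R M" and N: "module R N" and f: "f \<in> carrier (Hom R M N)" and x: "x \<in> carrier M"
  shows "(\<ominus>\<^bsub>Hom R M N\<^esub> f) x = \<ominus>\<^bsub>N\<^esub> f x"
proof -
  interpret M: module R M by (rule M)
  interpret N: module R N by (rule N)
  interpret H: module R "Hom R M N" by (rule Hom_module[OF M N])
  have "\<ominus>\<^bsub>Hom R M N\<^esub> f = (\<ominus>\<^bsub>R\<^esub> \<one>\<^bsub>R\<^esub>) \<odot>\<^bsub>Hom R M N\<^esub> f" using f by (simp add: H.smult_l_minus)
  then show ?thesis using x mod_homD(1)[OF Hom_mod_hom[OF f] x] by (simp add: N.smult_l_minus)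
qed

section \<open>Injective modules and torsion\<close>

text \<open>A single-valued linear relation from \<open>R\<close> to \<open>X\<close> is a homomorphism defined on an ideal of \<open>R\<close>.\<close>

definition baer :: "('a, 'r) ring_scheme \<Rightarrow> ('a, 'm, 'x) module_scheme \<Rightarrow> bool" where
  "baer R X \<longleftrightarrow> (\<forall>G. lin_rel R (regular_module R) X G \<and> (\<forall>y. (\<zero>\<^bsub>R\<^esub>, y) \<in> G \<longrightarrow> y = \<zero>\<^bsub>X\<^esub>) \<longrightarrow>
     (\<exists>x\<in>carrier X. \<forall>r y. (r, y) \<in> G \<longrightarrow> y = r \<odot>\<^bsub>X\<^esub> x))"

lemma baerD:
  assumes "baer R X" "lin_rel R (regular_module R) X G" "\<And>y. (\<zero>\<^bsub>R\<^esub>, y) \<in> G \<Longrightarrow> y = \<zero>\<^bsub>X\<^esub>"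
  obtains x where "x \<in> carrier X" "\<And>r y. (r, y) \<in> G \<Longrightarrow> y = r \<odot>\<^bsub>X\<^esub> x"
  using assms unfolding baer_def by meson

lemma lin_rel_single_valued:
  assumes X: "module R X" and Y: "module R Y" and G: "lin_rel R X Y G"
    and zero: "\<And>y. (\<zero>\<^bsub>X\<^esub>, y) \<in> G \<Longrightarrow> y = \<zero>\<^bsub>Y\<^esub>"
    and xy: "(x, y) \<in> G" "(x, y') \<in> G"
  shows "y = y'"
proof -
  interpret Y: module R Y by (rule Y)
  have c: "y \<in> carrier Y" "y' \<in> carrier Y" using lin_relD(2)[OF G] xy by auto
  have "y \<oplus>\<^bsub>Y\<^esub> \<ominus>\<^bsub>Y\<^esub> y' = \<zero>\<^bsub>Y\<^esub>" by (rule zero) (rule lin_rel_same_left[OF X Y G xy])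
  then show ?thesis using Y.submodule_diff_cancel[OF Y.submodule_zero, of "y \<oplus>\<^bsub>Y\<^esub> \<ominus>\<^bsub>Y\<^esub> y'"]
    using c by (metis Y.M.minus_equality Y.M.minus_minus Y.M.a_inv_closed)
qed

lemma (in cring) injective_imp_baer:
  assumes inj: "injective_module R X"
  shows "baer R X"
  unfolding baer_def
proof (intro allI impI, elim conjE)
  let ?R = "regular_module R"
  have X: "module R X" using inj by (simp add: injective_module_def)
  interpret S: module R ?R by (rule regular_module)
  interpret X: module R X by (rule X)
  fix G assume G: "lin_rel R ?R X G" and zero: "\<forall>y. (\<zero>, y) \<in> G \<longrightarrow> y = \<zero>\<^bsub>X\<^esub>"
  define J where "J = {r \<in> carrier ?R. \<exists>y\<in>carrier X. (r, y) \<in> G}"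
  have J: "submodule J R ?R"
    unfolding J_def by (rule submodule_lin_rel_preimage(1)[OF regular_module X G S.carrier_is_submodule X.carrier_is_submodule])
  have single: "y = y'" if "(r, y) \<in> G" "(r, y') \<in> G" for r y y'
    by (rule lin_rel_single_valued[OF regular_module X G _ that]) (simp add: zero)
  define f where "f r = (THE y. (r, y) \<in> G)" for r
  have f_eq: "f r = y" if "(r, y) \<in> G" for r y
    unfolding f_def using single that by (intro the_equality)
  have fG: "(r, f r) \<in> G" if "r \<in> J" for r using that f_eq unfolding J_def by blast
  have Jc: "module R (?R\<lparr>carrier := J\<rparr>)" by (rule submodule_imp_module[OF regular_module J])
  have f: "f \<in> mod_hom R (?R\<lparr>carrier := J\<rparr>) X"
  proof (rule mod_homI)
    fix x assume x: "x \<in> carrier (?R\<lparr>carrier := J\<rparr>)"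
    then show "f x \<in> carrier X" using lin_relD(2)[OF G fG] by simp
    show "f (r \<odot>\<^bsub>?R\<lparr>carrier := J\<rparr>\<^esub> x) = r \<odot>\<^bsub>X\<^esub> f x" if "r \<in> carrier R" for r
      using lin_relD(5)[OF G that fG, of x] x by (intro f_eq) simp
    fix y assume y: "y \<in> carrier (?R\<lparr>carrier := J\<rparr>)"
    show "f (x \<oplus>\<^bsub>?R\<lparr>carrier := J\<rparr>\<^esub> y) = f x \<oplus>\<^bsub>X\<^esub> f y"
      using lin_relD(4)[OF G fG fG, of x y] x y by (intro f_eq) simp
  qed
  have "(\<lambda>x. x) \<in> mod_hom R (?R\<lparr>carrier := J\<rparr>) ?R"
    using S.submoduleE(1)[OF J] by (intro mod_homI) auto
  \<comment> \<open>The inclusion of \<open>J\<close> into \<open>R\<close> is an admissible test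
    pair, both carriers being of type \<open>'a\<close>. The value of the extension at
    \<open>1\<close> will be the element wanted.\<close>
  then obtain g where g: "g \<in> mod_hom R ?R X" "\<And>r. r \<in> J \<Longrightarrow> g r = f r"
    using conjunct2[OF inj[unfolded injective_module_def], rule_format,
        of "?R\<lparr>carrier := J\<rparr>" ?R "\<lambda>x. x" f] Jc regular_module f
    by (auto simp: inj_on_def)
  have "y = r \<odot>\<^bsub>X\<^esub> g \<one>" if ry: "(r, y) \<in> G" for r y
  proof -
    have r: "r \<in> carrier R" "r \<in> J" using lin_relD(1,2)[OF G ry] ry unfolding J_def by auto
    have "g (r \<odot>\<^bsub>?R\<^esub> \<one>) = r \<odot>\<^bsub>X\<^esub> g \<one>" by (rule mod_homD(3)[OF g(1)]) (use r in simp_all)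
    then show ?thesis using f_eq[OF ry] g(2)[OF r(2)] r by simp
  qed
  moreover have "g \<one> \<in> carrier X" by (rule mod_homD(1)[OF g(1)]) simp
  ultimately show "\<exists>x\<in>carrier X. \<forall>r y. (r, y) \<in> G \<longrightarrow> y = r \<odot>\<^bsub>X\<^esub> x" by blast
qed

text \<open>This is \<open>G + R(b, x)\<close>, the candidate for extending a partial homomorphism
  \<open>G\<close> by \<open>b \<mapsto> x\<close>. Whether it stays single-valued depends on the
  choice of \<open>x\<close>.\<close>

lemma lin_rel_adjoin:
  assumes B: "module R B" and X: "module R X" and G: "lin_rel R B X G"
    and b: "b \<in> carrier B" and x: "x \<in> carrier X"
  shows "lin_rel R B X {(u \<oplus>\<^bsub>B\<^esub> r \<odot>\<^bsub>B\<^esub> b, v \<oplus>\<^bsub>X\<^esub> r \<odot>\<^bsub>X\<^esub> x) | u v r. (u, v) \<in> G \<and> r \<in> carrier R}"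
    (is "lin_rel R B X ?K")
proof -
  interpret B: module R B by (rule B)
  interpret X: module R X by (rule X)
  note Gc = lin_relD(1,2)[OF G]
  show ?thesis
  proof (rule lin_relI)
    show "p \<in> carrier B \<and> q \<in> carrier X" if "(p, q) \<in> ?K" for p q
      using that b x by (auto dest: Gc)
    have "(\<zero>\<^bsub>B\<^esub> \<oplus>\<^bsub>B\<^esub> \<zero>\<^bsub>R\<^esub> \<odot>\<^bsub>B\<^esub> b, \<zero>\<^bsub>X\<^esub> \<oplus>\<^bsub>X\<^esub> \<zero>\<^bsub>R\<^esub> \<odot>\<^bsub>X\<^esub> x) \<in> ?K"
      using lin_relD(3)[OF G] by blast
    then show "(\<zero>\<^bsub>B\<^esub>, \<zero>\<^bsub>X\<^esub>) \<in> ?K" using b x by simp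
  next
    fix p q p' q' assume "(p, q) \<in> ?K" "(p', q') \<in> ?K"
    then obtain u v r u' v' r' where uv: "(u, v) \<in> G" "(u', v') \<in> G" and r: "r \<in> carrier R" "r' \<in> carrier R"
      and pq: "p = u \<oplus>\<^bsub>B\<^esub> r \<odot>\<^bsub>B\<^esub> b" "q = v \<oplus>\<^bsub>X\<^esub> r \<odot>\<^bsub>X\<^esub> x"
        "p' = u' \<oplus>\<^bsub>B\<^esub> r' \<odot>\<^bsub>B\<^esub> b" "q' = v' \<oplus>\<^bsub>X\<^esub> r' \<odot>\<^bsub>X\<^esub> x"
      by blast
    note c = uv[THEN Gc(1)] uv[THEN Gc(2)]
    have "p \<oplus>\<^bsub>B\<^esub> p' = (u \<oplus>\<^bsub>B\<^esub> u') \<oplus>\<^bsub>B\<^esub> (r \<oplus>\<^bsub>R\<^esub> r') \<odot>\<^bsub>B\<^esub> b"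
      using c r b unfolding pq by (simp add: B.smult_l_distr B.M.a_ac)
    moreover have "q \<oplus>\<^bsub>X\<^esub> q' = (v \<oplus>\<^bsub>X\<^esub> v') \<oplus>\<^bsub>X\<^esub> (r \<oplus>\<^bsub>R\<^esub> r') \<odot>\<^bsub>X\<^esub> x"
      using c r x unfolding pq by (simp add: X.smult_l_distr X.M.a_ac)
    ultimately show "(p \<oplus>\<^bsub>B\<^esub> p', q \<oplus>\<^bsub>X\<^esub> q') \<in> ?K"
      using lin_relD(4)[OF G uv] r by blast
  next
    fix s p q assume s: "s \<in> carrier R" and "(p, q) \<in> ?K"
    then obtain u v r where uv: "(u, v) \<in> G" and r: "r \<in> carrier R"
      and pq: "p = u \<oplus>\<^bsub>B\<^esub> r \<odot>\<^bsub>B\<^esub> b" "q = v \<oplus>\<^bsub>X\<^esub> r \<odot>\<^bsub>X\<^esub> x"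
      by blast
    note c = uv[THEN Gc(1)] uv[THEN Gc(2)]
    have "s \<odot>\<^bsub>B\<^esub> p = s \<odot>\<^bsub>B\<^esub> u \<oplus>\<^bsub>B\<^esub> (s \<otimes>\<^bsub>R\<^esub> r) \<odot>\<^bsub>B\<^esub> b"
      using c r b s unfolding pq by (simp add: B.smult_r_distr B.smult_assoc1)
    moreover have "s \<odot>\<^bsub>X\<^esub> q = s \<odot>\<^bsub>X\<^esub> v \<oplus>\<^bsub>X\<^esub> (s \<otimes>\<^bsub>R\<^esub> r) \<odot>\<^bsub>X\<^esub> x"
      using c r x s unfolding pq by (simp add: X.smult_r_distr X.smult_assoc1)
    moreover have "s \<otimes>\<^bsub>R\<^esub> r \<in> carrier R" using s r by simp
    ultimately show "(s \<odot>\<^bsub>B\<^esub> p, s \<odot>\<^bsub>X\<^esub> q) \<in> ?K"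
      using lin_relD(5)[OF G s uv] by blast
  qed
qed

lemma lin_rel_Union_chain:
  assumes "C \<noteq> {}" and chain: "\<And>K K'. K \<in> C \<Longrightarrow> K' \<in> C \<Longrightarrow> K \<subseteq> K' \<or> K' \<subseteq> K"
    and lin: "\<And>K. K \<in> C \<Longrightarrow> lin_rel R B X K"
  shows "lin_rel R B X (\<Union>C)"
proof (rule lin_relI)
  show "x \<in> carrier B \<and> y \<in> carrier X" if "(x, y) \<in> \<Union>C" for x y
    using that lin_relD(1,2)[OF lin] by auto
  obtain K where "K \<in> C" using assms(1) by auto
  then show "(\<zero>\<^bsub>B\<^esub>, \<zero>\<^bsub>X\<^esub>) \<in> \<Union>C" using lin_relD(3)[OF lin] by blast
next
  fix x y x' y' assume "(x, y) \<in> \<Union>C" "(x', y') \<in> \<Union>C"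
  then obtain K K' where "K \<in> C" "K' \<in> C" "(x, y) \<in> K" "(x', y') \<in> K'" by auto
  then obtain L where L: "L \<in> C" "(x, y) \<in> L" "(x', y') \<in> L" using chain by blast
  then show "(x \<oplus>\<^bsub>B\<^esub> x', y \<oplus>\<^bsub>X\<^esub> y') \<in> \<Union>C" using lin_relD(4)[OF lin[OF L(1)] L(2,3)] by auto
next
  fix r x y assume r: "r \<in> carrier R" and "(x, y) \<in> \<Union>C"
  then obtain K where "K \<in> C" "(x, y) \<in> K" by auto
  then show "(r \<odot>\<^bsub>B\<^esub> x, r \<odot>\<^bsub>X\<^esub> y) \<in> \<Union>C" using lin_relD(5)[OF lin r] by blast
qed

text \<open>Baer's criterion by Zorn's lemma, for modules over arbitrary carrier types.
  Single-valued relations ordered by inclusion take the place of pairs of a domain and a map on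
  it.\<close>

lemma baer_extension:
  assumes B: "module R B" and X: "module R X" and baer: "baer R X"
    and G: "lin_rel R B X G" and zero: "\<And>y. (\<zero>\<^bsub>B\<^esub>, y) \<in> G \<Longrightarrow> y = \<zero>\<^bsub>X\<^esub>"
  obtains h where "h \<in> mod_hom R B X" "\<And>b y. (b, y) \<in> G \<Longrightarrow> h b = y"
proof -
  interpret B: module R B by (rule B)
  interpret X: module R X by (rule X)
  let ?S = "{K. lin_rel R B X K \<and> G \<subseteq> K \<and> (\<forall>y. (\<zero>\<^bsub>B\<^esub>, y) \<in> K \<longrightarrow> y = \<zero>\<^bsub>X\<^esub>)}"
  have "\<exists>K\<in>?S. \<forall>K'\<in>?S. K \<subseteq> K' \<longrightarrow> K' = K"
  proof (rule subset_Zorn_nonempty)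
    show "?S \<noteq> {}" using G zero by blast
    fix C assume ne: "C \<noteq> {}" and C: "subset.chain ?S C"
    have CS: "C \<subseteq> ?S" using C unfolding subset_chain_def by (rule conjunct1)
    have le: "K \<subseteq> K' \<or> K' \<subseteq> K" if "K \<in> C" "K' \<in> C" for K K'
      using C that unfolding subset_chain_def by meson
    have "lin_rel R B X (\<Union>C)"
      by (rule lin_rel_Union_chain[OF ne le]) (use CS in blast)+
    moreover have "G \<subseteq> \<Union>C" "\<forall>y. (\<zero>\<^bsub>B\<^esub>, y) \<in> \<Union>C \<longrightarrow> y = \<zero>\<^bsub>X\<^esub>"
      using CS ne by blast+
    ultimately show "\<Union>C \<in> ?S" by blast
  qed
  then obtain K where KS: "K \<in> ?S" and max': "\<forall>K'\<in>?S. K \<subseteq> K' \<longrightarrow> K' = K" by (rule bexE)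
  have K: "lin_rel R B X K" "G \<subseteq> K"
    and Kz: "\<And>y. (\<zero>\<^bsub>B\<^esub>, y) \<in> K \<Longrightarrow> y = \<zero>\<^bsub>X\<^esub>"
    using KS by simp_all
  have max: "K' = K" if K': "lin_rel R B X K'" "K \<subseteq> K'" "\<And>y. (\<zero>\<^bsub>B\<^esub>, y) \<in> K' \<Longrightarrow> y = \<zero>\<^bsub>X\<^esub>" for K'
  proof -
    have "K' \<in> ?S" using K' K(2) by simp
    then show ?thesis using max' K'(2) by simp
  qed
  note Kc = lin_relD(1,2)[OF K(1)]
  have total: "\<exists>y. (b, y) \<in> K" if b: "b \<in> carrier B" for b
  proof -
    \<comment> \<open>\<open>L\<close> is \<open>r \<mapsto> K(rb)\<close> on the ideal of all
      \<open>r\<close> with \<open>rb\<close> in the domain of \<open>K\<close>. An \<open>x\<close>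
      that realises it as a multiplication is a value at \<open>b\<close> compatible with
      \<open>K\<close>.\<close>
    define L where "L = {(r, y). r \<in> carrier R \<and> (r \<odot>\<^bsub>B\<^esub> b, y) \<in> K}"
    have "lin_rel R (regular_module R) X L"
    proof (rule lin_relI)
      show "(\<zero>\<^bsub>regular_module R\<^esub>, \<zero>\<^bsub>X\<^esub>) \<in> L" unfolding L_def using lin_relD(3)[OF K(1)] b by simp
    next
      fix r y r' y' assume "(r, y) \<in> L" "(r', y') \<in> L"
      then show "(r \<oplus>\<^bsub>regular_module R\<^esub> r', y \<oplus>\<^bsub>X\<^esub> y') \<in> L"
        unfolding L_def using lin_relD(4)[OF K(1)] b by (simp add: B.smult_l_distr)
    next
      fix s r y assume "s \<in> carrier R" "(r, y) \<in> L"
      then show "(s \<odot>\<^bsub>regular_module R\<^esub> r, s \<odot>\<^bsub>X\<^esub> y) \<in> L"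
        unfolding L_def using lin_relD(5)[OF K(1)] b by (simp add: B.smult_assoc1)
    qed (use Kc(2) in \<open>auto simp: L_def\<close>)
    moreover have "y = \<zero>\<^bsub>X\<^esub>" if "(\<zero>\<^bsub>R\<^esub>, y) \<in> L" for y using that Kz b unfolding L_def by simp
    ultimately obtain x where x: "x \<in> carrier X" "\<And>r y. (r, y) \<in> L \<Longrightarrow> y = r \<odot>\<^bsub>X\<^esub> x"
      using baerD[OF baer] by metis
    define K' where "K' = {(u \<oplus>\<^bsub>B\<^esub> r \<odot>\<^bsub>B\<^esub> b, v \<oplus>\<^bsub>X\<^esub> r \<odot>\<^bsub>X\<^esub> x) | u v r. (u, v) \<in> K \<and> r \<in> carrier R}"
    have in_K': "(u \<oplus>\<^bsub>B\<^esub> r \<odot>\<^bsub>B\<^esub> b, v \<oplus>\<^bsub>X\<^esub> r \<odot>\<^bsub>X\<^esub> x) \<in> K'" if "(u, v) \<in> K" "r \<in> carrier R" for u v r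
      using that unfolding K'_def by blast
    have "K' = K"
    proof (rule max)
      show "lin_rel R B X K'" unfolding K'_def by (rule lin_rel_adjoin[OF B X K(1) b x(1)])
      show "K \<subseteq> K'"
      proof (rule subrelI)
        fix u v assume uv: "(u, v) \<in> K"
        then show "(u, v) \<in> K'" using in_K'[OF uv B.R.zero_closed] Kc[OF uv] b x(1) by simp
      qed
      \<comment> \<open>A relation \<open>0 = u + rb\<close> puts \<open>-r\<close> into the ideal
        behind \<open>L\<close>, and by the choice of \<open>x\<close> the value \<open>v\<close> of
        \<open>u\<close> cancels against \<open>rx\<close>.\<close>
      fix y assume "(\<zero>\<^bsub>B\<^esub>, y) \<in> K'"
      then obtain u v r where uv: "(u, v) \<in> K" and r: "r \<in> carrier R"
        and z: "\<zero>\<^bsub>B\<^esub> = u \<oplus>\<^bsub>B\<^esub> r \<odot>\<^bsub>B\<^esub> b" and y: "y = v \<oplus>\<^bsub>X\<^esub> r \<odot>\<^bsub>X\<^esub> x"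
        unfolding K'_def by blast
      have "u = \<ominus>\<^bsub>B\<^esub> (r \<odot>\<^bsub>B\<^esub> b)"
        using z Kc(1)[OF uv] r b by (metis B.M.minus_equality B.smult_closed)
      then have "u = (\<ominus>\<^bsub>R\<^esub> r) \<odot>\<^bsub>B\<^esub> b" using r b by (simp add: B.smult_l_minus)
      then have "(\<ominus>\<^bsub>R\<^esub> r, v) \<in> L" unfolding L_def using uv r by simp
      then have "v = (\<ominus>\<^bsub>R\<^esub> r) \<odot>\<^bsub>X\<^esub> x" by (rule x(2))
      then show "y = \<zero>\<^bsub>X\<^esub>" using y r x(1) by (simp add: X.smult_l_minus X.M.l_neg)
    qed
    then have "(\<zero>\<^bsub>B\<^esub> \<oplus>\<^bsub>B\<^esub> \<one>\<^bsub>R\<^esub> \<odot>\<^bsub>B\<^esub> b, \<zero>\<^bsub>X\<^esub> \<oplus>\<^bsub>X\<^esub> \<one>\<^bsub>R\<^esub> \<odot>\<^bsub>X\<^esub> x) \<in> K"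
      using in_K'[OF lin_relD(3)[OF K(1)] B.R.one_closed] by simp
    then have "(b, x) \<in> K" using b x(1) by simp
    then show ?thesis by blast
  qed
  define h where "h b = (SOME y. (b, y) \<in> K)" for b
  have hK: "(b, h b) \<in> K" if "b \<in> carrier B" for b unfolding h_def using total[OF that] by (rule someI_ex)
  have h_eq: "h b = y" if "(b, y) \<in> K" for b y
    by (rule lin_rel_single_valued[OF B X K(1) Kz hK[OF Kc(1)[OF that]] that])
  show ?thesis
  proof (rule that)
    show "h \<in> mod_hom R B X"
    proof (rule mod_homI)
      fix x assume x: "x \<in> carrier B"
      show "h x \<in> carrier X" by (rule Kc(2)[OF hK[OF x]])
      show "h (r \<odot>\<^bsub>B\<^esub> x) = r \<odot>\<^bsub>X\<^esub> h x" if "r \<in> carrier R" for r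
        by (rule h_eq) (rule lin_relD(5)[OF K(1) that hK[OF x]])
      fix y assume y: "y \<in> carrier B"
      show "h (x \<oplus>\<^bsub>B\<^esub> y) = h x \<oplus>\<^bsub>X\<^esub> h y"
        by (rule h_eq) (rule lin_relD(4)[OF K(1) hK[OF x] hK[OF y]])
    qed
    show "h b = y" if "(b, y) \<in> G" for b y using h_eq that K(2) by blast
  qed
qed

section \<open>The maximal condition and powers of ideals\<close>

lemma (in noetherian_ring) ex_maximal_ideal_in:
  assumes "S \<noteq> {}" and S: "\<And>I. I \<in> S \<Longrightarrow> ideal I R"
  obtains P where "P \<in> S" "\<And>Q. Q \<in> S \<Longrightarrow> P \<subseteq> Q \<Longrightarrow> Q = P"
proof -
  have "\<exists>P\<in>S. \<forall>Q\<in>S. P \<subseteq> Q \<longrightarrow> Q = P"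
  proof (rule subset_Zorn_nonempty[OF assms(1)])
    fix C assume "C \<noteq> {}" and C: "subset.chain S C"
    moreover have "subset.chain {I. ideal I R} C" using C S unfolding subset_chain_def by blast
    \<comment> \<open>In a Noetherian ring the union of a nonempty chain of ideals is a member of
      the chain, so it stays in \<open>S\<close> whatever \<open>S\<close> is.\<close>
    ultimately have "\<Union>C \<in> C" using ideal_chain_is_trivial by blast
    then show "\<Union>C \<in> S" using C unfolding subset_chain_def by blast
  qed
  then show ?thesis using that by meson
qed

context cring
begin

interpretation ideals: comm_monoid "ideals_set R" by (rule ideals_set_is_comm_monoid)

lemma ideal_pow_0: "I [^]\<^bsub>ideals_set R\<^esub> (0::nat) = carrier R"
  using ideals.nat_pow_0[of I] by (simp add: ideals_set_def)

lemma ideal_pow_Suc: "I [^]\<^bsub>ideals_set R\<^esub> Suc n = ideal_prod R (I [^]\<^bsub>ideals_set R\<^esub> n) I"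
  using ideals.nat_pow_Suc[of I n] by (simp add: ideals_set_def)

lemma ideal_pow_add:
  "ideal I R \<Longrightarrow> I [^]\<^bsub>ideals_set R\<^esub> ((n::nat) + m) = ideal_prod R (I [^]\<^bsub>ideals_set R\<^esub> n) (I [^]\<^bsub>ideals_set R\<^esub> m)"
  using ideals.nat_pow_mult[of I n m] by (simp add: ideals_set_def)

lemma ideal_pow_ideal: "ideal I R \<Longrightarrow> ideal (I [^]\<^bsub>ideals_set R\<^esub> (n::nat)) R"
  using ideals.nat_pow_closed[of I n] by (simp add: ideals_set_def)

lemma ideal_pow_1:
  assumes "ideal I R" shows "I [^]\<^bsub>ideals_set R\<^esub> Suc 0 = I"
  unfolding ideal_pow_Suc ideal_pow_0
  using ideal_prod_one[OF assms] ideal_prod_commute[OF assms oneideal] by simp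

lemma ideal_pow_anti:
  assumes "ideal I R"
  shows "I [^]\<^bsub>ideals_set R\<^esub> ((n::nat) + m) \<subseteq> I [^]\<^bsub>ideals_set R\<^esub> n"
    and "I [^]\<^bsub>ideals_set R\<^esub> (n + m) \<subseteq> I [^]\<^bsub>ideals_set R\<^esub> m"
  using ideal_prod_inter[OF ideal_pow_ideal ideal_pow_ideal, OF assms assms, of n m]
  by (auto simp: ideal_pow_add[OF assms])

lemma pow_in_ideal_pow:
  assumes I: "ideal I R" and r: "r \<in> I"
  shows "r [^] (n::nat) \<in> I [^]\<^bsub>ideals_set R\<^esub> n"
proof (induction n)
  case 0 then show ?case unfolding ideal_pow_0 by simp
next
  case (Suc n) then show ?case unfolding ideal_pow_Suc using r by (simp add: ideal_prod.prod)
qed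

lemma ideal_colon:
  assumes P: "ideal P R" and U: "U \<subseteq> carrier R"
  shows "ideal {x \<in> carrier R. \<forall>u\<in>U. x \<otimes> u \<in> P} R"
proof -
  interpret P: ideal P R by (rule P)
  interpret S: module R "regular_module R" by (rule regular_module)
  show ?thesis
    using U P.I_l_closed
    by (fold submodule_regular_iff_ideal) (auto simp: S.submodule_iff l_distr m_assoc subset_iff)
qed

end

text \<open>Noetherian induction replaces the expansion of powers of finitely many generators. For a
  maximal counterexample \<open>P\<close> and \<open>r \<in> \<aa>\<close> outside \<open>P\<close>,
  let \<open>s\<close> be the power of \<open>r\<close> just before the first one in
  \<open>P\<close>. Then \<open>(P : r)\<close> gains \<open>s\<close>, \<open>(P : (P : r))\<close>
  gains \<open>r\<close>, and the product of these two ideals lies in \<open>P\<close>.\<close>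

lemma (in noetherian_cring) ideal_pow_subset:
  assumes a: "ideal \<aa> R" and P: "ideal P R" and rad: "\<And>r. r \<in> \<aa> \<Longrightarrow> \<exists>k::nat. r [^] k \<in> P"
  shows "\<exists>m::nat. \<aa> [^]\<^bsub>ideals_set R\<^esub> m \<subseteq> P"
proof (rule ccontr)
  let ?S = "{P. ideal P R \<and> (\<forall>r\<in>\<aa>. \<exists>k::nat. r [^] k \<in> P) \<and> \<not> (\<exists>m::nat. \<aa> [^]\<^bsub>ideals_set R\<^esub> m \<subseteq> P)}"
  assume "\<not> ?thesis"
  then have ne: "?S \<noteq> {}" using P rad by blast
  obtain P where PS: "P \<in> ?S" and max: "\<And>Q. Q \<in> ?S \<Longrightarrow> P \<subseteq> Q \<Longrightarrow> Q = P"
    using ex_maximal_ideal_in[OF ne] by blast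
  then have P: "ideal P R" and rad: "\<And>r. r \<in> \<aa> \<Longrightarrow> \<exists>k::nat. r [^] k \<in> P"
    and bad: "\<And>m::nat. \<not> \<aa> [^]\<^bsub>ideals_set R\<^esub> m \<subseteq> P"
    by blast+
  interpret P: ideal P R by (rule P)
  have larger: "\<exists>m::nat. \<aa> [^]\<^bsub>ideals_set R\<^esub> m \<subseteq> Q" if Q: "ideal Q R" "P \<subseteq> Q" "Q \<noteq> P" for Q
  proof (rule ccontr)
    assume "\<not> ?thesis"
    then have "Q \<in> ?S" using Q rad by blast
    with max Q show False by blast
  qed
  obtain r where r: "r \<in> \<aa>" "r \<notin> P" using bad[of "Suc 0"] ideal_pow_1[OF a] by auto
  have rc: "r \<in> carrier R" using ideal.Icarr[OF a r(1)] .
  define k where "k = (LEAST k::nat. r [^] k \<in> P)"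
  have k: "r [^] k \<in> P" unfolding k_def by (rule LeastI_ex) (rule rad[OF r(1)])
  have k': "r [^] j \<notin> P" if "j < k" for j using not_less_Least that unfolding k_def by blast
  have "k \<noteq> 0"
  proof
    assume "k = 0"
    then have "\<one> \<in> P" using k by simp
    then have "r \<otimes> \<one> \<in> P" using P.I_l_closed rc by blast
    then show False using r rc by simp
  qed
  then obtain j where j: "k = Suc j" by (cases k) auto
  define s where "s = r [^] j"
  have s: "s \<in> carrier R" "s \<notin> P" "s \<otimes> r \<in> P" using k k'[of j] rc unfolding j s_def by auto
  define Q1 where "Q1 = {x \<in> carrier R. \<forall>u\<in>{r}. x \<otimes> u \<in> P}"
  define Q2 where "Q2 = {x \<in> carrier R. \<forall>u\<in>Q1. x \<otimes> u \<in> P}"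
  have Q1: "ideal Q1 R" unfolding Q1_def by (rule ideal_colon[OF P]) (use rc in simp)
  have Q1c: "Q1 \<subseteq> carrier R" unfolding Q1_def by blast
  have Q2: "ideal Q2 R" unfolding Q2_def by (rule ideal_colon[OF P Q1c])
  have "P \<subseteq> Q1" unfolding Q1_def using P.I_r_closed rc P.Icarr by blast
  moreover have "s \<in> Q1" unfolding Q1_def using s by simp
  ultimately obtain m1 :: nat where m1: "\<aa> [^]\<^bsub>ideals_set R\<^esub> m1 \<subseteq> Q1" using larger[OF Q1] s by blast
  have "P \<subseteq> Q2" unfolding Q2_def using P.I_r_closed Q1c P.Icarr by blast
  moreover have "r \<in> Q2" unfolding Q2_def Q1_def using rc by (simp add: m_comm)
  ultimately obtain m2 :: nat where m2: "\<aa> [^]\<^bsub>ideals_set R\<^esub> m2 \<subseteq> Q2" using larger[OF Q2] r by blast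
  \<comment> \<open>Both colon ideals are strictly larger than \<open>P\<close>, so each contains a
    power of \<open>\<aa>\<close>; the exponents add.\<close>
  have "\<aa> [^]\<^bsub>ideals_set R\<^esub> (m2 + m1) \<subseteq> P"
    unfolding ideal_pow_add[OF a]
  proof
    fix x assume "x \<in> ideal_prod R (\<aa> [^]\<^bsub>ideals_set R\<^esub> m2) (\<aa> [^]\<^bsub>ideals_set R\<^esub> m1)"
    then show "x \<in> P"
    proof induction
      case (prod i l)
      then have "i \<in> Q2" "l \<in> Q1" using m1 m2 by blast+
      then show ?case unfolding Q2_def by blast
    next
      case (sum x y)
      then show ?case by (rule_tac P.a_closed)
    qed
  qed
  with bad show False by blast
qed

section \<open>Torsion submodules, and torsion parts of injective modules\<close>

lemma torsion_part_carrier: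
  "carrier (torsion_part R \<aa> M) =
     {x \<in> carrier M. \<exists>n::nat. \<forall>r \<in> \<aa> [^]\<^bsub>ideals_set R\<^esub> n. r \<odot>\<^bsub>M\<^esub> x = \<zero>\<^bsub>M\<^esub>}"
  by (simp add: torsion_part_def)

lemma torsion_part_eq: "torsion_part R \<aa> M = M\<lparr>carrier := carrier (torsion_part R \<aa> M)\<rparr>"
  by (simp add: torsion_part_def)

lemma (in cring) submodule_torsion_part:
  assumes a: "ideal \<aa> R" and M: "module R M"
  shows "submodule (carrier (torsion_part R \<aa> M)) R M"
proof -
  interpret M: module R M by (rule M)
  have ac: "r \<in> carrier R" if "r \<in> \<aa> [^]\<^bsub>ideals_set R\<^esub> n" for r and n :: nat
    using ideal.Icarr[OF ideal_pow_ideal[OF a] that] .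
  show ?thesis
    unfolding M.submodule_iff
  proof (intro conjI ballI)
    have "\<forall>r \<in> \<aa> [^]\<^bsub>ideals_set R\<^esub> n. r \<odot>\<^bsub>M\<^esub> \<zero>\<^bsub>M\<^esub> = \<zero>\<^bsub>M\<^esub>" for n :: nat
      using M.smult_r_null[OF ac] by blast
    then show "\<zero>\<^bsub>M\<^esub> \<in> carrier (torsion_part R \<aa> M)" unfolding torsion_part_carrier by blast
  next
    fix x y assume "x \<in> carrier (torsion_part R \<aa> M)" "y \<in> carrier (torsion_part R \<aa> M)"
    then obtain n m :: nat where x: "x \<in> carrier M" "\<And>r. r \<in> \<aa> [^]\<^bsub>ideals_set R\<^esub> n \<Longrightarrow> r \<odot>\<^bsub>M\<^esub> x = \<zero>\<^bsub>M\<^esub>"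
      and y: "y \<in> carrier M" "\<And>r. r \<in> \<aa> [^]\<^bsub>ideals_set R\<^esub> m \<Longrightarrow> r \<odot>\<^bsub>M\<^esub> y = \<zero>\<^bsub>M\<^esub>"
      unfolding torsion_part_carrier by blast
    have "r \<odot>\<^bsub>M\<^esub> (x \<oplus>\<^bsub>M\<^esub> y) = \<zero>\<^bsub>M\<^esub>" if r: "r \<in> \<aa> [^]\<^bsub>ideals_set R\<^esub> (n + m)" for r
    proof -
      have "r \<in> \<aa> [^]\<^bsub>ideals_set R\<^esub> n" "r \<in> \<aa> [^]\<^bsub>ideals_set R\<^esub> m"
        using ideal_pow_anti[OF a, where n = n and m = m] r by blast+
      then show ?thesis using x y ac[OF r] by (simp add: M.smult_r_distr)
    qed
    then show "x \<oplus>\<^bsub>M\<^esub> y \<in> carrier (torsion_part R \<aa> M)"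
      unfolding torsion_part_carrier using x(1) y(1) by blast
  next
    fix s x assume s: "s \<in> carrier R" and "x \<in> carrier (torsion_part R \<aa> M)"
    then obtain n :: nat where x: "x \<in> carrier M" "\<And>r. r \<in> \<aa> [^]\<^bsub>ideals_set R\<^esub> n \<Longrightarrow> r \<odot>\<^bsub>M\<^esub> x = \<zero>\<^bsub>M\<^esub>"
      unfolding torsion_part_carrier by blast
    have "r \<odot>\<^bsub>M\<^esub> (s \<odot>\<^bsub>M\<^esub> x) = \<zero>\<^bsub>M\<^esub>" if r: "r \<in> \<aa> [^]\<^bsub>ideals_set R\<^esub> n" for r
    proof -
      have "r \<odot>\<^bsub>M\<^esub> (s \<odot>\<^bsub>M\<^esub> x) = s \<odot>\<^bsub>M\<^esub> (r \<odot>\<^bsub>M\<^esub> x)"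
        using ac[OF r] s x(1) by (simp add: m_comm flip: M.smult_assoc1)
      then show ?thesis using x(2)[OF r] s by simp
    qed
    then show "s \<odot>\<^bsub>M\<^esub> x \<in> carrier (torsion_part R \<aa> M)"
      unfolding torsion_part_carrier using x(1) s by blast
  qed (auto simp: torsion_part_carrier)
qed

text \<open>Replaces the Artin-Rees lemma in the proof that \<open>\<Gamma>\<^sub>\<aa>\<close> preserves injectivity: an ideal \<open>P\<close> maximal
  with \<open>P \<inter> J = N\<close> contains a power of \<open>\<aa>\<close>. If \<open>r \<in> \<aa>\<close> and the chain \<open>(P : r\<^sup>k)\<close> is stationary from
  \<open>k\<close> on, then \<open>(P + r\<^sup>k R) \<inter> J = N\<close>, so \<open>r\<^sup>k \<in> P\<close>.\<close>

lemma (in noetherian_cring) ex_ideal_pow_Int: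
  assumes a: "ideal \<aa> R" and J: "ideal J R" and N: "ideal N R" "N \<subseteq> J"
    and tors: "\<And>x r. x \<in> J \<Longrightarrow> r \<in> \<aa> \<Longrightarrow> \<exists>n::nat. r [^] n \<otimes> x \<in> N"
  obtains P and m :: nat where "ideal P R" "P \<inter> J = N" "\<aa> [^]\<^bsub>ideals_set R\<^esub> m \<subseteq> P"
proof -
  let ?S = "{P. ideal P R \<and> P \<inter> J = N}"
  have ne: "?S \<noteq> {}" using N by blast
  obtain P where PS: "P \<in> ?S" and max: "\<And>Q. Q \<in> ?S \<Longrightarrow> P \<subseteq> Q \<Longrightarrow> Q = P"
    using ex_maximal_ideal_in[OF ne] by blast
  then have P: "ideal P R" and PJ: "P \<inter> J = N" by blast+
  interpret P: ideal P R by (rule P)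
  have "\<exists>k::nat. r [^] k \<in> P" if r: "r \<in> \<aa>" for r
  proof -
    have rc: "r \<in> carrier R" using ideal.Icarr[OF a r] .
    define Q where "Q k = {x \<in> carrier R. \<forall>u\<in>{r [^] k}. x \<otimes> u \<in> P}" for k :: nat
    have Q: "ideal (Q k) R" for k unfolding Q_def by (rule ideal_colon[OF P]) (use rc in simp)
    have ne: "range Q \<noteq> {}" by simp
    \<comment> \<open>The ideals \<open>Q k = (P : r\<^sup>k)\<close> ascend, so a maximal member of
      the family is the point where the chain becomes stationary.\<close>
    obtain k where k: "\<And>k'. Q k \<subseteq> Q k' \<Longrightarrow> Q k' = Q k"
      using ex_maximal_ideal_in[OF ne] Q by (metis (no_types, lifting) rangeE rangeI)
    define P' where "P' = P <+>\<^bsub>R\<^esub> PIdl (r [^] k)"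
    have P': "ideal P' R" unfolding P'_def by (rule add_ideals[OF P cgenideal_ideal]) (use rc in simp)
    have sub: "P \<subseteq> P'" "r [^] k \<in> P'"
    proof -
      have z: "\<zero> \<in> PIdl (r [^] k)" "r [^] k \<in> PIdl (r [^] k)"
        using cgenideal_self[of "r [^] k"] additive_subgroup.zero_closed[OF ideal.axioms(1)[OF cgenideal_ideal]]
          rc by auto
      have "x \<in> P'" if "x \<in> P" for x
        using that z(1) P.Icarr[OF that] unfolding P'_def set_add_def' by force
      then show "P \<subseteq> P'" by blast
      have "\<zero> \<oplus> r [^] k \<in> P'" unfolding P'_def set_add_def' using P.zero_closed z(2) by blast
      then show "r [^] k \<in> P'" using rc by simp
    qed
    have "P' \<inter> J \<subseteq> N"
    proof
      fix x assume x: "x \<in> P' \<inter> J"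
      then obtain p c where p: "p \<in> P" and c: "c \<in> carrier R" and xpc: "x = p \<oplus> c \<otimes> r [^] k"
        unfolding P'_def set_add_def' cgenideal_def by blast
      have pc: "p \<in> carrier R" by (rule P.Icarr[OF p])
      \<comment> \<open>For \<open>x = p + c r\<^sup>k\<close> in \<open>J\<close>, multiplication
        by \<open>r\<^sup>n\<close> moves \<open>x\<close> into \<open>N \<subseteq> P\<close>,
        hence \<open>c r\<^sup>n\<^sup>+\<^sup>k \<in> P\<close>. Stationarity gives back
        \<open>c r\<^sup>k \<in> P\<close>, and so \<open>x \<in> P\<close>.\<close>
      obtain n :: nat where "r [^] n \<otimes> x \<in> N" using tors[OF _ r, of x] x by blast
      then have "r [^] n \<otimes> x \<in> P" using PJ by blast
      moreover have "r [^] n \<otimes> x = r [^] n \<otimes> p \<oplus> c \<otimes> r [^] (n + k)"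
        using pc c rc unfolding xpc
        by (simp add: r_distr m_lcomm flip: nat_pow_mult)
      moreover have "r [^] n \<otimes> p \<in> P" using P.I_l_closed[OF p] rc by simp
      ultimately have "\<ominus> (r [^] n \<otimes> p) \<oplus> (r [^] n \<otimes> p \<oplus> c \<otimes> r [^] (n + k)) \<in> P"
        using P.a_closed P.a_inv_closed by simp
      then have "c \<otimes> r [^] (n + k) \<in> P" using pc c rc by (simp add: r_neg1)
      then have "c \<in> Q (n + k)" unfolding Q_def using c by simp
      moreover have "Q k \<subseteq> Q (n + k)"
      proof
        fix y assume "y \<in> Q k"
        then have y: "y \<in> carrier R" "y \<otimes> r [^] k \<in> P" unfolding Q_def by auto
        then have "r [^] n \<otimes> (y \<otimes> r [^] k) \<in> P" using P.I_l_closed rc by simp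
        moreover have "r [^] n \<otimes> (y \<otimes> r [^] k) = y \<otimes> r [^] (n + k)"
          using y rc by (simp add: m_lcomm flip: nat_pow_mult)
        ultimately show "y \<in> Q (n + k)" unfolding Q_def using y by simp
      qed
      ultimately have "c \<in> Q k" using k by blast
      then have "x \<in> P" unfolding xpc Q_def using p P.a_closed by simp
      then show "x \<in> N" using x PJ by blast
    qed
    moreover have "N \<subseteq> P' \<inter> J" using PJ sub(1) N(2) by blast
    ultimately have "P' = P" using max[of P'] P' sub(1) by blast
    then show ?thesis using sub(2) by blast
  qed
  then obtain m :: nat where "\<aa> [^]\<^bsub>ideals_set R\<^esub> m \<subseteq> P" using ideal_pow_subset[OF a P] by blast
  with P PJ show ?thesis using that by blast
qed

text \<open>A homomorphism from an ideal \<open>J\<close> to the torsion part, with kernel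
  \<open>N\<close>, is extended by zero to \<open>J + P\<close>, where
  \<open>P \<inter> J = N\<close> and \<open>P\<close> contains a power of \<open>\<aa>\<close>.
  Baer's criterion for \<open>X\<close> then yields an element annihilated by \<open>P\<close>,
  hence a torsion element.\<close>

lemma (in noetherian_cring) baer_torsion_part:
  assumes a: "ideal \<aa> R" and X: "module R X" and baer: "baer R X"
  shows "baer R (torsion_part R \<aa> X)"
  unfolding baer_def
proof (intro allI impI, elim conjE)
  let ?R = "regular_module R" and ?T = "torsion_part R \<aa> X"
  interpret S: module R ?R by (rule regular_module)
  interpret X: module R X by (rule X)
  have ops: "\<zero>\<^bsub>?T\<^esub> = \<zero>\<^bsub>X\<^esub>" "x \<oplus>\<^bsub>?T\<^esub> y = x \<oplus>\<^bsub>X\<^esub> y" "r \<odot>\<^bsub>?T\<^esub> x = r \<odot>\<^bsub>X\<^esub> x" for x y r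
    by (simp_all add: torsion_part_def)
  fix G assume GT: "lin_rel R ?R ?T G" and "\<forall>y. (\<zero>, y) \<in> G \<longrightarrow> y = \<zero>\<^bsub>?T\<^esub>"
  then have zero: "y = \<zero>\<^bsub>X\<^esub>" if "(\<zero>, y) \<in> G" for y using that ops by simp
  have GTc: "y \<in> carrier ?T" if "(x, y) \<in> G" for x y using lin_relD(2)[OF GT that] .
  have G: "lin_rel R ?R X G"
    using GT unfolding lin_rel_def ops by (auto simp: torsion_part_carrier)
  define J where "J = {r \<in> carrier ?R. \<exists>y\<in>carrier X. (r, y) \<in> G}"
  define N where "N = {r \<in> carrier ?R. \<exists>y\<in>{\<zero>\<^bsub>X\<^esub>}. (r, y) \<in> G}"
  have J: "ideal J R" and N: "ideal N R"
    unfolding J_def N_def submodule_regular_iff_ideal[symmetric]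
    by (rule submodule_lin_rel_preimage(1)[OF regular_module X G S.carrier_is_submodule X.carrier_is_submodule]
        submodule_lin_rel_preimage(1)[OF regular_module X G S.carrier_is_submodule X.submodule_zero])+
  have NJ: "N \<subseteq> J" unfolding N_def J_def by auto
  \<comment> \<open>The values of \<open>G\<close> are torsion, so some power of
    \<open>r \<in> \<aa>\<close> moves each element of \<open>J\<close> into the kernel
    \<open>N\<close>.\<close>
  have tors: "\<exists>n::nat. r [^] n \<otimes> x \<in> N" if x: "x \<in> J" and r: "r \<in> \<aa>" for x r
  proof -
    obtain y where y: "(x, y) \<in> G" "x \<in> carrier R" using x unfolding J_def by auto
    obtain n :: nat where n: "\<And>s. s \<in> \<aa> [^]\<^bsub>ideals_set R\<^esub> n \<Longrightarrow> s \<odot>\<^bsub>X\<^esub> y = \<zero>\<^bsub>X\<^esub>"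
      using GTc[OF y(1)] unfolding torsion_part_carrier by blast
    have rc: "r \<in> carrier R" using ideal.Icarr[OF a r] .
    have "(r [^] n \<odot>\<^bsub>?R\<^esub> x, r [^] n \<odot>\<^bsub>X\<^esub> y) \<in> G" by (rule lin_relD(5)[OF G _ y(1)]) (use rc in simp)
    then have "(r [^] n \<otimes> x, \<zero>\<^bsub>X\<^esub>) \<in> G" using n[OF pow_in_ideal_pow[OF a r]] by simp
    then show ?thesis unfolding N_def using y(2) rc by (intro exI[of _ n]) simp
  qed
  obtain P and m :: nat where P: "ideal P R" "P \<inter> J = N" "\<aa> [^]\<^bsub>ideals_set R\<^esub> m \<subseteq> P"
    by (rule ex_ideal_pow_Int[OF a J N NJ tors]) (rule that | assumption)+
  interpret P: ideal P R by (rule P)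
  define G' where "G' = {(x \<oplus> p, y) | x p y. (x, y) \<in> G \<and> p \<in> P}"
  have Gc: "x \<in> carrier R" "y \<in> carrier X" if "(x, y) \<in> G" for x y using lin_relD(1,2)[OF G that] by simp_all
  have in_G': "(x \<oplus> p, y) \<in> G'" if "(x, y) \<in> G" "p \<in> P" for x p y using that unfolding G'_def by blast
  have Gz: "(\<zero>, \<zero>\<^bsub>X\<^esub>) \<in> G" using lin_relD(3)[OF G] by simp
  have G': "lin_rel R ?R X G'"
  proof (rule lin_relI)
    show "x \<in> carrier ?R \<and> y \<in> carrier X" if "(x, y) \<in> G'" for x y
      using that Gc P.Icarr unfolding G'_def by auto
    show "(\<zero>\<^bsub>?R\<^esub>, \<zero>\<^bsub>X\<^esub>) \<in> G'" using in_G'[OF Gz P.zero_closed] by simp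
  next
    fix u y u' y' assume "(u, y) \<in> G'" "(u', y') \<in> G'"
    then obtain x p x' p' where xy: "(x, y) \<in> G" "(x', y') \<in> G" and p: "p \<in> P" "p' \<in> P"
      and u: "u = x \<oplus> p" "u' = x' \<oplus> p'"
      unfolding G'_def by blast
    have "u \<oplus> u' = (x \<oplus> x') \<oplus> (p \<oplus> p')"
      using xy[THEN Gc(1)] p[THEN P.Icarr] unfolding u by (simp add: a_ac)
    moreover have "(x \<oplus> x', y \<oplus>\<^bsub>X\<^esub> y') \<in> G" using lin_relD(4)[OF G xy] by simp
    ultimately show "(u \<oplus>\<^bsub>?R\<^esub> u', y \<oplus>\<^bsub>X\<^esub> y') \<in> G'" using in_G'[OF _ P.a_closed[OF p]] by simp
  next
    fix s u y assume s: "s \<in> carrier R" and "(u, y) \<in> G'"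
    then obtain x p where xy: "(x, y) \<in> G" and p: "p \<in> P" and u: "u = x \<oplus> p"
      unfolding G'_def by blast
    have "s \<otimes> u = s \<otimes> x \<oplus> s \<otimes> p" using Gc(1)[OF xy] P.Icarr[OF p] s unfolding u by (simp add: r_distr)
    moreover have "(s \<otimes> x, s \<odot>\<^bsub>X\<^esub> y) \<in> G" using lin_relD(5)[OF G s xy] by simp
    ultimately show "(s \<odot>\<^bsub>?R\<^esub> u, s \<odot>\<^bsub>X\<^esub> y) \<in> G'" using in_G'[OF _ P.I_l_closed[OF p s]] by simp
  qed
  \<comment> \<open>The extension by zero is consistent because an overlap lies in
    \<open>P \<inter> J = N\<close>, where \<open>G\<close> already vanishes.\<close>
  have "y = \<zero>\<^bsub>X\<^esub>" if y: "(\<zero>, y) \<in> G'" for y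
  proof -
    obtain x p where xy: "(x, y) \<in> G" and p: "p \<in> P" and z: "\<zero> = x \<oplus> p"
      using y unfolding G'_def by blast
    have "x = \<ominus> p" using z Gc(1)[OF xy] P.Icarr[OF p] by (metis minus_equality)
    then have "x \<in> P" using P.a_inv_closed p by simp
    moreover have "x \<in> J" unfolding J_def using Gc[OF xy] xy by auto
    ultimately have "(x, \<zero>\<^bsub>X\<^esub>) \<in> G" using P(2) unfolding N_def by blast
    then show ?thesis using lin_rel_single_valued[OF regular_module X G _ xy] zero by simp
  qed
  then obtain x where x: "x \<in> carrier X" "\<And>r y. (r, y) \<in> G' \<Longrightarrow> y = r \<odot>\<^bsub>X\<^esub> x"
    using baerD[OF baer G'] by metis
  have "r \<odot>\<^bsub>X\<^esub> x = \<zero>\<^bsub>X\<^esub>" if "r \<in> \<aa> [^]\<^bsub>ideals_set R\<^esub> m" for r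
  proof -
    have r: "r \<in> P" "r \<in> carrier R" using that P(3) P.Icarr by blast+
    have "(r, \<zero>\<^bsub>X\<^esub>) \<in> G'" using in_G'[OF Gz r(1)] r(2) by simp
    then show ?thesis using x(2) by simp
  qed
  then have "x \<in> carrier ?T" unfolding torsion_part_carrier using x(1) by blast
  moreover have "y = r \<odot>\<^bsub>?T\<^esub> x" if "(r, y) \<in> G" for r y
    using in_G'[OF that P.zero_closed] Gc[OF that] x(2) by (simp add: ops)
  ultimately show "\<exists>x\<in>carrier ?T. \<forall>r y. (r, y) \<in> G \<longrightarrow> y = r \<odot>\<^bsub>?T\<^esub> x" by blast
qed

section \<open>Free modules\<close>

lemma mod_hom_finsum:
  assumes M: "module R M" and N: "module R N" and f: "f \<in> mod_hom R M N"
    and U: "finite U" and k: "k \<in> U \<rightarrow> carrier M"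
  shows "f (\<Oplus>\<^bsub>M\<^esub>i\<in>U. k i) = (\<Oplus>\<^bsub>N\<^esub>i\<in>U. f (k i))"
proof -
  interpret M: module R M by (rule M)
  interpret N: module R N by (rule N)
  show ?thesis
    using U k
  proof (induction U)
    case empty then show ?case by (simp add: mod_hom_zero[OF M N f])
  next
    case (insert i U)
    then have "k i \<in> carrier M" "k \<in> U \<rightarrow> carrier M" "f (k i) \<in> carrier N" "(\<lambda>i. f (k i)) \<in> U \<rightarrow> carrier N"
      using mod_homD(1)[OF f] by auto
    then show ?case using insert by (simp add: mod_homD(2)[OF f])
  qed
qed

text \<open>The family \<open>k\<close> is kept apart from the index set so that one coefficient
  function can be evaluated both on a basis and on elements chosen over the images of that
  basis.\<close>

definition lin_comb ::
  "('a, 'r) ring_scheme \<Rightarrow> ('a, 'm, 'x) module_scheme \<Rightarrow> 'b set \<Rightarrow> ('b \<Rightarrow> 'm) \<Rightarrow> ('b \<Rightarrow> 'a) \<Rightarrow> 'm" where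
  "lin_comb R W B k c = (\<Oplus>\<^bsub>W\<^esub>b\<in>{b \<in> B. c b \<noteq> \<zero>\<^bsub>R\<^esub>}. c b \<odot>\<^bsub>W\<^esub> k b)"

context
  fixes R :: "('a, 'r) ring_scheme" and W :: "('a, 'm, 'x) module_scheme" and B :: "'b set" and k :: "'b \<Rightarrow> 'm"
  assumes W: "module R W" and k: "k \<in> B \<rightarrow> carrier W"
begin

interpretation W: module R W by (rule W)

text \<open>Sums and multiples of coefficient functions can have smaller support than their parts;
  this brings all of them to one common index set.\<close>

lemma lin_comb_eq_finsum:
  assumes "finite U" "{b \<in> B. c b \<noteq> \<zero>\<^bsub>R\<^esub>} \<subseteq> U" "U \<subseteq> B" "c \<in> B \<rightarrow> carrier R"
  shows "lin_comb R W B k c = (\<Oplus>\<^bsub>W\<^esub>b\<in>U. c b \<odot>\<^bsub>W\<^esub> k b)"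
  unfolding lin_comb_def
proof (rule W.M.add.finprod_mono_neutral_cong_left)
  show "(\<lambda>b. c b \<odot>\<^bsub>W\<^esub> k b) \<in> U \<rightarrow> carrier W" using assms(3,4) k by blast
  show "c b \<odot>\<^bsub>W\<^esub> k b = \<zero>\<^bsub>W\<^esub>" if "b \<in> U - {b \<in> B. c b \<noteq> \<zero>\<^bsub>R\<^esub>}" for b
  proof -
    have "c b = \<zero>\<^bsub>R\<^esub>" "k b \<in> carrier W" using that assms(3) k by auto
    then show ?thesis by simp
  qed
qed (use assms in auto)

lemma lin_comb_closed:
  "c \<in> B \<rightarrow> carrier R \<Longrightarrow> lin_comb R W B k c \<in> carrier W"
  unfolding lin_comb_def by (rule W.M.finsum_closed) (use k in auto)

lemma lin_comb_add:
  assumes c: "c \<in> B \<rightarrow> carrier R" "finite {b \<in> B. c b \<noteq> \<zero>\<^bsub>R\<^esub>}"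
    and c': "c' \<in> B \<rightarrow> carrier R" "finite {b \<in> B. c' b \<noteq> \<zero>\<^bsub>R\<^esub>}"
  shows "lin_comb R W B k (\<lambda>b\<in>B. c b \<oplus>\<^bsub>R\<^esub> c' b) = lin_comb R W B k c \<oplus>\<^bsub>W\<^esub> lin_comb R W B k c'"
proof -
  let ?U = "{b \<in> B. c b \<noteq> \<zero>\<^bsub>R\<^esub>} \<union> {b \<in> B. c' b \<noteq> \<zero>\<^bsub>R\<^esub>}"
  have U: "finite ?U" "?U \<subseteq> B" using c c' by auto
  have cc: "c b \<in> carrier R" "c' b \<in> carrier R" "k b \<in> carrier W" if "b \<in> B" for b using that c c' k by auto
  have eqs: "lin_comb R W B k c = (\<Oplus>\<^bsub>W\<^esub>b\<in>?U. c b \<odot>\<^bsub>W\<^esub> k b)"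
    "lin_comb R W B k c' = (\<Oplus>\<^bsub>W\<^esub>b\<in>?U. c' b \<odot>\<^bsub>W\<^esub> k b)"
    using U c(1) c'(1) by (intro lin_comb_eq_finsum; auto)+
  have "lin_comb R W B k (\<lambda>b\<in>B. c b \<oplus>\<^bsub>R\<^esub> c' b) = (\<Oplus>\<^bsub>W\<^esub>b\<in>?U. (\<lambda>b\<in>B. c b \<oplus>\<^bsub>R\<^esub> c' b) b \<odot>\<^bsub>W\<^esub> k b)"
    using U cc by (intro lin_comb_eq_finsum) auto
  also have "\<dots> = (\<Oplus>\<^bsub>W\<^esub>b\<in>?U. c b \<odot>\<^bsub>W\<^esub> k b \<oplus>\<^bsub>W\<^esub> c' b \<odot>\<^bsub>W\<^esub> k b)"
    using U(2) cc by (intro W.M.finsum_cong') (auto simp: W.smult_l_distr)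
  also have "\<dots> = lin_comb R W B k c \<oplus>\<^bsub>W\<^esub> lin_comb R W B k c'"
    unfolding eqs using U cc by (intro W.M.finsum_addf) auto
  finally show ?thesis .
qed

lemma lin_comb_smult:
  assumes r: "r \<in> carrier R" and c: "c \<in> B \<rightarrow> carrier R" "finite {b \<in> B. c b \<noteq> \<zero>\<^bsub>R\<^esub>}"
  shows "lin_comb R W B k (\<lambda>b\<in>B. r \<otimes>\<^bsub>R\<^esub> c b) = r \<odot>\<^bsub>W\<^esub> lin_comb R W B k c"
proof -
  let ?U = "{b \<in> B. c b \<noteq> \<zero>\<^bsub>R\<^esub>}"
  have cc: "c b \<in> carrier R" "k b \<in> carrier W" if "b \<in> B" for b using that c k by auto
  have "lin_comb R W B k (\<lambda>b\<in>B. r \<otimes>\<^bsub>R\<^esub> c b) = (\<Oplus>\<^bsub>W\<^esub>b\<in>?U. (\<lambda>b\<in>B. r \<otimes>\<^bsub>R\<^esub> c b) b \<odot>\<^bsub>W\<^esub> k b)"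
    using c cc r by (intro lin_comb_eq_finsum) auto
  also have "\<dots> = (\<Oplus>\<^bsub>W\<^esub>b\<in>?U. r \<odot>\<^bsub>W\<^esub> (c b \<odot>\<^bsub>W\<^esub> k b))"
    using cc r by (intro W.M.finsum_cong') (auto simp: W.smult_assoc1)
  also have "\<dots> = r \<odot>\<^bsub>W\<^esub> lin_comb R W B k c"
    unfolding lin_comb_def using c(2) cc r by (intro W.finsum_smult_ldistr[symmetric]) auto
  finally show ?thesis .
qed

end

text \<open>Projectivity of free modules, with \<open>g\<close> required to reach only the values of
  \<open>\<phi>\<close>: preimages of the values on a basis are chosen and extended
  linearly.\<close>

lemma free_module_lift:
  assumes free: "free_module R F" and X: "module R X" and Y: "module R Y"
    and g: "g \<in> mod_hom R X Y" and \<phi>: "\<phi> \<in> mod_hom R F Y"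
    and surj: "\<And>y. y \<in> carrier F \<Longrightarrow> \<phi> y \<in> g ` carrier X"
  obtains \<chi> where "\<chi> \<in> mod_hom R F X" "\<And>y. y \<in> carrier F \<Longrightarrow> g (\<chi> y) = \<phi> y"
proof -
  have F: "module R F" using free by (simp add: free_module_def)
  interpret F: module R F by (rule F)
  interpret X: module R X by (rule X)
  define rep where "rep B x c \<longleftrightarrow> c \<in> B \<rightarrow>\<^sub>E carrier R \<and> finite {b \<in> B. c b \<noteq> \<zero>\<^bsub>R\<^esub>}
    \<and> x = lin_comb R F B (\<lambda>b. b) c" for B x c
  have "\<exists>B \<subseteq> carrier F. \<forall>x\<in>carrier F. \<exists>!c. rep B x c"
    using free unfolding free_module_def rep_def lin_comb_def by simp
  then obtain B where B': "B \<subseteq> carrier F \<and> (\<forall>x\<in>carrier F. \<exists>!c. rep B x c)" by (rule exE)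
  note B = conjunct1[OF B'] and ex1 = bspec[OF conjunct2[OF B']]
  define coef where "coef x = (THE c. rep B x c)" for x
  have rep_coef: "rep B x (coef x)" if "x \<in> carrier F" for x
    unfolding coef_def by (rule theI'[OF ex1[OF that]])
  have coef_eq: "coef x = c" if "x \<in> carrier F" "rep B x c" for x c
    unfolding coef_def by (rule the1_equality[where P = "rep B x", OF ex1[OF that(1)] that(2)])
  have "\<forall>b\<in>B. \<exists>x\<in>carrier X. g x = \<phi> b"
  proof
    fix b assume "b \<in> B"
    then have "\<phi> b \<in> g ` carrier X" using surj B by blast
    then show "\<exists>x\<in>carrier X. g x = \<phi> b" by auto
  qed
  then obtain h where h': "\<forall>b\<in>B. h b \<in> carrier X \<and> g (h b) = \<phi> b"
    using bchoice[of B "\<lambda>b x. x \<in> carrier X \<and> g x = \<phi> b"] by blast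
  have h: "\<And>b. b \<in> B \<Longrightarrow> h b \<in> carrier X" "\<And>b. b \<in> B \<Longrightarrow> g (h b) = \<phi> b" using h' by simp_all
  have hB: "h \<in> B \<rightarrow> carrier X" and idB: "(\<lambda>b. b) \<in> B \<rightarrow> carrier F" using h(1) B by auto
  have coef: "coef x \<in> B \<rightarrow> carrier R" "coef x \<in> extensional B" "finite {b \<in> B. coef x b \<noteq> \<zero>\<^bsub>R\<^esub>}"
      "x = lin_comb R F B (\<lambda>b. b) (coef x)"
    if "x \<in> carrier F" for x
    using rep_coef[OF that] unfolding rep_def by (auto simp: PiE_def)
  \<comment> \<open>Coordinates are linear because they are unique: the pointwise sum of the
    coefficients represents \<open>x + y\<close>.\<close>
  have coef_add: "coef (x \<oplus>\<^bsub>F\<^esub> y) = (\<lambda>b\<in>B. coef x b \<oplus>\<^bsub>R\<^esub> coef y b)"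
    if x: "x \<in> carrier F" and y: "y \<in> carrier F" for x y
  proof (rule coef_eq)
    have "finite {b \<in> B. (\<lambda>b\<in>B. coef x b \<oplus>\<^bsub>R\<^esub> coef y b) b \<noteq> \<zero>\<^bsub>R\<^esub>}"
      by (rule finite_subset[OF _ finite_UnI[OF coef(3)[OF x] coef(3)[OF y]]]) auto
    then show "rep B (x \<oplus>\<^bsub>F\<^esub> y) (\<lambda>b\<in>B. coef x b \<oplus>\<^bsub>R\<^esub> coef y b)"
      unfolding rep_def
      using lin_comb_add[OF F idB coef(1,3)[OF x] coef(1,3)[OF y]]
        coef(4)[OF x, symmetric] coef(4)[OF y, symmetric] coef(1)[OF x] coef(1)[OF y]
      by (auto simp: Pi_iff)
  qed (use x y in simp)
  have coef_smult: "coef (r \<odot>\<^bsub>F\<^esub> x) = (\<lambda>b\<in>B. r \<otimes>\<^bsub>R\<^esub> coef x b)"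
    if r: "r \<in> carrier R" and x: "x \<in> carrier F" for r x
  proof (rule coef_eq)
    have "finite {b \<in> B. (\<lambda>b\<in>B. r \<otimes>\<^bsub>R\<^esub> coef x b) b \<noteq> \<zero>\<^bsub>R\<^esub>}"
      by (rule finite_subset[OF _ coef(3)[OF x]]) (use r in auto)
    then show "rep B (r \<odot>\<^bsub>F\<^esub> x) (\<lambda>b\<in>B. r \<otimes>\<^bsub>R\<^esub> coef x b)"
      unfolding rep_def
      using lin_comb_smult[OF F idB r coef(1,3)[OF x]] coef(4)[OF x, symmetric] coef(1)[OF x] r
      by (auto simp: Pi_iff)
  qed (use r x in simp)
  define \<chi> where "\<chi> x = lin_comb R X B h (coef x)" for x
  show ?thesis
  proof (rule that)
    show "\<chi> \<in> mod_hom R F X"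
    proof (rule mod_homI)
      show "\<chi> x \<in> carrier X" if "x \<in> carrier F" for x
        unfolding \<chi>_def by (rule lin_comb_closed[OF X hB coef(1)[OF that]])
      show "\<chi> (x \<oplus>\<^bsub>F\<^esub> y) = \<chi> x \<oplus>\<^bsub>X\<^esub> \<chi> y" if "x \<in> carrier F" "y \<in> carrier F" for x y
        unfolding \<chi>_def coef_add[OF that]
        by (rule lin_comb_add[OF X hB coef(1,3)[OF that(1)] coef(1,3)[OF that(2)]])
      show "\<chi> (r \<odot>\<^bsub>F\<^esub> x) = r \<odot>\<^bsub>X\<^esub> \<chi> x" if "r \<in> carrier R" "x \<in> carrier F" for r x
        unfolding \<chi>_def coef_smult[OF that]
        by (rule lin_comb_smult[OF X hB that(1) coef(1,3)[OF that(2)]])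
    qed
    show "g (\<chi> x) = \<phi> x" if x: "x \<in> carrier F" for x
    proof -
      let ?S = "{b \<in> B. coef x b \<noteq> \<zero>\<^bsub>R\<^esub>}"
      have c: "coef x b \<in> carrier R" "b \<in> carrier F" "h b \<in> carrier X" if "b \<in> ?S" for b
        using that coef(1)[OF x] B h(1) by auto
      have "g (\<chi> x) = (\<Oplus>\<^bsub>Y\<^esub>b\<in>?S. g (coef x b \<odot>\<^bsub>X\<^esub> h b))"
        unfolding \<chi>_def lin_comb_def
        by (rule mod_hom_finsum[OF X Y g coef(3)[OF x]]) (use c in auto)
      also have "\<dots> = (\<Oplus>\<^bsub>Y\<^esub>b\<in>?S. \<phi> (coef x b \<odot>\<^bsub>F\<^esub> b))"
      proof -
        interpret Y: module R Y by (rule Y)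
        show ?thesis
          by (rule Y.M.finsum_cong')
            (use c h(2) in \<open>auto simp: mod_homD(3)[OF g] mod_homD(3)[OF \<phi>] mod_homD(1)[OF \<phi>]\<close>)
      qed
      also have "\<dots> = \<phi> (\<Oplus>\<^bsub>F\<^esub>b\<in>?S. coef x b \<odot>\<^bsub>F\<^esub> b)"
        by (rule mod_hom_finsum[OF F Y \<phi> coef(3)[OF x], symmetric]) (use c in auto)
      also have "(\<Oplus>\<^bsub>F\<^esub>b\<in>?S. coef x b \<odot>\<^bsub>F\<^esub> b) = x"
        using coef(4)[OF x] unfolding lin_comb_def by simp
      finally show ?thesis .
    qed
  qed
qed

section \<open>Ext as a functor of the second argument\<close>

text \<open>The graph of \<open>Hom(F, g)\<close>, given as a relation so that induced and
  connecting maps enter \<open>rel_fg_exact\<close> in the same form.\<close>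

definition push ::
  "('a, 'r) ring_scheme \<Rightarrow> ('a, 'f, 'w) module_scheme \<Rightarrow> ('a, 'm, 'x) module_scheme \<Rightarrow> ('a, 'n, 'y) module_scheme
    \<Rightarrow> ('m \<Rightarrow> 'n) \<Rightarrow> (('f \<Rightarrow> 'm) \<times> ('f \<Rightarrow> 'n)) set" where
  "push R F X Y g = {(\<phi>, \<omega>). \<phi> \<in> carrier (Hom R F X) \<and> \<omega> \<in> carrier (Hom R F Y) \<and>
     (\<forall>y\<in>carrier F. \<omega> y = g (\<phi> y))}"

lemma Hom_apply_closed: "\<phi> \<in> carrier (Hom R M N) \<Longrightarrow> x \<in> carrier M \<Longrightarrow> \<phi> x \<in> carrier N"
  by (rule mod_homD(1)[OF Hom_mod_hom])

lemma lin_rel_push: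
  assumes F: "module R F" and X: "module R X" and Y: "module R Y" and g: "g \<in> mod_hom R X Y"
  shows "lin_rel R (Hom R F X) (Hom R F Y) (push R F X Y g)"
proof (rule lin_relI)
  note cl = Hom_closed[OF F X] Hom_closed[OF F Y]
  show "(\<zero>\<^bsub>Hom R F X\<^esub>, \<zero>\<^bsub>Hom R F Y\<^esub>) \<in> push R F X Y g"
    unfolding push_def by (simp add: cl mod_hom_zero[OF X Y g])
  show "(\<phi> \<oplus>\<^bsub>Hom R F X\<^esub> \<phi>', \<omega> \<oplus>\<^bsub>Hom R F Y\<^esub> \<omega>') \<in> push R F X Y g"
    if "(\<phi>, \<omega>) \<in> push R F X Y g" "(\<phi>', \<omega>') \<in> push R F X Y g" for \<phi> \<omega> \<phi>' \<omega>'
    using that unfolding push_def by (simp add: cl mod_homD(2)[OF g] Hom_apply_closed[of _ R F X])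
  show "(r \<odot>\<^bsub>Hom R F X\<^esub> \<phi>, r \<odot>\<^bsub>Hom R F Y\<^esub> \<omega>) \<in> push R F X Y g"
    if "r \<in> carrier R" "(\<phi>, \<omega>) \<in> push R F X Y g" for r \<phi> \<omega>
    using that unfolding push_def by (simp add: cl mod_homD(3)[OF g] Hom_apply_closed[of _ R F X])
qed (auto simp: push_def)

lemma ex_push:
  assumes F: "module R F" and g: "g \<in> mod_hom R X Y" and \<phi>: "\<phi> \<in> carrier (Hom R F X)"
  obtains \<omega> where "(\<phi>, \<omega>) \<in> push R F X Y g"
proof
  show "(\<phi>, restrict (\<lambda>y. g (\<phi> y)) (carrier F)) \<in> push R F X Y g"
    unfolding push_def
    using \<phi> restrict_Hom[OF F mod_hom_comp[OF Hom_mod_hom[OF \<phi>] g]] by simp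
qed

lemma Hom_submoduleI:
  assumes "\<phi> \<in> carrier (Hom R F X)" "\<And>y. y \<in> carrier F \<Longrightarrow> \<phi> y \<in> K"
  shows "\<phi> \<in> carrier (Hom R F (X\<lparr>carrier := K\<rparr>))"
  using assms unfolding Hom_carrier_iff mod_hom_def by auto

lemma Hom_submoduleD:
  assumes "\<phi> \<in> carrier (Hom R F (X\<lparr>carrier := K\<rparr>))" "K \<subseteq> carrier X"
  shows "\<phi> \<in> carrier (Hom R F X)"
  using assms unfolding Hom_carrier_iff mod_hom_def by auto

lemma incl_mod_hom: "K \<subseteq> K' \<Longrightarrow> (\<lambda>x. x) \<in> mod_hom R (X\<lparr>carrier := K\<rparr>) (X\<lparr>carrier := K'\<rparr>)"
  by (rule mod_homI) auto

text \<open>The augmentation is left out, since the exact sequences in the second argument depend on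
  the complex alone. It returns where degree 0 is identified with \<open>Hom\<close> and where
  0-cocycles are shown to have torsion values.\<close>

locale free_complex = noetherian_cring R for R :: "('a, 'r) ring_scheme" (structure) +
  fixes F :: "nat \<Rightarrow> ('a, 'f, 'y) module_scheme" and d :: "nat \<Rightarrow> 'f \<Rightarrow> 'f"
  assumes free: "free_module R (F n)"
    and d: "d n \<in> mod_hom R (F (Suc n)) (F n)"
    and d_exact: "a_kernel (F (Suc n)) (F n) (d n) = d (Suc n) ` carrier (F (Suc (Suc n)))"
begin

lemma F_module: "module R (F n)"
  using free by (simp add: free_module_def)

lemma d_closed: "y \<in> carrier (F (Suc n)) \<Longrightarrow> d n y \<in> carrier (F n)"
  by (rule mod_homD(1)[OF d])

lemma d_d:
  assumes "y \<in> carrier (F (Suc (Suc n)))" shows "d n (d (Suc n) y) = \<zero>\<^bsub>F n\<^esub>"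
proof -
  have "d (Suc n) y \<in> a_kernel (F (Suc n)) (F n) (d n)" unfolding d_exact using assms by blast
  then show ?thesis by (simp add: a_kernel_def')
qed

definition cocyc :: "('a, 'm, 'x) module_scheme \<Rightarrow> nat \<Rightarrow> ('f \<Rightarrow> 'm) set" where
  "cocyc X i = {\<phi> \<in> carrier (Hom R (F i) X). \<forall>y\<in>carrier (F (Suc i)). \<phi> (d i y) = \<zero>\<^bsub>X\<^esub>}"

text \<open>Degree 0 has no incoming differential and only the zero map bounds, so cohomology there
  is the module of cocycles itself.\<close>

definition cobd :: "('a, 'm, 'x) module_scheme \<Rightarrow> nat \<Rightarrow> ('f \<Rightarrow> 'm) set" where
  "cobd X i = {\<phi> \<in> carrier (Hom R (F i) X). case i of
     0 \<Rightarrow> \<forall>y\<in>carrier (F 0). \<phi> y = \<zero>\<^bsub>X\<^esub>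
   | Suc j \<Rightarrow> \<exists>\<chi>\<in>carrier (Hom R (F j) X). \<forall>y\<in>carrier (F (Suc j)). \<phi> y = \<chi> (d j y)}"

lemma cocycD:
  assumes "\<phi> \<in> cocyc X i"
  shows "\<phi> \<in> carrier (Hom R (F i) X)" "y \<in> carrier (F (Suc i)) \<Longrightarrow> \<phi> (d i y) = \<zero>\<^bsub>X\<^esub>"
  using assms by (simp_all add: cocyc_def)

lemma cocycI:
  assumes "\<phi> \<in> carrier (Hom R (F i) X)" "\<And>y. y \<in> carrier (F (Suc i)) \<Longrightarrow> \<phi> (d i y) = \<zero>\<^bsub>X\<^esub>"
  shows "\<phi> \<in> cocyc X i"
  using assms by (simp add: cocyc_def)

lemma cobd_SucE:
  assumes "\<phi> \<in> cobd X (Suc j)"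
  obtains \<chi> where "\<phi> \<in> carrier (Hom R (F (Suc j)) X)" "\<chi> \<in> carrier (Hom R (F j) X)"
    "\<And>y. y \<in> carrier (F (Suc j)) \<Longrightarrow> \<phi> y = \<chi> (d j y)"
  using assms by (auto simp: cobd_def)

lemma cobd_SucI:
  assumes "\<phi> \<in> carrier (Hom R (F (Suc j)) X)" "\<chi> \<in> carrier (Hom R (F j) X)"
    "\<And>y. y \<in> carrier (F (Suc j)) \<Longrightarrow> \<phi> y = \<chi> (d j y)"
  shows "\<phi> \<in> cobd X (Suc j)"
  using assms by (auto simp: cobd_def)

lemma cobd_0_iff:
  "\<phi> \<in> cobd X 0 \<longleftrightarrow> \<phi> \<in> carrier (Hom R (F 0) X) \<and> (\<forall>y\<in>carrier (F 0). \<phi> y = \<zero>\<^bsub>X\<^esub>)"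
  by (simp add: cobd_def)

lemma cobd_Hom: "\<phi> \<in> cobd X i \<Longrightarrow> \<phi> \<in> carrier (Hom R (F i) X)"
  by (simp add: cobd_def)

lemma ex_comp_d:
  assumes \<chi>: "\<chi> \<in> carrier (Hom R (F i) X)"
  obtains \<psi> where "\<psi> \<in> carrier (Hom R (F (Suc i)) X)" "\<And>y. y \<in> carrier (F (Suc i)) \<Longrightarrow> \<psi> y = \<chi> (d i y)"
proof
  show "restrict (\<lambda>y. \<chi> (d i y)) (carrier (F (Suc i))) \<in> carrier (Hom R (F (Suc i)) X)"
    by (rule restrict_Hom[OF F_module mod_hom_comp[OF d Hom_mod_hom[OF \<chi>]]])
qed simp

context
  fixes X :: "('a, 'm, 'x) module_scheme"
  assumes X: "module R X"
begin

interpretation X: module R X by (rule X)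

lemma Hom_F_module: "module R (Hom R (F i) X)"
  by (rule Hom_module[OF F_module X])

lemma submodule_cocyc: "submodule (cocyc X i) R (Hom R (F i) X)"
proof -
  interpret H: module R "Hom R (F i) X" by (rule Hom_F_module)
  show ?thesis
    unfolding H.submodule_iff cocyc_def
    by (auto simp: d_closed Hom_closed[OF F_module X])
qed

lemma cobd_subset_cocyc: "cobd X i \<subseteq> cocyc X i"
proof
  fix \<phi> assume \<phi>: "\<phi> \<in> cobd X i"
  show "\<phi> \<in> cocyc X i"
  proof (cases i)
    case 0
    with \<phi> show ?thesis by (auto intro!: cocycI simp: cobd_0_iff d_closed)
  next
    case (Suc j)
    with \<phi> obtain \<chi> where \<chi>: "\<phi> \<in> carrier (Hom R (F (Suc j)) X)" "\<chi> \<in> carrier (Hom R (F j) X)"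
      "\<And>y. y \<in> carrier (F (Suc j)) \<Longrightarrow> \<phi> y = \<chi> (d j y)"
      using cobd_SucE by metis
    have "\<chi> \<zero>\<^bsub>F j\<^esub> = \<zero>\<^bsub>X\<^esub>" by (rule mod_hom_zero[OF F_module X Hom_mod_hom[OF \<chi>(2)]])
    then show ?thesis unfolding Suc by (intro cocycI) (simp_all add: \<chi> d_closed d_d)
  qed
qed

lemma submodule_cobd: "submodule (cobd X i) R (Hom R (F i) X)"
proof -
  interpret H: module R "Hom R (F i) X" by (rule Hom_F_module)
  note cl = Hom_closed[OF F_module X]
  show ?thesis
  proof (cases i)
    case 0
    show ?thesis unfolding H.submodule_iff unfolding 0 by (auto simp: cobd_0_iff cl)
  next
    case (Suc j)
    show ?thesis
      unfolding H.submodule_iff unfolding Suc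
    proof (intro conjI ballI)
      show "cobd X (Suc j) \<subseteq> carrier (Hom R (F (Suc j)) X)" using cobd_Hom by blast
      show "\<zero>\<^bsub>Hom R (F (Suc j)) X\<^esub> \<in> cobd X (Suc j)"
        by (rule cobd_SucI[OF cl(1) cl(1)]) (simp add: d_closed)
    next
      fix \<phi> \<phi>' assume "\<phi> \<in> cobd X (Suc j)" "\<phi>' \<in> cobd X (Suc j)"
      then show "\<phi> \<oplus>\<^bsub>Hom R (F (Suc j)) X\<^esub> \<phi>' \<in> cobd X (Suc j)"
        by (elim cobd_SucE) (rule cobd_SucI[OF cl(2) cl(2)], simp_all add: d_closed)
    next
      fix r \<phi> assume "r \<in> carrier R" "\<phi> \<in> cobd X (Suc j)"
      then show "r \<odot>\<^bsub>Hom R (F (Suc j)) X\<^esub> \<phi> \<in> cobd X (Suc j)"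
        by (elim cobd_SucE) (rule cobd_SucI[OF cl(3) cl(3)], simp_all add: d_closed)
    qed
  qed
qed

text \<open>Kernel and image of composition with the differentials, computed on extensional
  functions, are \<open>cocyc\<close> and \<open>cobd\<close>. After this the \<open>Ext\<close>
  record need not be opened again.\<close>

lemma fin_gen_Ext_iff:
  "fin_gen R (Ext R F d X i) \<longleftrightarrow> rel_fg R (Hom R (F i) X) (cocyc X i) (cobd X i)"
proof -
  let ?d = "\<lambda>n \<phi>. compose (carrier (F (Suc n))) \<phi> (d n)"
  have "?d i \<phi> = \<zero>\<^bsub>Hom R (F (Suc i)) X\<^esub> \<longleftrightarrow> (\<forall>y\<in>carrier (F (Suc i)). \<phi> (d i y) = \<zero>\<^bsub>X\<^esub>)" for \<phi>
    by (auto simp: Hom_def compose_def fun_eq_iff restrict_def)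
  then have ker: "a_kernel (Hom R (F i) X) (Hom R (F (Suc i)) X) (?d i) = cocyc X i"
    by (simp add: a_kernel_def' cocyc_def)
  have im: "(case i of 0 \<Rightarrow> {\<zero>\<^bsub>Hom R (F 0) X\<^esub>} | Suc j \<Rightarrow> ?d j ` carrier (Hom R (F j) X)) = cobd X i"
  proof (cases i)
    case 0
    have "\<phi> = \<zero>\<^bsub>Hom R (F 0) X\<^esub>" if "\<phi> \<in> cobd X 0" for \<phi>
      by (rule Hom_eqI[of _ R "F 0" X _ X])
        (use that in \<open>simp_all add: cobd_0_iff Hom_closed(1)[OF F_module X]\<close>)
    then show ?thesis unfolding 0 by (auto simp: cobd_0_iff Hom_closed[OF F_module X])
  next
    case (Suc j)
    have "?d j \<chi> \<in> cobd X (Suc j)" if "\<chi> \<in> carrier (Hom R (F j) X)" for \<chi>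
    proof (rule cobd_SucI[OF _ that])
      show "?d j \<chi> \<in> carrier (Hom R (F (Suc j)) X)"
        unfolding compose_def by (rule restrict_Hom[OF F_module mod_hom_comp[OF d Hom_mod_hom[OF that]]])
    qed (simp add: compose_def)
    moreover have "\<phi> \<in> ?d j ` carrier (Hom R (F j) X)" if \<phi>: "\<phi> \<in> cobd X (Suc j)" for \<phi>
    proof -
      obtain \<chi> where \<chi>: "\<phi> \<in> carrier (Hom R (F (Suc j)) X)" "\<chi> \<in> carrier (Hom R (F j) X)"
        "\<And>y. y \<in> carrier (F (Suc j)) \<Longrightarrow> \<phi> y = \<chi> (d j y)"
        using cobd_SucE[OF \<phi>] by metis
      have "\<phi> = ?d j \<chi>"
        using \<chi>(1,3) by (intro extensionalityI[of _ "carrier (F (Suc j))"]) (auto simp: Hom_carrier_iff compose_def)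
      then show ?thesis using \<chi>(2) by blast
    qed
    ultimately show ?thesis unfolding Suc by auto
  qed
  show ?thesis
    unfolding Ext_def cohomology_def ker im
    by (rule fin_gen_subquotient_iff[OF Hom_F_module submodule_cocyc submodule_cobd cobd_subset_cocyc])
qed

text \<open>By exactness a cocycle kills the kernel of \<open>d j\<close>, so
  \<open>d j y \<mapsto> \<phi> y\<close> is a well-defined partial homomorphism on
  \<open>F j\<close>. Any extension of it to \<open>F j\<close> exhibits \<open>\<phi>\<close> as a
  coboundary; thus \<open>T\<^sup>j\<^sup>+\<^sup>1(X) = 0\<close>.\<close>

lemma cocyc_subset_cobd_if_baer:
  assumes baer: "baer R X"
  shows "cocyc X (Suc j) \<subseteq> cobd X (Suc j)"
proof
  fix \<phi> assume \<phi>: "\<phi> \<in> cocyc X (Suc j)"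
  note \<phi>h = Hom_mod_hom[OF cocycD(1)[OF \<phi>]]
  let ?G = "{(d j y, \<phi> y) | y. y \<in> carrier (F (Suc j))}"
  interpret F: module R "F (Suc j)" by (rule F_module)
  have G: "lin_rel R (F j) X ?G"
  proof (rule lin_relI)
    have "(d j \<zero>\<^bsub>F (Suc j)\<^esub>, \<phi> \<zero>\<^bsub>F (Suc j)\<^esub>) \<in> ?G" by blast
    then show "(\<zero>\<^bsub>F j\<^esub>, \<zero>\<^bsub>X\<^esub>) \<in> ?G"
      by (simp only: mod_hom_zero[OF F_module F_module d] mod_hom_zero[OF F_module X \<phi>h])
  next
    fix x y x' y' assume "(x, y) \<in> ?G" "(x', y') \<in> ?G"
    then obtain u u' where u: "u \<in> carrier (F (Suc j))" "u' \<in> carrier (F (Suc j))"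
      and e: "x = d j u" "y = \<phi> u" "x' = d j u'" "y' = \<phi> u'"
      by blast
    have "(d j (u \<oplus>\<^bsub>F (Suc j)\<^esub> u'), \<phi> (u \<oplus>\<^bsub>F (Suc j)\<^esub> u')) \<in> ?G" using u by blast
    then show "(x \<oplus>\<^bsub>F j\<^esub> x', y \<oplus>\<^bsub>X\<^esub> y') \<in> ?G"
      unfolding e by (simp only: mod_homD(2)[OF d u] mod_homD(2)[OF \<phi>h u])
  next
    fix r x y assume r: "r \<in> carrier R" and "(x, y) \<in> ?G"
    then obtain u where u: "u \<in> carrier (F (Suc j))" and e: "x = d j u" "y = \<phi> u" by blast
    have "(d j (r \<odot>\<^bsub>F (Suc j)\<^esub> u), \<phi> (r \<odot>\<^bsub>F (Suc j)\<^esub> u)) \<in> ?G" using u r by blast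
    then show "(r \<odot>\<^bsub>F j\<^esub> x, r \<odot>\<^bsub>X\<^esub> y) \<in> ?G"
      unfolding e by (simp only: mod_homD(3)[OF d r u] mod_homD(3)[OF \<phi>h r u])
  qed (use d_closed mod_homD(1)[OF \<phi>h] in auto)
  have zero: "y = \<zero>\<^bsub>X\<^esub>" if zy: "(\<zero>\<^bsub>F j\<^esub>, y) \<in> ?G" for y
  proof -
    obtain u where u: "u \<in> carrier (F (Suc j))" "\<zero>\<^bsub>F j\<^esub> = d j u" "y = \<phi> u" using zy by blast
    then have "u \<in> a_kernel (F (Suc j)) (F j) (d j)" by (simp add: a_kernel_def')
    then obtain v where "v \<in> carrier (F (Suc (Suc j)))" "u = d (Suc j) v" unfolding d_exact by blast
    then show ?thesis using cocycD(2)[OF \<phi>] u by simp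
  qed
  obtain h where h: "h \<in> mod_hom R (F j) X" "\<And>b y. (b, y) \<in> ?G \<Longrightarrow> h b = y"
    by (rule baer_extension[OF F_module X baer G]) (erule zero, rule that, assumption+)
  show "\<phi> \<in> cobd X (Suc j)"
  proof (rule cobd_SucI[OF cocycD(1)[OF \<phi>] restrict_Hom[OF F_module h(1)]])
    fix y assume y: "y \<in> carrier (F (Suc j))"
    then have "h (d j y) = \<phi> y" by (intro h(2)) blast
    then show "\<phi> y = restrict h (carrier (F j)) (d j y)" using d_closed[OF y] by simp
  qed
qed

lemma fin_gen_Ext_baer: "baer R X \<Longrightarrow> fin_gen R (Ext R F d X (Suc j))"
  unfolding fin_gen_Ext_iff using cocyc_subset_cobd_if_baer by (intro rel_fgI[of "{}"]) auto

end

end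

context free_complex
begin

text \<open>The connecting homomorphism of \<open>0 \<rightarrow> K \<rightarrow> X \<rightarrow> Y \<rightarrow> 0\<close> as a linear relation.\<close>

definition conn ::
  "('a, 'm, 'x) module_scheme \<Rightarrow> ('a, 'n, 'z) module_scheme \<Rightarrow> ('m \<Rightarrow> 'n) \<Rightarrow> 'm set \<Rightarrow> nat
    \<Rightarrow> (('f \<Rightarrow> 'n) \<times> ('f \<Rightarrow> 'm)) set" where
  "conn X Y g K i = {(\<omega>, \<psi>). \<omega> \<in> carrier (Hom R (F i) Y) \<and>
     \<psi> \<in> carrier (Hom R (F (Suc i)) (X\<lparr>carrier := K\<rparr>)) \<and>
     (\<exists>\<chi>\<in>carrier (Hom R (F i) X). (\<forall>y\<in>carrier (F i). g (\<chi> y) = \<omega> y) \<and>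
        (\<forall>y\<in>carrier (F (Suc i)). \<psi> y = \<chi> (d i y)))}"

lemma lin_rel_conn:
  assumes X: "module R X" and Y: "module R Y" and g: "g \<in> mod_hom R X Y" and K: "submodule K R X"
  shows "lin_rel R (Hom R (F i) Y) (Hom R (F (Suc i)) (X\<lparr>carrier := K\<rparr>)) (conn X Y g K i)"
proof (rule lin_relI)
  let ?K = "X\<lparr>carrier := K\<rparr>"
  have K': "module R ?K" by (rule submodule_imp_module[OF X K])
  note clX = Hom_closed[OF F_module X] and clY = Hom_closed[OF F_module Y] and clK = Hom_closed[OF F_module K']
  note ap = Hom_apply_closed[of _ R "F i" X]
  show "\<omega> \<in> carrier (Hom R (F i) Y) \<and> \<psi> \<in> carrier (Hom R (F (Suc i)) ?K)"
    if "(\<omega>, \<psi>) \<in> conn X Y g K i" for \<omega> \<psi> using that by (simp add: conn_def)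
  show "(\<zero>\<^bsub>Hom R (F i) Y\<^esub>, \<zero>\<^bsub>Hom R (F (Suc i)) ?K\<^esub>) \<in> conn X Y g K i"
    unfolding conn_def using clX(1)
    by (auto simp: clY clK d_closed mod_hom_zero[OF X Y g] intro!: bexI[of _ "\<zero>\<^bsub>Hom R (F i) X\<^esub>"])
  show "(\<omega> \<oplus>\<^bsub>Hom R (F i) Y\<^esub> \<omega>', \<psi> \<oplus>\<^bsub>Hom R (F (Suc i)) ?K\<^esub> \<psi>') \<in> conn X Y g K i"
    if m: "(\<omega>, \<psi>) \<in> conn X Y g K i" "(\<omega>', \<psi>') \<in> conn X Y g K i" for \<omega> \<psi> \<omega>' \<psi>'
  proof -
    obtain \<chi> \<chi>' where c: "\<chi> \<in> carrier (Hom R (F i) X)" "\<forall>y\<in>carrier (F i). g (\<chi> y) = \<omega> y"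
        "\<forall>y\<in>carrier (F (Suc i)). \<psi> y = \<chi> (d i y)"
      "\<chi>' \<in> carrier (Hom R (F i) X)" "\<forall>y\<in>carrier (F i). g (\<chi>' y) = \<omega>' y"
        "\<forall>y\<in>carrier (F (Suc i)). \<psi>' y = \<chi>' (d i y)"
      using m unfolding conn_def by blast
    with m show ?thesis
      unfolding conn_def
      by (auto simp: clX clY clK d_closed ap mod_homD(2)[OF g]
          intro!: bexI[of _ "\<chi> \<oplus>\<^bsub>Hom R (F i) X\<^esub> \<chi>'"])
  qed
  show "(r \<odot>\<^bsub>Hom R (F i) Y\<^esub> \<omega>, r \<odot>\<^bsub>Hom R (F (Suc i)) ?K\<^esub> \<psi>) \<in> conn X Y g K i"
    if r: "r \<in> carrier R" and m: "(\<omega>, \<psi>) \<in> conn X Y g K i" for r \<omega> \<psi>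
  proof -
    obtain \<chi> where c: "\<chi> \<in> carrier (Hom R (F i) X)" "\<forall>y\<in>carrier (F i). g (\<chi> y) = \<omega> y"
        "\<forall>y\<in>carrier (F (Suc i)). \<psi> y = \<chi> (d i y)"
      using m unfolding conn_def by blast
    with m r show ?thesis
      unfolding conn_def
      by (auto simp: clX clY clK d_closed ap mod_homD(3)[OF g]
          intro!: bexI[of _ "r \<odot>\<^bsub>Hom R (F i) X\<^esub> \<chi>"])
  qed
qed

lemma Hom_diff_apply:
  assumes X: "module R X" and f: "f \<in> carrier (Hom R (F i) X)" and h: "h \<in> carrier (Hom R (F i) X)"
    and y: "y \<in> carrier (F i)"
  shows "(f \<oplus>\<^bsub>Hom R (F i) X\<^esub> \<ominus>\<^bsub>Hom R (F i) X\<^esub> h) y = f y \<oplus>\<^bsub>X\<^esub> \<ominus>\<^bsub>X\<^esub> h y"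
  using y by (simp add: Hom_minus_apply[OF F_module X h])

lemma Hom_diff_closed:
  assumes X: "module R X" and f: "f \<in> carrier (Hom R (F i) X)" and h: "h \<in> carrier (Hom R (F i) X)"
  shows "f \<oplus>\<^bsub>Hom R (F i) X\<^esub> \<ominus>\<^bsub>Hom R (F i) X\<^esub> h \<in> carrier (Hom R (F i) X)"
proof -
  interpret H: module R "Hom R (F i) X" by (rule Hom_module[OF F_module X])
  show ?thesis using f h by simp
qed

section \<open>Three-term pieces of the long exact \<open>Ext\<close> sequence of \<open>0
  \<rightarrow> K \<rightarrow> X \<rightarrow> Y \<rightarrow> 0\<close>\<close>

context
  fixes X :: "('a, 'm, 'x) module_scheme" and Y :: "('a, 'n, 'z) module_scheme" and g :: "'m \<Rightarrow> 'n"
    and K :: "'m set"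
  assumes X: "module R X" and Y: "module R Y" and g: "g \<in> mod_hom R X Y"
    and surj: "g ` carrier X = carrier Y" and K_eq: "K = a_kernel X Y g"
begin

interpretation X: module R X by (rule X)
interpretation Y: module R Y by (rule Y)

lemma K_submodule: "submodule K R X"
  unfolding K_eq by (rule submodule_kernel[OF X Y g])

lemma K_module: "module R (X\<lparr>carrier := K\<rparr>)"
  by (rule submodule_imp_module[OF X K_submodule])

lemma K_iff: "x \<in> K \<longleftrightarrow> x \<in> carrier X \<and> g x = \<zero>\<^bsub>Y\<^esub>"
  unfolding K_eq a_kernel_def' by simp

lemma Hom_K_D: "\<phi> \<in> carrier (Hom R (F i) (X\<lparr>carrier := K\<rparr>)) \<Longrightarrow> \<phi> \<in> carrier (Hom R (F i) X)"
  by (rule Hom_submoduleD) (auto simp: K_iff)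

lemma ex_Hom_lift:
  assumes \<omega>: "\<omega> \<in> carrier (Hom R (F i) Y)"
  obtains \<chi> where "\<chi> \<in> carrier (Hom R (F i) X)" "\<And>y. y \<in> carrier (F i) \<Longrightarrow> g (\<chi> y) = \<omega> y"
proof -
  obtain \<chi> where \<chi>: "\<chi> \<in> mod_hom R (F i) X" "\<And>y. y \<in> carrier (F i) \<Longrightarrow> g (\<chi> y) = \<omega> y"
    by (rule free_module_lift[OF free X Y g Hom_mod_hom[OF \<omega>]])
      (use Hom_apply_closed[OF \<omega>] surj in blast)+
  show ?thesis
    by (rule that[OF restrict_Hom[OF F_module \<chi>(1)]]) (simp add: \<chi>(2))
qed

lemma cobd_push:
  assumes \<phi>: "\<phi> \<in> cobd X i" and p: "(\<phi>, \<omega>) \<in> push R (F i) X Y g"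
  shows "\<omega> \<in> cobd Y i"
proof -
  have \<omega>: "\<omega> \<in> carrier (Hom R (F i) Y)" "\<And>y. y \<in> carrier (F i) \<Longrightarrow> \<omega> y = g (\<phi> y)"
    using p by (auto simp: push_def)
  show ?thesis
  proof (cases i)
    case 0
    then show ?thesis using \<omega> \<phi> by (simp add: cobd_0_iff mod_hom_zero[OF X Y g])
  next
    case (Suc j)
    obtain \<chi> where \<chi>: "\<chi> \<in> carrier (Hom R (F j) X)" "\<And>y. y \<in> carrier (F (Suc j)) \<Longrightarrow> \<phi> y = \<chi> (d j y)"
      using cobd_SucE[OF \<phi>[unfolded Suc]] by metis
    obtain \<rho> where "(\<chi>, \<rho>) \<in> push R (F j) X Y g" using ex_push[OF F_module g \<chi>(1)] by blast
    then show ?thesis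
      using \<omega> \<chi> unfolding Suc by (intro cobd_SucI[of _ _ _ \<rho>]) (auto simp: push_def d_closed)
  qed
qed

text \<open>Lift \<open>\<omega>\<close> through the free module \<open>F i\<close>; composed with
  \<open>d i\<close> the lift lands in \<open>K\<close>, because \<open>\<omega>\<close> is a
  cocycle.\<close>

lemma conn_total:
  assumes \<omega>: "\<omega> \<in> cocyc Y i"
  shows "\<exists>\<psi>\<in>cocyc (X\<lparr>carrier := K\<rparr>) (Suc i). (\<omega>, \<psi>) \<in> conn X Y g K i"
proof -
  obtain \<chi> where \<chi>: "\<chi> \<in> carrier (Hom R (F i) X)" "\<And>y. y \<in> carrier (F i) \<Longrightarrow> g (\<chi> y) = \<omega> y"
    using ex_Hom_lift[OF cocycD(1)[OF \<omega>]] by blast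
  obtain \<psi> where \<psi>: "\<psi> \<in> carrier (Hom R (F (Suc i)) X)" "\<And>y. y \<in> carrier (F (Suc i)) \<Longrightarrow> \<psi> y = \<chi> (d i y)"
    using ex_comp_d[OF \<chi>(1)] by blast
  have "\<psi> y \<in> K" if "y \<in> carrier (F (Suc i))" for y
    using that Hom_apply_closed[OF \<psi>(1)] cocycD(2)[OF \<omega>] by (simp add: K_iff \<psi>(2) \<chi>(2) d_closed)
  then have \<psi>K: "\<psi> \<in> carrier (Hom R (F (Suc i)) (X\<lparr>carrier := K\<rparr>))" using \<psi>(1) by (rule_tac Hom_submoduleI)
  have "\<psi> \<in> cocyc (X\<lparr>carrier := K\<rparr>) (Suc i)"
    using mod_hom_zero[OF F_module X Hom_mod_hom[OF \<chi>(1)]]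
    by (intro cocycI[OF \<psi>K]) (simp add: \<psi>(2) d_closed d_d)
  moreover have "(\<omega>, \<psi>) \<in> conn X Y g K i"
    unfolding conn_def using cocycD(1)[OF \<omega>] \<psi>K \<psi>(2) \<chi> by auto
  ultimately show ?thesis by blast
qed

text \<open>If \<open>\<psi> = \<chi> d\<close> is also \<open>\<rho> d\<close> with
  \<open>\<rho>\<close> valued in \<open>K\<close>, then \<open>\<chi> - \<rho>\<close> is a cocycle
  of \<open>X\<close> over \<open>\<omega>\<close>. This is exactness at the \<open>Y\<close>
  term.\<close>

lemma conn_exact:
  assumes \<omega>: "\<omega> \<in> carrier (Hom R (F i) Y)" and \<psi>: "\<psi> \<in> cobd (X\<lparr>carrier := K\<rparr>) (Suc i)"
    and c: "(\<omega>, \<psi>) \<in> conn X Y g K i"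
  shows "\<exists>\<phi>\<in>cocyc X i. (\<phi>, \<omega>) \<in> push R (F i) X Y g"
proof -
  obtain \<chi> where \<chi>: "\<chi> \<in> carrier (Hom R (F i) X)" "\<forall>y\<in>carrier (F i). g (\<chi> y) = \<omega> y"
    "\<forall>y\<in>carrier (F (Suc i)). \<psi> y = \<chi> (d i y)"
    using c unfolding conn_def by blast
  obtain \<rho> where \<rho>K: "\<rho> \<in> carrier (Hom R (F i) (X\<lparr>carrier := K\<rparr>))"
    and \<rho>: "\<And>y. y \<in> carrier (F (Suc i)) \<Longrightarrow> \<psi> y = \<rho> (d i y)"
    using cobd_SucE[OF \<psi>] by metis
  note \<rho>X = Hom_K_D[OF \<rho>K]
  let ?\<phi> = "\<chi> \<oplus>\<^bsub>Hom R (F i) X\<^esub> \<ominus>\<^bsub>Hom R (F i) X\<^esub> \<rho>"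
  have \<phi>c: "?\<phi> \<in> carrier (Hom R (F i) X)" by (rule Hom_diff_closed[OF X \<chi>(1) \<rho>X])
  have \<phi>: "?\<phi> y = \<chi> y \<oplus>\<^bsub>X\<^esub> \<ominus>\<^bsub>X\<^esub> \<rho> y" if "y \<in> carrier (F i)" for y
    by (rule Hom_diff_apply[OF X \<chi>(1) \<rho>X that])
  have c1: "\<chi> y \<in> carrier X" "\<rho> y \<in> carrier X" "g (\<rho> y) = \<zero>\<^bsub>Y\<^esub>" "\<omega> y \<in> carrier Y"
    if "y \<in> carrier (F i)" for y
    using Hom_apply_closed[OF \<chi>(1) that] Hom_apply_closed[OF \<rho>K that] Hom_apply_closed[OF \<omega> that]
    by (simp_all add: K_iff)
  have "?\<phi> \<in> cocyc X i"
  proof (rule cocycI[OF \<phi>c])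
    fix y assume y: "y \<in> carrier (F (Suc i))"
    then have "\<chi> (d i y) = \<rho> (d i y)" using \<chi>(3) \<rho> by metis
    then show "?\<phi> (d i y) = \<zero>\<^bsub>X\<^esub>" using c1[OF d_closed[OF y]] by (simp only: \<phi>[OF d_closed[OF y]] X.M.r_neg)
  qed
  moreover have "(?\<phi>, \<omega>) \<in> push R (F i) X Y g"
    unfolding push_def
  proof (intro CollectI case_prodI conjI ballI \<phi>c \<omega>)
    fix y assume y: "y \<in> carrier (F i)"
    have "g (?\<phi> y) = g (\<chi> y) \<oplus>\<^bsub>Y\<^esub> \<ominus>\<^bsub>Y\<^esub> g (\<rho> y)"
      unfolding \<phi>[OF y] by (rule mod_hom_diff[OF X Y g c1(1,2)[OF y]])
    then show "\<omega> y = g (?\<phi> y)" using \<chi>(2) y c1[OF y] by simp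
  qed
  ultimately show ?thesis by blast
qed

text \<open>Exactness of \<open>T\<^sup>i(X) \<rightarrow> T\<^sup>i(Y) \<rightarrow>
  T\<^sup>i\<^sup>+\<^sup>1(K)\<close>. Dividing the left term by any \<open>N\<close> that dies in
  \<open>T\<^sup>i(Y)\<close>, not just by the coboundaries, serves degree 0, where
  \<open>T\<^sup>0(X)\<close> itself need not be finitely generated.\<close>

lemma Ext_right:
  assumes N: "submodule N R (Hom R (F i) X)" and fgX: "rel_fg R (Hom R (F i) X) (cocyc X i) N"
    and NY: "\<And>\<phi> \<omega>. \<phi> \<in> N \<Longrightarrow> (\<phi>, \<omega>) \<in> push R (F i) X Y g \<Longrightarrow> \<omega> \<in> cobd Y i"
    and fgK: "fin_gen R (Ext R F d (X\<lparr>carrier := K\<rparr>) (Suc i))"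
  shows "fin_gen R (Ext R F d Y i)"
  unfolding fin_gen_Ext_iff[OF Y]
proof (rule rel_fg_exact[OF Hom_F_module[OF X] Hom_F_module[OF Y] Hom_F_module[OF K_module]
      lin_rel_push[OF F_module X Y g] lin_rel_conn[OF X Y g K_submodule]
      submodule_cocyc[OF X] submodule_cocyc[OF Y] submodule_cocyc[OF K_module]
      N cobd_subset_cocyc[OF Y] submodule_cobd[OF K_module] fgX fgK[unfolded fin_gen_Ext_iff[OF K_module]]])
  show "\<omega> \<in> cobd Y i" if "\<phi> \<in> N" "(\<phi>, \<omega>) \<in> push R (F i) X Y g" for \<phi> \<omega> by (rule NY[OF that])
next
  fix \<omega> assume "\<omega> \<in> cocyc Y i"
  then show "\<exists>\<psi>\<in>cocyc (X\<lparr>carrier := K\<rparr>) (Suc i). (\<omega>, \<psi>) \<in> conn X Y g K i" by (rule conn_total)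
next
  fix \<omega> \<psi> assume \<omega>: "\<omega> \<in> cocyc Y i" and \<psi>: "\<psi> \<in> cobd (X\<lparr>carrier := K\<rparr>) (Suc i)"
    and c: "(\<omega>, \<psi>) \<in> conn X Y g K i"
  have "\<exists>\<phi>\<in>cocyc X i. (\<phi>, \<omega>) \<in> push R (F i) X Y g" by (rule conn_exact[OF cocycD(1)[OF \<omega>] \<psi> c])
  moreover have "\<omega> \<oplus>\<^bsub>Hom R (F i) Y\<^esub> \<ominus>\<^bsub>Hom R (F i) Y\<^esub> \<omega> \<in> cobd Y i"
  proof -
    interpret H: module R "Hom R (F i) Y" by (rule Hom_F_module[OF Y])
    show ?thesis
      using cocycD(1)[OF \<omega>] submodule_cobd[OF Y, of i] by (simp add: H.M.r_neg H.submodule_iff)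
  qed
  ultimately show "\<exists>\<phi>\<in>cocyc X i. \<exists>\<omega>'\<in>cocyc Y i. (\<phi>, \<omega>') \<in> push R (F i) X Y g \<and>
      \<omega> \<oplus>\<^bsub>Hom R (F i) Y\<^esub> \<ominus>\<^bsub>Hom R (F i) Y\<^esub> \<omega>' \<in> cobd Y i"
    using \<omega> by blast
qed

corollary fin_gen_Ext_right:
  assumes "fin_gen R (Ext R F d X i)" and "fin_gen R (Ext R F d (X\<lparr>carrier := K\<rparr>) (Suc i))"
  shows "fin_gen R (Ext R F d Y i)"
  by (rule Ext_right[OF submodule_cobd[OF X] assms(1)[unfolded fin_gen_Ext_iff[OF X]] cobd_push assms(2)])

text \<open>The kernel of \<open>T\<^sup>0(Y) \<rightarrow> T\<^sup>1(K)\<close> is the image of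
  \<open>T\<^sup>0(X)\<close>, whose members take values in \<open>I\<close>; so it consists of maps
  into \<open>g(I)\<close>. Dividing by all such maps leaves a quotient of a submodule of
  \<open>T\<^sup>1(K)\<close>.\<close>

lemma rel_fg_cocyc_0_mod_image:
  assumes I: "submodule I R X"
    and sub: "\<And>\<chi> y. \<chi> \<in> cocyc X 0 \<Longrightarrow> y \<in> carrier (F 0) \<Longrightarrow> \<chi> y \<in> I"
    and fgK: "fin_gen R (Ext R F d (X\<lparr>carrier := K\<rparr>) (Suc 0))"
  shows "submodule {\<phi> \<in> cocyc Y 0. \<forall>y\<in>carrier (F 0). \<phi> y \<in> g ` I} R (Hom R (F 0) Y)" (is "submodule ?N R _")
    and "rel_fg R (Hom R (F 0) Y) (cocyc Y 0) {\<phi> \<in> cocyc Y 0. \<forall>y\<in>carrier (F 0). \<phi> y \<in> g ` I}"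
proof -
  interpret H: module R "Hom R (F 0) Y" by (rule Hom_F_module[OF Y])
  have gI: "submodule (g ` I) R Y" by (rule submodule_image[OF X Y g I])
  have "submodule {\<phi> \<in> cocyc Y 0. \<forall>y\<in>carrier (F 0). \<phi> y \<in> P} R (Hom R (F 0) Y)" if "submodule P R Y" for P
    using submodule_cocyc[OF Y, of 0] that unfolding H.submodule_iff Y.submodule_iff by auto
  from this[OF gI] show N: "submodule ?N R (Hom R (F 0) Y)" .
  show "rel_fg R (Hom R (F 0) Y) (cocyc Y 0) ?N"
  proof (rule rel_fg_inj[OF Hom_F_module[OF Y] Hom_F_module[OF K_module] lin_rel_conn[OF X Y g K_submodule]
        submodule_cocyc[OF Y] submodule_cocyc[OF K_module] N _ submodule_cobd[OF K_module]
        fgK[unfolded fin_gen_Ext_iff[OF K_module]]])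
    fix \<omega> \<psi> assume \<omega>: "\<omega> \<in> cocyc Y 0" and "\<psi> \<in> cobd (X\<lparr>carrier := K\<rparr>) (Suc 0)" "(\<omega>, \<psi>) \<in> conn X Y g K 0"
    then obtain \<phi> where "\<phi> \<in> cocyc X 0" "(\<phi>, \<omega>) \<in> push R (F 0) X Y g"
      using conn_exact[OF cocycD(1)[OF \<omega>]] by blast
    then show "\<omega> \<in> ?N" using \<omega> sub by (auto simp: push_def)
  qed (use conn_total in auto)
qed

text \<open>Exactness of \<open>T\<^sup>i(Y) \<rightarrow> T\<^sup>i\<^sup>+\<^sup>1(K)
  \<rightarrow> T\<^sup>i\<^sup>+\<^sup>1(X)\<close>.\<close>

lemma fin_gen_Ext_left:
  assumes fgY: "fin_gen R (Ext R F d Y i)" and fgX: "fin_gen R (Ext R F d X (Suc i))"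
  shows "fin_gen R (Ext R F d (X\<lparr>carrier := K\<rparr>) (Suc i))"
  unfolding fin_gen_Ext_iff[OF K_module]
proof (rule rel_fg_exact[OF Hom_F_module[OF Y] Hom_F_module[OF K_module] Hom_F_module[OF X]
      lin_rel_conn[OF X Y g K_submodule] lin_rel_push[OF F_module K_module X]
      submodule_cocyc[OF Y] submodule_cocyc[OF K_module] submodule_cocyc[OF X]
      submodule_cobd[OF Y] cobd_subset_cocyc[OF K_module] submodule_cobd[OF X]
      fgY[unfolded fin_gen_Ext_iff[OF Y]] fgX[unfolded fin_gen_Ext_iff[OF X]]])
  let ?K = "X\<lparr>carrier := K\<rparr>"
  show incl: "(\<lambda>x. x) \<in> mod_hom R ?K X" by (rule mod_homI) (auto simp: K_iff)
  fix \<omega> \<psi> assume \<omega>: "\<omega> \<in> cobd Y i" and c: "(\<omega>, \<psi>) \<in> conn X Y g K i"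
  obtain \<chi> where \<chi>: "\<chi> \<in> carrier (Hom R (F i) X)" "\<forall>y\<in>carrier (F i). g (\<chi> y) = \<omega> y"
    "\<forall>y\<in>carrier (F (Suc i)). \<psi> y = \<chi> (d i y)"
    and \<psi>: "\<psi> \<in> carrier (Hom R (F (Suc i)) ?K)"
    using c unfolding conn_def by blast
  have \<chi>c: "\<chi> y \<in> carrier X" if "y \<in> carrier (F i)" for y by (rule Hom_apply_closed[OF \<chi>(1) that])
  \<comment> \<open>The class of \<open>\<psi>\<close> must vanish for every lift
    \<open>\<chi>\<close> that \<open>conn\<close> admits. If \<open>\<omega> = \<theta> d\<close>,
    subtracting from \<open>\<chi>\<close> a lift of \<open>\<theta>\<close> composed with
    \<open>d\<close> moves it into \<open>K\<close> and leaves \<open>\<chi> d\<close> unchanged, as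
    \<open>d d = 0\<close>. In degree 0 the lift is in \<open>K\<close> already.\<close>
  show "\<psi> \<in> cobd ?K (Suc i)"
  proof (cases i)
    case 0
    have "\<chi> y \<in> K" if "y \<in> carrier (F i)" for y
      using that \<omega> \<chi>(2) \<chi>c[OF that] unfolding 0 by (simp add: K_iff cobd_0_iff)
    then have "\<chi> \<in> carrier (Hom R (F i) ?K)" by (rule Hom_submoduleI[OF \<chi>(1)])
    then show ?thesis using \<psi> \<chi>(3) by (intro cobd_SucI[of _ _ _ \<chi>]) auto
  next
    case (Suc j)
    obtain \<theta> where \<theta>: "\<theta> \<in> carrier (Hom R (F j) Y)" "\<And>y. y \<in> carrier (F (Suc j)) \<Longrightarrow> \<omega> y = \<theta> (d j y)"
      using cobd_SucE[OF \<omega>[unfolded Suc]] by metis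
    obtain \<rho> where \<rho>: "\<rho> \<in> carrier (Hom R (F j) X)" "\<And>y. y \<in> carrier (F j) \<Longrightarrow> g (\<rho> y) = \<theta> y"
      using ex_Hom_lift[OF \<theta>(1)] by blast
    obtain \<sigma> where \<sigma>: "\<sigma> \<in> carrier (Hom R (F i) X)" "\<And>y. y \<in> carrier (F i) \<Longrightarrow> \<sigma> y = \<rho> (d j y)"
      using ex_comp_d[OF \<rho>(1)] unfolding Suc by metis
    let ?\<tau> = "\<chi> \<oplus>\<^bsub>Hom R (F i) X\<^esub> \<ominus>\<^bsub>Hom R (F i) X\<^esub> \<sigma>"
    have \<tau>: "?\<tau> y = \<chi> y \<oplus>\<^bsub>X\<^esub> \<ominus>\<^bsub>X\<^esub> \<sigma> y" if "y \<in> carrier (F i)" for y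
      by (rule Hom_diff_apply[OF X \<chi>(1) \<sigma>(1) that])
    have \<sigma>c: "\<sigma> y \<in> carrier X" if "y \<in> carrier (F i)" for y by (rule Hom_apply_closed[OF \<sigma>(1) that])
    have "?\<tau> y \<in> K" if y: "y \<in> carrier (F i)" for y
    proof -
      have "g (\<sigma> y) = \<omega> y" using \<sigma>(2)[OF y] \<rho>(2) \<theta>(2) y d_closed unfolding Suc by simp
      then have "g (?\<tau> y) = g (\<sigma> y) \<oplus>\<^bsub>Y\<^esub> \<ominus>\<^bsub>Y\<^esub> g (\<sigma> y)"
        using \<chi>(2) y unfolding \<tau>[OF y] by (simp add: mod_hom_diff[OF X Y g \<chi>c[OF y] \<sigma>c[OF y]])
      then show ?thesis
        using mod_homD(1)[OF g \<sigma>c[OF y]] \<chi>c[OF y] \<sigma>c[OF y] unfolding K_iff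
        by (simp add: Y.M.r_neg \<tau>[OF y])
    qed
    then have "?\<tau> \<in> carrier (Hom R (F i) ?K)" by (rule Hom_submoduleI[OF Hom_diff_closed[OF X \<chi>(1) \<sigma>(1)]])
    moreover have "\<psi> y = ?\<tau> (d i y)" if y: "y \<in> carrier (F (Suc i))" for y
    proof -
      have "\<sigma> (d i y) = \<zero>\<^bsub>X\<^esub>"
        using \<sigma>(2)[OF d_closed[OF y]] y mod_hom_zero[OF F_module X Hom_mod_hom[OF \<rho>(1)]]
        unfolding Suc by (simp add: d_d)
      then show ?thesis using \<chi>(3) y \<chi>c[OF d_closed[OF y]] by (simp only: \<tau>[OF d_closed[OF y]]) simp
    qed
    ultimately show ?thesis using \<psi> by (intro cobd_SucI[of _ _ _ ?\<tau>])
  qed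
next
  let ?K = "X\<lparr>carrier := K\<rparr>"
  fix \<psi> assume \<psi>: "\<psi> \<in> cocyc ?K (Suc i)"
  note \<psi>X = Hom_K_D[OF cocycD(1)[OF \<psi>]]
  have "(\<psi>, \<psi>) \<in> push R (F (Suc i)) ?K X (\<lambda>x. x)" using cocycD(1)[OF \<psi>] \<psi>X by (simp add: push_def)
  moreover have "\<psi> \<in> cocyc X (Suc i)" using cocycD(2)[OF \<psi>] by (intro cocycI[OF \<psi>X]) simp
  ultimately show "\<exists>\<phi>\<in>cocyc X (Suc i). (\<psi>, \<phi>) \<in> push R (F (Suc i)) ?K X (\<lambda>x. x)" by blast
next
  let ?K = "X\<lparr>carrier := K\<rparr>"
  fix \<psi> \<phi> assume \<psi>: "\<psi> \<in> cocyc ?K (Suc i)" and \<phi>: "\<phi> \<in> cobd X (Suc i)"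
    and p: "(\<psi>, \<phi>) \<in> push R (F (Suc i)) ?K X (\<lambda>x. x)"
  obtain \<chi> where \<chi>: "\<chi> \<in> carrier (Hom R (F i) X)" "\<And>y. y \<in> carrier (F (Suc i)) \<Longrightarrow> \<phi> y = \<chi> (d i y)"
    using cobd_SucE[OF \<phi>] by metis
  have \<psi>\<chi>: "\<psi> y = \<chi> (d i y)" if "y \<in> carrier (F (Suc i))" for y
    using p \<chi>(2)[OF that] that by (simp add: push_def)
  \<comment> \<open>A cochain \<open>\<chi>\<close> of \<open>X\<close> with
    \<open>\<chi> d = \<psi>\<close> pushes to a cocycle of \<open>Y\<close>, since
    \<open>\<psi>\<close> has values in \<open>K\<close>; that cocycle is related to
    \<open>\<psi>\<close> by \<open>conn\<close>, with \<open>\<chi>\<close> itself as the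
    lift.\<close>
  obtain \<omega> where \<omega>: "(\<chi>, \<omega>) \<in> push R (F i) X Y g" using ex_push[OF F_module g \<chi>(1)] by blast
  then have \<omega>': "\<omega> \<in> carrier (Hom R (F i) Y)" "\<forall>y\<in>carrier (F i). g (\<chi> y) = \<omega> y" by (auto simp: push_def)
  have "\<omega> \<in> cocyc Y i"
  proof (rule cocycI[OF \<omega>'(1)])
    fix y assume y: "y \<in> carrier (F (Suc i))"
    have "\<psi> y \<in> K" using Hom_apply_closed[OF cocycD(1)[OF \<psi>] y] by simp
    then show "\<omega> (d i y) = \<zero>\<^bsub>Y\<^esub>" using \<omega>'(2) d_closed[OF y] \<psi>\<chi>[OF y] by (simp add: K_iff)
  qed
  moreover have "(\<omega>, \<psi>) \<in> conn X Y g K i"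
    unfolding conn_def using \<omega>' cocycD(1)[OF \<psi>] \<chi>(1) \<psi>\<chi> by auto
  moreover have "\<psi> \<oplus>\<^bsub>Hom R (F (Suc i)) ?K\<^esub> \<ominus>\<^bsub>Hom R (F (Suc i)) ?K\<^esub> \<psi> \<in> cobd ?K (Suc i)"
  proof -
    interpret H: module R "Hom R (F (Suc i)) ?K" by (rule Hom_F_module[OF K_module])
    show ?thesis
      using cocycD(1)[OF \<psi>] submodule_cobd[OF K_module, of "Suc i"] by (simp add: H.M.r_neg H.submodule_iff)
  qed
  ultimately show "\<exists>\<omega>\<in>cocyc Y i. \<exists>\<psi>'\<in>cocyc ?K (Suc i). (\<omega>, \<psi>') \<in> conn X Y g K i \<and>
      \<psi> \<oplus>\<^bsub>Hom R (F (Suc i)) ?K\<^esub> \<ominus>\<^bsub>Hom R (F (Suc i)) ?K\<^esub> \<psi>' \<in> cobd ?K (Suc i)"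
    using \<psi> by blast
qed

text \<open>Exactness at the \<open>X\<close> term: a cocycle \<open>\<phi>\<close> whose image in
  \<open>Y\<close> is \<open>\<theta> d\<close> is moved into \<open>K\<close> by subtracting the
  coboundary \<open>\<sigma> = \<rho> d\<close>, where \<open>\<rho>\<close> lifts
  \<open>\<theta>\<close>.\<close>

lemma fin_gen_Ext_middle:
  assumes fgK: "fin_gen R (Ext R F d (X\<lparr>carrier := K\<rparr>) (Suc j))" and fgY: "fin_gen R (Ext R F d Y (Suc j))"
  shows "fin_gen R (Ext R F d X (Suc j))"
  unfolding fin_gen_Ext_iff[OF X]
proof (rule rel_fg_exact[OF Hom_F_module[OF K_module] Hom_F_module[OF X] Hom_F_module[OF Y]
      lin_rel_push[OF F_module K_module X] lin_rel_push[OF F_module X Y g]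
      submodule_cocyc[OF K_module] submodule_cocyc[OF X] submodule_cocyc[OF Y]
      submodule_cobd[OF K_module] cobd_subset_cocyc[OF X] submodule_cobd[OF Y]
      fgK[unfolded fin_gen_Ext_iff[OF K_module]] fgY[unfolded fin_gen_Ext_iff[OF Y]]])
  let ?K = "X\<lparr>carrier := K\<rparr>" let ?i = "Suc j"
  show "(\<lambda>x. x) \<in> mod_hom R ?K X" by (rule mod_homI) (auto simp: K_iff)
  fix \<psi> \<phi> assume \<psi>: "\<psi> \<in> cobd ?K ?i" and p: "(\<psi>, \<phi>) \<in> push R (F ?i) ?K X (\<lambda>x. x)"
  obtain \<chi> where \<chi>: "\<chi> \<in> carrier (Hom R (F j) ?K)" "\<And>y. y \<in> carrier (F ?i) \<Longrightarrow> \<psi> y = \<chi> (d j y)"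
    using cobd_SucE[OF \<psi>] by metis
  show "\<phi> \<in> cobd X ?i"
    using p \<chi>(2) by (intro cobd_SucI[OF _ Hom_K_D[OF \<chi>(1)]]) (auto simp: push_def)
next
  fix \<phi> assume \<phi>: "\<phi> \<in> cocyc X (Suc j)"
  obtain \<omega> where \<omega>: "(\<phi>, \<omega>) \<in> push R (F (Suc j)) X Y g" using ex_push[OF F_module g cocycD(1)[OF \<phi>]] by blast
  then have "\<omega> \<in> cocyc Y (Suc j)"
    using cocycD(2)[OF \<phi>] mod_hom_zero[OF X Y g] by (intro cocycI) (auto simp: push_def d_closed)
  with \<omega> show "\<exists>\<omega>\<in>cocyc Y (Suc j). (\<phi>, \<omega>) \<in> push R (F (Suc j)) X Y g" by blast
next
  let ?K = "X\<lparr>carrier := K\<rparr>" let ?i = "Suc j"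
  fix \<phi> \<omega> assume \<phi>: "\<phi> \<in> cocyc X ?i" and \<omega>: "\<omega> \<in> cobd Y ?i" and p: "(\<phi>, \<omega>) \<in> push R (F ?i) X Y g"
  note \<phi>c = cocycD(1)[OF \<phi>]
  obtain \<theta> where \<theta>: "\<theta> \<in> carrier (Hom R (F j) Y)" "\<And>y. y \<in> carrier (F ?i) \<Longrightarrow> \<omega> y = \<theta> (d j y)"
    using cobd_SucE[OF \<omega>] by metis
  obtain \<rho> where \<rho>: "\<rho> \<in> carrier (Hom R (F j) X)" "\<And>y. y \<in> carrier (F j) \<Longrightarrow> g (\<rho> y) = \<theta> y"
    using ex_Hom_lift[OF \<theta>(1)] by blast
  obtain \<sigma> where \<sigma>: "\<sigma> \<in> carrier (Hom R (F ?i) X)" "\<And>y. y \<in> carrier (F ?i) \<Longrightarrow> \<sigma> y = \<rho> (d j y)"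
    using ex_comp_d[OF \<rho>(1)] by metis
  have \<sigma>B: "\<sigma> \<in> cobd X ?i" by (rule cobd_SucI[OF \<sigma>(1) \<rho>(1) \<sigma>(2)])
  interpret H: module R "Hom R (F ?i) X" by (rule Hom_F_module[OF X])
  let ?\<tau> = "\<phi> \<oplus>\<^bsub>Hom R (F ?i) X\<^esub> \<ominus>\<^bsub>Hom R (F ?i) X\<^esub> \<sigma>"
  have \<tau>: "?\<tau> y = \<phi> y \<oplus>\<^bsub>X\<^esub> \<ominus>\<^bsub>X\<^esub> \<sigma> y" if "y \<in> carrier (F ?i)" for y
    by (rule Hom_diff_apply[OF X \<phi>c \<sigma>(1) that])
  have \<tau>Z: "?\<tau> \<in> cocyc X ?i"
    by (rule H.submodule_sub[OF submodule_cocyc[OF X] \<phi>]) (use \<sigma>B cobd_subset_cocyc[OF X] in blast)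
  have "?\<tau> y \<in> K" if y: "y \<in> carrier (F ?i)" for y
  proof -
    have c: "\<phi> y \<in> carrier X" "\<sigma> y \<in> carrier X"
      using Hom_apply_closed[OF \<phi>c y] Hom_apply_closed[OF \<sigma>(1) y] by auto
    have "g (\<phi> y) = g (\<sigma> y)"
      using p y \<sigma>(2)[OF y] \<rho>(2)[OF d_closed[OF y]] \<theta>(2)[OF y] by (simp add: push_def)
    then have "g (?\<tau> y) = g (\<sigma> y) \<oplus>\<^bsub>Y\<^esub> \<ominus>\<^bsub>Y\<^esub> g (\<sigma> y)"
      unfolding \<tau>[OF y] by (simp add: mod_hom_diff[OF X Y g c])
    then show ?thesis
      using mod_homD(1)[OF g c(2)] c unfolding K_iff by (simp add: Y.M.r_neg \<tau>[OF y])
  qed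
  then have \<tau>K: "?\<tau> \<in> carrier (Hom R (F ?i) ?K)" by (rule Hom_submoduleI[OF cocycD(1)[OF \<tau>Z]])
  have "?\<tau> \<in> cocyc ?K ?i" using cocycD(2)[OF \<tau>Z] by (intro cocycI[OF \<tau>K]) simp
  moreover have "(?\<tau>, ?\<tau>) \<in> push R (F ?i) ?K X (\<lambda>x. x)"
    unfolding push_def using \<tau>K cocycD(1)[OF \<tau>Z] by auto
  moreover have "\<phi> \<oplus>\<^bsub>Hom R (F ?i) X\<^esub> \<ominus>\<^bsub>Hom R (F ?i) X\<^esub> ?\<tau> = \<sigma>"
    using \<phi>c \<sigma>(1) by (simp add: H.M.minus_add H.M.r_neg2)
  ultimately show "\<exists>\<tau>\<in>cocyc ?K ?i. \<exists>\<tau>'\<in>cocyc X ?i. (\<tau>, \<tau>') \<in> push R (F ?i) ?K X (\<lambda>x. x) \<and>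
      \<phi> \<oplus>\<^bsub>Hom R (F ?i) X\<^esub> \<ominus>\<^bsub>Hom R (F ?i) X\<^esub> \<tau>' \<in> cobd X ?i"
    using \<sigma>B \<tau>Z by metis
qed

end

end

section \<open>Torsion, isomorphisms and degree 0\<close>

context free_complex
begin

text \<open>\<open>T\<^sup>1(C \<inter> I)\<close> embeds in \<open>T\<^sup>1(C)\<close>. If
  \<open>\<phi>\<close> bounds by \<open>\<chi>\<close> in \<open>C\<close>, it also bounds by some
  \<open>\<theta>\<close> in the injective \<open>I\<close>. The difference is a 0-cocycle of
  \<open>E\<close>, hence valued in \<open>I\<close>, so \<open>\<chi>\<close> was valued in
  \<open>C \<inter> I\<close> from the start.\<close>

lemma fin_gen_Ext_1_Int:
  assumes E: "module R E" and I: "submodule I R E" and C: "submodule C R E"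
    and baer: "baer R (E\<lparr>carrier := I\<rparr>)"
    and sub: "\<And>\<chi> y. \<chi> \<in> cocyc E 0 \<Longrightarrow> y \<in> carrier (F 0) \<Longrightarrow> \<chi> y \<in> I"
    and fg: "fin_gen R (Ext R F d (E\<lparr>carrier := C\<rparr>) (Suc 0))"
  shows "fin_gen R (Ext R F d (E\<lparr>carrier := C \<inter> I\<rparr>) (Suc 0))"
proof -
  interpret E: module R E by (rule E)
  have CI: "submodule (C \<inter> I) R E" by (rule E.submodule_Int[OF C I])
  have sets: "I \<subseteq> carrier E" "C \<subseteq> carrier E" "C \<inter> I \<subseteq> carrier E"
    using E.submoduleE(1)[OF I] E.submoduleE(1)[OF C] by auto
  note C' = submodule_imp_module[OF E C] and I' = submodule_imp_module[OF E I] and CI' = submodule_imp_module[OF E CI]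
  show ?thesis
    unfolding fin_gen_Ext_iff[OF CI']
  proof (rule rel_fg_inj[OF Hom_F_module[OF CI'] Hom_F_module[OF C'] lin_rel_push[OF F_module CI' C' incl_mod_hom]
        submodule_cocyc[OF CI'] submodule_cocyc[OF C'] submodule_cobd[OF CI'] cobd_subset_cocyc[OF CI']
        submodule_cobd[OF C'] fg[unfolded fin_gen_Ext_iff[OF C']]])
    fix \<phi> assume \<phi>: "\<phi> \<in> cocyc (E\<lparr>carrier := C \<inter> I\<rparr>) (Suc 0)"
    have \<phi>y: "\<phi> y \<in> C \<inter> I" if "y \<in> carrier (F (Suc 0))" for y
      using Hom_apply_closed[OF cocycD(1)[OF \<phi>] that] by simp
    note \<phi>E = Hom_submoduleD[OF cocycD(1)[OF \<phi>] sets(3)]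
    have \<phi>C: "\<phi> \<in> carrier (Hom R (F (Suc 0)) (E\<lparr>carrier := C\<rparr>))"
      by (rule Hom_submoduleI[OF \<phi>E]) (use \<phi>y in blast)
    have "\<phi> \<in> cocyc (E\<lparr>carrier := C\<rparr>) (Suc 0)" using cocycD(2)[OF \<phi>] by (intro cocycI[OF \<phi>C]) simp
    then show "\<exists>\<psi>\<in>cocyc (E\<lparr>carrier := C\<rparr>) (Suc 0).
        (\<phi>, \<psi>) \<in> push R (F (Suc 0)) (E\<lparr>carrier := C \<inter> I\<rparr>) (E\<lparr>carrier := C\<rparr>) (\<lambda>x. x)"
      using cocycD(1)[OF \<phi>] \<phi>C by (intro bexI[of _ \<phi>]) (simp_all add: push_def)
    fix \<psi> assume \<psi>: "\<psi> \<in> cobd (E\<lparr>carrier := C\<rparr>) (Suc 0)"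
      and p: "(\<phi>, \<psi>) \<in> push R (F (Suc 0)) (E\<lparr>carrier := C \<inter> I\<rparr>) (E\<lparr>carrier := C\<rparr>) (\<lambda>x. x)"
    obtain \<chi> where \<chi>C: "\<chi> \<in> carrier (Hom R (F 0) (E\<lparr>carrier := C\<rparr>))"
      and "\<And>y. y \<in> carrier (F (Suc 0)) \<Longrightarrow> \<psi> y = \<chi> (d 0 y)"
      using cobd_SucE[OF \<psi>] by metis
    with p have \<chi>: "\<phi> y = \<chi> (d 0 y)" if "y \<in> carrier (F (Suc 0))" for y
      using that by (simp add: push_def)
    have \<phi>I: "\<phi> \<in> carrier (Hom R (F (Suc 0)) (E\<lparr>carrier := I\<rparr>))"
      by (rule Hom_submoduleI[OF \<phi>E]) (use \<phi>y in blast)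
    have "\<phi> \<in> cocyc (E\<lparr>carrier := I\<rparr>) (Suc 0)" using cocycD(2)[OF \<phi>] by (intro cocycI[OF \<phi>I]) simp
    then have "\<phi> \<in> cobd (E\<lparr>carrier := I\<rparr>) (Suc 0)" using cocyc_subset_cobd_if_baer[OF I' baer] by blast
    then obtain \<theta> where \<theta>I: "\<theta> \<in> carrier (Hom R (F 0) (E\<lparr>carrier := I\<rparr>))"
      and \<theta>: "\<And>y. y \<in> carrier (F (Suc 0)) \<Longrightarrow> \<phi> y = \<theta> (d 0 y)"
      using cobd_SucE by metis
    note \<chi>E = Hom_submoduleD[OF \<chi>C sets(2)] and \<theta>E = Hom_submoduleD[OF \<theta>I sets(1)]
    let ?\<tau> = "\<chi> \<oplus>\<^bsub>Hom R (F 0) E\<^esub> \<ominus>\<^bsub>Hom R (F 0) E\<^esub> \<theta>"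
    note \<tau> = Hom_diff_apply[OF E \<chi>E \<theta>E]
    have c: "\<chi> y \<in> C" "\<theta> y \<in> I" if "y \<in> carrier (F 0)" for y
      using Hom_apply_closed[OF \<chi>C that] Hom_apply_closed[OF \<theta>I that] by auto
    have "?\<tau> \<in> cocyc E 0"
    proof (rule cocycI[OF Hom_diff_closed[OF E \<chi>E \<theta>E]])
      fix y assume y: "y \<in> carrier (F (Suc 0))"
      have "\<chi> (d 0 y) = \<theta> (d 0 y)" using \<chi>[OF y] \<theta>[OF y] by simp
      moreover have "\<theta> (d 0 y) \<in> carrier E" using c(2)[OF d_closed[OF y]] sets by blast
      ultimately show "?\<tau> (d 0 y) = \<zero>\<^bsub>E\<^esub>" by (simp only: \<tau>[OF d_closed[OF y]] E.M.r_neg)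
    qed
    then have "\<chi> y \<oplus>\<^bsub>E\<^esub> \<ominus>\<^bsub>E\<^esub> \<theta> y \<in> I" if "y \<in> carrier (F 0)" for y using sub \<tau>[OF that] that by metis
    then have "\<chi> y \<in> C \<inter> I" if y: "y \<in> carrier (F 0)" for y
      using E.submodule_diff_cancel[OF I _ c(2)[OF y]] c(1)[OF y] sets y by blast
    then have "\<chi> \<in> carrier (Hom R (F 0) (E\<lparr>carrier := C \<inter> I\<rparr>))" by (rule Hom_submoduleI[OF \<chi>E])
    then show "\<phi> \<in> cobd (E\<lparr>carrier := C \<inter> I\<rparr>) (Suc 0)"
      by (rule cobd_SucI[OF cocycD(1)[OF \<phi>] _ \<chi>])
  qed simp
qed

end

text \<open>Supplies two trivial ends: the kernel of an isomorphism and the coboundaries in degree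
  0.\<close>

lemma baer_zero:
  assumes M: "module R M"
  shows "baer R (M\<lparr>carrier := {\<zero>\<^bsub>M\<^esub>}\<rparr>)"
proof -
  interpret M: module R M by (rule M)
  have "y = r \<odot>\<^bsub>M\<^esub> \<zero>\<^bsub>M\<^esub>" if "lin_rel R (regular_module R) (M\<lparr>carrier := {\<zero>\<^bsub>M\<^esub>}\<rparr>) G" "(r, y) \<in> G" for G r y
    using lin_relD(1,2)[OF that] by simp
  then show ?thesis unfolding baer_def by auto
qed

text \<open>An isomorphism is a surjection with kernel zero, so the piece ending in
  \<open>T\<^sup>i\<^sup>+\<^sup>1(0) = 0\<close> applies, even across carrier types.\<close>

lemma (in free_complex) fin_gen_Ext_iso:
  assumes M: "module R M" and N: "module R N" and f: "f \<in> mod_hom R M N"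
    and inj: "inj_on f (carrier M)" and surj: "f ` carrier M = carrier N"
    and fg: "fin_gen R (Ext R F d M i)"
  shows "fin_gen R (Ext R F d N i)"
proof -
  interpret M: module R M by (rule M)
  have f0: "f \<zero>\<^bsub>M\<^esub> = \<zero>\<^bsub>N\<^esub>" by (rule mod_hom_zero[OF M N f])
  have "a_kernel M N f = {\<zero>\<^bsub>M\<^esub>}"
    unfolding a_kernel_def'
  proof (intro equalityI subsetI)
    fix x assume "x \<in> {x \<in> carrier M. f x = \<zero>\<^bsub>N\<^esub>}"
    then show "x \<in> {\<zero>\<^bsub>M\<^esub>}" using inj_onD[OF inj, of x "\<zero>\<^bsub>M\<^esub>"] f0 by simp
  qed (simp add: f0)
  then show ?thesis
    using fin_gen_Ext_right[OF M N f surj refl fg]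
      fin_gen_Ext_baer[OF submodule_imp_module[OF M M.submodule_zero] baer_zero[OF M]] by simp
qed

text \<open>A cocycle of degree \<open>0\<close> factors through \<open>R/\<aa>\<close>, so its values are annihilated by \<open>\<aa>\<close>.\<close>

lemma (in free_complex) cocyc_0_torsion:
  assumes a: "ideal \<aa> R" and res: "free_resolution R (quot_ring_module R \<aa>) F d \<epsilon>"
    and E: "module R E" and \<chi>: "\<chi> \<in> cocyc E 0" and y: "y \<in> carrier (F 0)"
  shows "\<chi> y \<in> carrier (torsion_part R \<aa> E)"
proof -
  let ?Q = "quot_ring_module R \<aa>"
  interpret E: module R E by (rule E)
  interpret F0: module R "F 0" by (rule F_module)
  have a': "submodule \<aa> R (regular_module R)" using a by (simp add: submodule_regular_iff_ideal)
  have \<epsilon>: "\<epsilon> \<in> mod_hom R (F 0) ?Q" and ker: "a_kernel (F 0) ?Q \<epsilon> = d 0 ` carrier (F 1)"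
    using res by (simp_all add: free_resolution_def)
  have \<chi>h: "\<chi> \<in> mod_hom R (F 0) E" by (rule Hom_mod_hom[OF cocycD(1)[OF \<chi>]])
  have "r \<odot>\<^bsub>E\<^esub> \<chi> y = \<zero>\<^bsub>E\<^esub>" if r: "r \<in> \<aa>" for r
  proof -
    have rc: "r \<in> carrier R" by (rule ideal.Icarr[OF a r])
    obtain x where x: "x \<in> carrier R" "\<epsilon> y = \<aa> +>\<^bsub>regular_module R\<^esub> x"
      using mod_homD(1)[OF \<epsilon> y] by (auto simp: quot_module_carrier[OF regular_module a'])
    have "\<epsilon> (r \<odot>\<^bsub>F 0\<^esub> y) = \<aa> +>\<^bsub>regular_module R\<^esub> (r \<otimes> x)"
      using quot_module_smult[OF regular_module a' rc, of x] x by (simp add: mod_homD(3)[OF \<epsilon> rc y])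
    also have "\<dots> = \<zero>\<^bsub>?Q\<^esub>"
      using coset_zero_iff[OF regular_module a', of "r \<otimes> x"] ideal.I_r_closed[OF a r x(1)] rc x(1)
      by (simp add: quot_module_zero[OF regular_module a'])
    finally have "r \<odot>\<^bsub>F 0\<^esub> y \<in> a_kernel (F 0) ?Q \<epsilon>" using rc y by (simp add: a_kernel_def')
    then obtain z where z: "z \<in> carrier (F (Suc 0))" "r \<odot>\<^bsub>F 0\<^esub> y = d 0 z" unfolding ker by auto
    have "r \<odot>\<^bsub>E\<^esub> \<chi> y = \<chi> (r \<odot>\<^bsub>F 0\<^esub> y)" by (rule mod_homD(3)[OF \<chi>h rc y, symmetric])
    then show ?thesis using cocycD(2)[OF \<chi> z(1)] z(2) by simp
  qed
  then have "\<forall>r \<in> \<aa> [^]\<^bsub>ideals_set R\<^esub> Suc 0. r \<odot>\<^bsub>E\<^esub> \<chi> y = \<zero>\<^bsub>E\<^esub>" unfolding ideal_pow_1[OF a] by blast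
  then show ?thesis unfolding torsion_part_carrier using mod_homD(1)[OF \<chi>h y] by blast
qed

text \<open>Left exactness of \<open>Hom\<close>: composition with \<open>\<epsilon>\<close>
  identifies \<open>Hom(N, X)\<close> with the maps on \<open>F 0\<close> that vanish on the image
  of \<open>d 0\<close>.\<close>

lemma (in free_complex) fin_gen_Hom_iff_Ext_0:
  assumes N: "module R N" and res: "free_resolution R N F d \<epsilon>" and X: "module R X"
  shows "fin_gen R (Hom R N X) \<longleftrightarrow> fin_gen R (Ext R F d X 0)"
proof -
  interpret N: module R N by (rule N)
  interpret X: module R X by (rule X)
  interpret H: module R "Hom R N X" by (rule Hom_module[OF N X])
  have \<epsilon>: "\<epsilon> \<in> mod_hom R (F 0) N" and surj: "\<epsilon> ` carrier (F 0) = carrier N"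
    and ker: "a_kernel (F 0) N \<epsilon> = d 0 ` carrier (F 1)"
    using res by (simp_all add: free_resolution_def)
  interpret F0: module R "F 0" by (rule F_module)
  let ?G = "{(f, \<phi>). f \<in> carrier (Hom R N X) \<and> \<phi> \<in> carrier (Hom R (F 0) X) \<and> (\<forall>y\<in>carrier (F 0). \<phi> y = f (\<epsilon> y))}"
  note \<epsilon>c = mod_homD(1)[OF \<epsilon>]
  have "rel_fg R (Hom R N X) (carrier (Hom R N X)) {\<zero>\<^bsub>Hom R N X\<^esub>} \<longleftrightarrow> rel_fg R (Hom R (F 0) X) (cocyc X 0) (cobd X 0)"
  proof (rule rel_fg_cong[OF Hom_module[OF N X] Hom_F_module[OF X] _ H.carrier_is_submodule submodule_cocyc[OF X]
        H.submodule_zero _ submodule_cobd[OF X] cobd_subset_cocyc[OF X]])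
    show "lin_rel R (Hom R N X) (Hom R (F 0) X) ?G"
      by (rule lin_relI) (auto simp: \<epsilon>c Hom_closed[OF N X] Hom_closed[OF F_module X])
  next
    fix f assume f: "f \<in> carrier (Hom R N X)"
    let ?\<phi> = "restrict (\<lambda>y. f (\<epsilon> y)) (carrier (F 0))"
    have \<phi>: "?\<phi> \<in> carrier (Hom R (F 0) X)"
      by (rule restrict_Hom[OF F_module mod_hom_comp[OF \<epsilon> Hom_mod_hom[OF f]]])
    have "?\<phi> \<in> cocyc X 0"
    proof (rule cocycI[OF \<phi>])
      fix y assume y: "y \<in> carrier (F (Suc 0))"
      then have "d 0 y \<in> a_kernel (F 0) N \<epsilon>" unfolding ker by auto
      then have "\<epsilon> (d 0 y) = \<zero>\<^bsub>N\<^esub>" by (simp add: a_kernel_def')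
      then show "?\<phi> (d 0 y) = \<zero>\<^bsub>X\<^esub>"
        using d_closed[OF y] mod_hom_zero[OF N X Hom_mod_hom[OF f]] by simp
    qed
    then show "\<exists>\<phi>\<in>cocyc X 0. (f, \<phi>) \<in> ?G" using f \<phi> by (intro bexI[of _ ?\<phi>]) auto
  next
    fix \<phi> assume \<phi>: "\<phi> \<in> cocyc X 0"
    note \<phi>h = Hom_mod_hom[OF cocycD(1)[OF \<phi>]]
    \<comment> \<open>A set-theoretic section of \<open>\<epsilon>\<close>, in general not linear.
      Its composite with \<open>\<phi>\<close> is linear because \<open>\<phi>\<close> is constant
      on the fibres of \<open>\<epsilon>\<close>.\<close>
    define s where "s x = (SOME y. y \<in> carrier (F 0) \<and> \<epsilon> y = x)" for x
    have s: "s x \<in> carrier (F 0)" "\<epsilon> (s x) = x" if "x \<in> carrier N" for x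
    proof -
      have "x \<in> \<epsilon> ` carrier (F 0)" using that surj by simp
      then have "\<exists>y. y \<in> carrier (F 0) \<and> \<epsilon> y = x" by auto
      from someI_ex[OF this] show "s x \<in> carrier (F 0)" "\<epsilon> (s x) = x" unfolding s_def by auto
    qed
    have eq: "\<phi> y = \<phi> y'" if y: "y \<in> carrier (F 0)" "y' \<in> carrier (F 0)" "\<epsilon> y = \<epsilon> y'" for y y'
    proof -
      have "\<epsilon> (y \<oplus>\<^bsub>F 0\<^esub> \<ominus>\<^bsub>F 0\<^esub> y') = \<zero>\<^bsub>N\<^esub>"
        using y \<epsilon>c by (simp add: mod_hom_diff[OF F_module N \<epsilon>] N.M.r_neg)
      then have "y \<oplus>\<^bsub>F 0\<^esub> \<ominus>\<^bsub>F 0\<^esub> y' \<in> a_kernel (F 0) N \<epsilon>" using y by (simp add: a_kernel_def')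
      then obtain z where "z \<in> carrier (F (Suc 0))" "y \<oplus>\<^bsub>F 0\<^esub> \<ominus>\<^bsub>F 0\<^esub> y' = d 0 z" unfolding ker by auto
      then have "\<phi> (y \<oplus>\<^bsub>F 0\<^esub> \<ominus>\<^bsub>F 0\<^esub> y') = \<zero>\<^bsub>X\<^esub>" using cocycD(2)[OF \<phi>] by simp
      then have "\<phi> y \<oplus>\<^bsub>X\<^esub> \<ominus>\<^bsub>X\<^esub> \<phi> y' = \<zero>\<^bsub>X\<^esub>" by (simp add: mod_hom_diff[OF F_module X \<phi>h y(1,2)])
      then show ?thesis
        using mod_homD(1)[OF \<phi>h y(1)] mod_homD(1)[OF \<phi>h y(2)]
        by (metis X.M.minus_equality X.M.minus_minus X.M.a_inv_closed)
    qed
    have f: "(\<lambda>x. \<phi> (s x)) \<in> mod_hom R N X"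
    proof (rule mod_homI)
      fix x assume x: "x \<in> carrier N"
      show "\<phi> (s x) \<in> carrier X" by (rule mod_homD(1)[OF \<phi>h s(1)[OF x]])
      show "\<phi> (s (r \<odot>\<^bsub>N\<^esub> x)) = r \<odot>\<^bsub>X\<^esub> \<phi> (s x)" if r: "r \<in> carrier R" for r
        unfolding mod_homD(3)[OF \<phi>h r s(1)[OF x], symmetric]
        by (rule eq) (use x r s in \<open>simp_all add: mod_homD(3)[OF \<epsilon>]\<close>)
      fix y assume y: "y \<in> carrier N"
      show "\<phi> (s (x \<oplus>\<^bsub>N\<^esub> y)) = \<phi> (s x) \<oplus>\<^bsub>X\<^esub> \<phi> (s y)"
        unfolding mod_homD(2)[OF \<phi>h s(1)[OF x] s(1)[OF y], symmetric]
        by (rule eq) (use x y s in \<open>simp_all add: mod_homD(2)[OF \<epsilon>]\<close>)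
    qed
    have "(restrict (\<lambda>x. \<phi> (s x)) (carrier N), \<phi>) \<in> ?G"
    proof (intro CollectI case_prodI conjI ballI)
      fix y assume y: "y \<in> carrier (F 0)"
      then show "\<phi> y = restrict (\<lambda>x. \<phi> (s x)) (carrier N) (\<epsilon> y)"
        using eq[OF y s(1)[OF \<epsilon>c[OF y]]] s(2)[OF \<epsilon>c[OF y]] \<epsilon>c[OF y] by simp
    qed (rule restrict_Hom[OF N f] cocycD(1)[OF \<phi>])+
    then show "\<exists>f\<in>carrier (Hom R N X). (f, \<phi>) \<in> ?G" by blast
  next
    fix f \<phi> assume "f \<in> carrier (Hom R N X)" "(f, \<phi>) \<in> ?G"
    then have f: "f \<in> carrier (Hom R N X)" "\<phi> \<in> carrier (Hom R (F 0) X)" "\<And>y. y \<in> carrier (F 0) \<Longrightarrow> \<phi> y = f (\<epsilon> y)"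
      by auto
    have "f = \<zero>\<^bsub>Hom R N X\<^esub> \<longleftrightarrow> (\<forall>x\<in>carrier N. f x = \<zero>\<^bsub>X\<^esub>)"
      using Hom_eqI[OF f(1) Hom_closed(1)[OF N X]] by auto
    also have "\<dots> \<longleftrightarrow> (\<forall>y\<in>carrier (F 0). \<phi> y = \<zero>\<^bsub>X\<^esub>)"
      unfolding surj[symmetric] using f(3) by auto
    finally show "f \<in> {\<zero>\<^bsub>Hom R N X\<^esub>} \<longleftrightarrow> \<phi> \<in> cobd X 0" using f(2) by (simp add: cobd_0_iff)
  qed (simp add: Hom_closed[OF N X])
  then show ?thesis unfolding H.rel_fg_carrier_iff fin_gen_Ext_iff[OF X] .
qed

lemma (in cring) mod_hom_torsion:
  assumes a: "ideal \<aa> R" and M: "module R M" and N: "module R N" and f: "f \<in> mod_hom R M N"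
    and x: "x \<in> carrier (torsion_part R \<aa> M)"
  shows "f x \<in> carrier (torsion_part R \<aa> N)"
proof -
  obtain n :: nat where x: "x \<in> carrier M" "\<And>r. r \<in> \<aa> [^]\<^bsub>ideals_set R\<^esub> n \<Longrightarrow> r \<odot>\<^bsub>M\<^esub> x = \<zero>\<^bsub>M\<^esub>"
    using x unfolding torsion_part_carrier by blast
  have "r \<odot>\<^bsub>N\<^esub> f x = \<zero>\<^bsub>N\<^esub>" if r: "r \<in> \<aa> [^]\<^bsub>ideals_set R\<^esub> n" for r
    using mod_homD(3)[OF f ideal.Icarr[OF ideal_pow_ideal[OF a] r] x(1)] x(2)[OF r] mod_hom_zero[OF M N f] by simp
  then show ?thesis unfolding torsion_part_carrier using mod_homD(1)[OF f x(1)] by blast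
qed

theorem theoremB:
  fixes R :: "('a, 'r) ring_scheme"
    and \<aa> :: "'a set"
    and M :: "('a, 'm, 'x) module_scheme"
    and F :: "nat \<Rightarrow> ('a, 'f, 'y) module_scheme" and d :: "nat \<Rightarrow> 'f \<Rightarrow> 'f" and \<epsilon> :: "'f \<Rightarrow> 'a set"
    and E :: "nat \<Rightarrow> ('a, 'e, 'z) module_scheme" and \<delta> :: "nat \<Rightarrow> 'e \<Rightarrow> 'e" and \<eta> :: "'m \<Rightarrow> 'e"
    and t :: nat
  assumes "cring R" and "noetherian_ring R"
    and "ideal \<aa> R"
    and "module R M"
    and "free_resolution R (quot_ring_module R \<aa>) F d \<epsilon>"
    and "injective_resolution R M E \<delta> \<eta>"
    and "\<And>i. fin_gen R (Ext R F d M i)"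
    and "\<And>i. i < t \<Longrightarrow> cofinite_module R \<aa> F d (local_cohomology R \<aa> E \<delta> i)"
  shows "fin_gen R (Hom R (quot_ring_module R \<aa>) (local_cohomology R \<aa> E \<delta> (t + 1)))
    \<longleftrightarrow> fin_gen R (Ext R F d (local_cohomology R \<aa> E \<delta> t) 2)"
  proof -
  note cr = assms(1) and noeth = assms(2) and a = assms(3) and M = assms(4) and res = assms(5)
    and inj_res = assms(6) and fgM = assms(7) and cof = assms(8)
  interpret noetherian_cring R by (rule noetherian_cring.intro[OF noeth cr])
  interpret free_complex R F d
    by (rule free_complex.intro[OF noetherian_cring_axioms], rule free_complex_axioms.intro)
      (use res in \<open>auto simp: free_resolution_def\<close>)
  have E_inj: "injective_module R (E n)" and \<delta>: "\<delta> n \<in> mod_hom R (E n) (E (Suc n))" for n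
    using inj_res by (simp_all add: injective_resolution_def)
  have \<eta>: "\<eta> \<in> mod_hom R M (E 0)" "inj_on \<eta> (carrier M)" "a_kernel (E 0) (E 1) (\<delta> 0) = \<eta> ` carrier M"
    and \<delta>_exact: "a_kernel (E (Suc n)) (E (Suc (Suc n))) (\<delta> (Suc n)) = \<delta> n ` carrier (E n)" for n
    using inj_res by (simp_all add: injective_resolution_def)
  have E: "module R (E n)" for n using E_inj by (simp add: injective_module_def)
  have E_baer: "baer R (E n)" for n by (rule injective_imp_baer[OF E_inj])

  \<comment> \<open>The torsion complex and its short exact sequences\<close>
  define I where "I n = carrier (torsion_part R \<aa> (E n))" for n
  define C where "C n = a_kernel (E n) (E (Suc n)) (\<delta> n)" for n
  define Z where "Z n = C n \<inter> I n" for n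
  define B where "B n = (case n of 0 \<Rightarrow> {\<zero>\<^bsub>E 0\<^esub>} | Suc j \<Rightarrow> \<delta> j ` I j)" for n
  let ?E = "\<lambda>n S. E n\<lparr>carrier := S\<rparr>"
  let ?H = "local_cohomology R \<aa> E \<delta>"
  let ?fg = "\<lambda>X i. fin_gen R (Ext R F d X i)"

  have I_sub: "submodule (I n) R (E n)" for n unfolding I_def by (rule submodule_torsion_part[OF a E])
  have C_sub: "submodule (C n) R (E n)" for n unfolding C_def by (rule submodule_kernel[OF E E \<delta>])
  have Z_sub: "submodule (Z n) R (E n)" for n
    unfolding Z_def by (rule module.submodule_Int[OF E C_sub I_sub])
  have B_sub: "submodule (B n) R (E n)" for n
    unfolding B_def using module.submodule_zero[OF E] submodule_image[OF E E \<delta> I_sub] by (cases n) auto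
  have carr: "x \<in> I n \<Longrightarrow> x \<in> carrier (E n)" "x \<in> Z n \<Longrightarrow> x \<in> carrier (E n)" "x \<in> C n \<Longrightarrow> x \<in> carrier (E n)" for x n
    using module.submoduleE(1)[OF E I_sub] module.submoduleE(1)[OF E Z_sub] module.submoduleE(1)[OF E C_sub] by blast+
  have \<delta>_I: "\<delta> n x \<in> I (Suc n)" if "x \<in> I n" for n x
    using mod_hom_torsion[OF a E E \<delta>] that unfolding I_def .
  have \<delta>_C: "\<delta> n ` carrier (E n) = C (Suc n)" for n unfolding C_def \<delta>_exact ..
  have B_Suc: "B (Suc n) = \<delta> n ` I n" for n by (simp add: B_def)
  have B_Z: "B n \<subseteq> Z n" for n
  proof (cases n)
    case 0
    then show ?thesis using module.submodule_iff[OF E, THEN iffD1, OF Z_sub[of 0]] by (simp add: B_def)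
  next
    case (Suc j)
    then show ?thesis using \<delta>_I \<delta>_C[of j] carr(1) unfolding Suc B_Suc Z_def by blast
  qed
  note I_mod = submodule_imp_module[OF E I_sub] and C_mod = submodule_imp_module[OF E C_sub]
    and Z_mod = submodule_imp_module[OF E Z_sub] and B_mod = submodule_imp_module[OF E B_sub]
  have I_eq: "torsion_part R \<aa> (E n) = ?E n (I n)" for n unfolding I_def by (rule torsion_part_eq)
  have I_baer: "baer R (?E n (I n))" for n
    using baer_torsion_part[OF a E E_baer, of n] unfolding I_eq .

  have B_sub_Z: "submodule (B n) R (?E n (Z n))" for n
    using B_sub B_Z by (simp add: submodule_of_submodule[OF E Z_sub])
  \<comment> \<open>Passing to torsion parts changes only carriers, so the cocycles of the torsion
    complex are the torsion elements of \<open>C n\<close>.\<close>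
  have "a_kernel (?E n (I n)) (?E (Suc n) (I (Suc n))) (\<delta> n) = Z n" for n
    using carr(1) unfolding a_kernel_def' Z_def C_def by auto
  moreover have "(case n of 0 \<Rightarrow> {\<zero>\<^bsub>?E 0 (I 0)\<^esub>} | Suc j \<Rightarrow> \<delta> j ` carrier (?E j (I j))) = B n" for n
    unfolding B_def by (cases n) simp_all
  ultimately have H_eq: "?H n = quot_module (?E n (Z n)) (B n)" for n
    unfolding local_cohomology_def cohomology_def I_eq by simp
  have H_mod: "module R (?H n)" for n
    unfolding H_eq by (rule quot_module_is_module[OF Z_mod B_sub_Z])

  have torsion: "\<chi> y \<in> I n" if "\<chi> \<in> cocyc (E n) 0" "y \<in> carrier (F 0)" for n \<chi> y
    unfolding I_def by (rule cocyc_0_torsion[OF a res E that])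

  let ?coset = "\<lambda>n x. B n +>\<^bsub>?E n (Z n)\<^esub> x"
  have coset: "?coset n \<in> mod_hom R (?E n (Z n)) (?H n)" for n
    unfolding H_eq by (rule quot_module_proj[OF Z_mod B_sub_Z])
  have coset_surj: "?coset n ` carrier (?E n (Z n)) = carrier (?H n)" for n
    unfolding H_eq by (rule quot_module_carrier[OF Z_mod B_sub_Z, symmetric])
  have coset_zero: "?coset n x = \<zero>\<^bsub>?H n\<^esub> \<longleftrightarrow> x \<in> B n" if "x \<in> Z n" for n x
    unfolding H_eq quot_module_zero[OF Z_mod B_sub_Z]
    by (rule coset_zero_iff[OF Z_mod B_sub_Z]) (simp add: that)
  have coset_ker: "B n = a_kernel (?E n (Z n)) (?H n) (?coset n)" for n
    using B_Z[of n] coset_zero unfolding a_kernel_def' by auto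
  note H_right = fin_gen_Ext_right[OF Z_mod H_mod coset coset_surj coset_ker, simplified]
    and H_left = fin_gen_Ext_left[OF Z_mod H_mod coset coset_surj coset_ker, simplified]
    and H_middle = fin_gen_Ext_middle[OF Z_mod H_mod coset coset_surj coset_ker, simplified]
    and H_Ext_right = Ext_right[OF Z_mod H_mod coset coset_surj coset_ker, simplified]

  have \<delta>_IB: "\<delta> n \<in> mod_hom R (?E n (I n)) (?E (Suc n) (B (Suc n)))" for n
    unfolding B_Suc by (rule mod_homI) (use carr(1) mod_homD[OF \<delta>[of n]] in auto)
  have \<delta>_IB_surj: "\<delta> n ` carrier (?E n (I n)) = carrier (?E (Suc n) (B (Suc n)))" for n
    by (simp add: B_Suc)
  have \<delta>_IB_ker: "Z n = a_kernel (?E n (I n)) (?E (Suc n) (B (Suc n))) (\<delta> n)" for n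
    using carr(1) unfolding a_kernel_def' Z_def C_def by auto
  note B_right = fin_gen_Ext_right[OF I_mod B_mod \<delta>_IB \<delta>_IB_surj \<delta>_IB_ker, simplified]
    and B_left = fin_gen_Ext_left[OF I_mod B_mod \<delta>_IB \<delta>_IB_surj \<delta>_IB_ker, simplified]

  \<comment> \<open>Dimension shifting along \<open>0 \<rightarrow> C\<^sup>n \<rightarrow>
    E\<^sup>n \<rightarrow> C\<^sup>n\<^sup>+\<^sup>1 \<rightarrow> 0\<close>, from
    \<open>C\<^sup>0 \<cong> M\<close>. Degree \<open>i + 1\<close> at \<open>n + 1\<close> needs
    degree \<open>i + 2\<close> at \<open>n\<close>, so \<open>i\<close> stays arbitrary. Positive
    degrees are those in which \<open>T\<^sup>i(E\<^sup>n)\<close> is known to vanish.\<close>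
  have fgC: "?fg (?E n (C n)) (Suc i)" for n i
  proof (induction n arbitrary: i)
    case 0
    have C0: "C 0 = \<eta> ` carrier M" unfolding C_def using \<eta>(3) by simp
    show ?case
    proof (rule fin_gen_Ext_iso[OF M C_mod _ \<eta>(2) _ fgM])
      show "\<eta> \<in> mod_hom R M (?E 0 (C 0))"
        unfolding C0 by (rule mod_homI) (use mod_homD[OF \<eta>(1)] in auto)
    qed (simp add: C0)
  next
    case (Suc n)
    have \<delta>_EC: "\<delta> n \<in> mod_hom R (E n) (?E (Suc n) (C (Suc n)))"
      unfolding \<delta>_C[symmetric] by (rule mod_homI) (use mod_homD[OF \<delta>[of n]] in auto)
    have ker: "C n = a_kernel (E n) (?E (Suc n) (C (Suc n))) (\<delta> n)" by (simp add: C_def a_kernel_def')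
    show ?case
      by (rule fin_gen_Ext_right[OF E C_mod \<delta>_EC _ ker fin_gen_Ext_baer[OF E E_baer] Suc]) (simp add: \<delta>_C)
  qed

  have fgZ1: "?fg (?E n (Z n)) (Suc 0)" for n
    unfolding Z_def by (rule fin_gen_Ext_1_Int[OF E I_sub C_sub I_baer _ fgC]) (rule torsion)

  \<comment> \<open>\<open>?N n\<close> is \<open>T\<^sup>0(B\<^sup>n)\<close>, viewed inside
    \<open>T\<^sup>0(Z\<^sup>n)\<close>.\<close>
  let ?N = "\<lambda>n. {\<phi> \<in> cocyc (?E n (Z n)) 0. \<forall>y\<in>carrier (F 0). \<phi> y \<in> B n}"
  have N: "submodule (?N (Suc n)) R (Hom R (F 0) (?E (Suc n) (Z (Suc n))))"
    "rel_fg R (Hom R (F 0) (?E (Suc n) (Z (Suc n)))) (cocyc (?E (Suc n) (Z (Suc n))) 0) (?N (Suc n))" for n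
  proof -
    \<comment> \<open>All of \<open>E\<^sup>n\<close> maps onto
      \<open>C\<^sup>n\<^sup>+\<^sup>1\<close>, which may be too large. \<open>D\<close> is the part
      over \<open>Z\<^sup>n\<^sup>+\<^sup>1\<close>: it keeps the kernel \<open>C\<^sup>n\<close>,
      for which \<open>T\<^sup>1\<close> is finitely generated, and contains
      \<open>I\<^sup>n\<close>, where all its 0-cocycles take their values.\<close>
    define D where "D = {x \<in> carrier (E n). \<delta> n x \<in> Z (Suc n)}"
    have D_sub: "submodule D R (E n)"
      using Z_sub[of "Suc n"] module.carrier_is_submodule[OF E, of n] mod_homD[OF \<delta>[of n]] mod_hom_zero[OF E E \<delta>[of n]]
      unfolding D_def module.submodule_iff[OF E] by auto
    note D_mod = submodule_imp_module[OF E D_sub]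
    have g: "\<delta> n \<in> mod_hom R (?E n D) (?E (Suc n) (Z (Suc n)))"
      by (rule mod_homI) (use mod_homD[OF \<delta>[of n]] in \<open>auto simp: D_def\<close>)
    have surj: "\<delta> n ` carrier (?E n D) = carrier (?E (Suc n) (Z (Suc n)))"
      using \<delta>_C[of n] unfolding D_def Z_def by auto
    have CZ: "\<zero>\<^bsub>E (Suc n)\<^esub> \<in> Z (Suc n)"
      using Z_sub[of "Suc n"] unfolding module.submodule_iff[OF E] by blast
    have ker: "C n = a_kernel (?E n D) (?E (Suc n) (Z (Suc n))) (\<delta> n)"
      using CZ unfolding C_def D_def a_kernel_def' by auto
    have "I n \<subseteq> D" using B_Z[of "Suc n"] carr(1) unfolding D_def B_Suc by auto
    then have I_D: "submodule (I n) R (?E n D)" using I_sub by (simp add: submodule_of_submodule[OF E D_sub])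
    have sub: "\<chi> y \<in> I n" if \<chi>: "\<chi> \<in> cocyc (?E n D) 0" and y: "y \<in> carrier (F 0)" for \<chi> y
    proof (rule torsion[OF cocycI y])
      show "\<chi> \<in> carrier (Hom R (F 0) (E n))"
        by (rule Hom_submoduleD[OF cocycD(1)[OF \<chi>]]) (auto simp: D_def)
      show "\<chi> (d 0 z) = \<zero>\<^bsub>E n\<^esub>" if "z \<in> carrier (F (Suc 0))" for z
        using cocycD(2)[OF \<chi> that] by simp
    qed
    have fgK: "?fg (?E n D\<lparr>carrier := C n\<rparr>) (Suc 0)" using fgC[of n 0] by simp
    show "submodule (?N (Suc n)) R (Hom R (F 0) (?E (Suc n) (Z (Suc n))))"
      unfolding B_Suc by (rule rel_fg_cocyc_0_mod_image(1)[OF D_mod Z_mod g surj ker I_D _ fgK]) (rule sub)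
    show "rel_fg R (Hom R (F 0) (?E (Suc n) (Z (Suc n)))) (cocyc (?E (Suc n) (Z (Suc n))) 0) (?N (Suc n))"
      unfolding B_Suc by (rule rel_fg_cocyc_0_mod_image(2)[OF D_mod Z_mod g surj ker I_D _ fgK]) (rule sub)
  qed

  \<comment> \<open>Going from \<open>B\<^sup>n\<close> to \<open>B\<^sup>n\<^sup>+\<^sup>1\<close>
    uses the cofiniteness of \<open>H\<^sup>n\<close>, available for \<open>n < t\<close>; hence the
    bound \<open>t\<close>. Degree \<open>i + 1\<close> of \<open>B\<^sup>n\<^sup>+\<^sup>1\<close>
    comes from degree \<open>i + 2\<close> of \<open>Z\<^sup>n\<close>, so again \<open>i\<close> is
    arbitrary.\<close>
  have fgB: "?fg (?E n (B n)) (Suc i)" if "n \<le> t" for n i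
    using that
  proof (induction n arbitrary: i)
    case 0
    have "baer R (?E 0 (B 0))" using baer_zero[OF E] by (simp add: B_def)
    then show ?case by (rule fin_gen_Ext_baer[OF B_mod])
  next
    case (Suc n)
    have "?fg (?H n) j" for j using cof[of n] Suc.prems by (simp add: cofinite_module_def)
    then have "?fg (?E n (Z n)) (Suc (Suc i))" using Suc by (intro H_middle) simp_all
    then show ?case by (rule B_right[OF fin_gen_Ext_baer[OF I_mod I_baer]])
  qed

  \<comment> \<open>The chain of equivalences\<close>
  have "fin_gen R (Hom R (quot_ring_module R \<aa>) (?H (Suc t))) \<longleftrightarrow> ?fg (?H (Suc t)) 0"
    by (rule fin_gen_Hom_iff_Ext_0[OF quot_module_is_module[OF regular_module] res H_mod])
      (simp add: submodule_regular_iff_ideal a)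
  also have "\<dots> \<longleftrightarrow> ?fg (?E (Suc t) (B (Suc t))) (Suc 0)"
  proof
    assume "?fg (?H (Suc t)) 0"
    \<comment> \<open>In \<open>T\<^sup>0(H) \<rightarrow> T\<^sup>1(B) \<rightarrow>
      T\<^sup>1(Z)\<close> the right end is finitely generated at every index, including
      \<open>t + 1\<close>.\<close>
    then show "?fg (?E (Suc t) (B (Suc t))) (Suc 0)" by (rule H_left[OF _ fgZ1])
  next
    assume fg: "?fg (?E (Suc t) (B (Suc t))) (Suc 0)"
    show "?fg (?H (Suc t)) 0"
    \<comment> \<open>\<open>T\<^sup>0(Z)\<close> enters only through its finitely generated
      quotient by \<open>?N\<close>. Maps with values in \<open>B\<close> become zero in
      \<open>H\<close>, as \<open>Ext_right\<close> asks.\<close>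
    proof (rule H_Ext_right[OF N _ fg])
      fix \<phi> \<omega> assume \<phi>: "\<phi> \<in> ?N (Suc t)"
        and "(\<phi>, \<omega>) \<in> push R (F 0) (?E (Suc t) (Z (Suc t))) (?H (Suc t)) (\<lambda>x. B (Suc t) +>\<^bsub>E (Suc t)\<^esub> x)"
      then have "\<omega> \<in> carrier (Hom R (F 0) (?H (Suc t)))"
        "\<And>y. y \<in> carrier (F 0) \<Longrightarrow> \<omega> y = ?coset (Suc t) (\<phi> y)" by (auto simp: push_def)
      moreover have "?coset (Suc t) (\<phi> y) = \<zero>\<^bsub>?H (Suc t)\<^esub>" if "y \<in> carrier (F 0)" for y
        using coset_zero[of "\<phi> y" "Suc t"] \<phi> that B_Z[of "Suc t"] by blast
      ultimately show "\<omega> \<in> cobd (?H (Suc t)) 0" by (simp add: cobd_0_iff)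
    qed
  qed
  \<comment> \<open>Since \<open>T\<^sup>1(I\<^sup>t) = T\<^sup>2(I\<^sup>t) = 0\<close>, each
    direction is one piece of the sequence for \<open>0 \<rightarrow> Z\<^sup>t \<rightarrow>
    I\<^sup>t \<rightarrow> B\<^sup>t\<^sup>+\<^sup>1 \<rightarrow> 0\<close>.\<close>
  also have "\<dots> \<longleftrightarrow> ?fg (?E t (Z t)) (Suc (Suc 0))"
    using B_left[OF _ fin_gen_Ext_baer[OF I_mod I_baer]] B_right[OF fin_gen_Ext_baer[OF I_mod I_baer]] by blast
  \<comment> \<open>From \<open>Z\<close> to \<open>H\<close> the finiteness of
    \<open>T\<^sup>3(B\<^sup>t)\<close> is used, from \<open>H\<close> to \<open>Z\<close> that of
    \<open>T\<^sup>2(B\<^sup>t)\<close>; \<open>t\<close> is the last index that \<open>fgB\<close>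
    covers.\<close>
  also have "\<dots> \<longleftrightarrow> ?fg (?H t) (Suc (Suc 0))"
    using H_right[OF _ fgB[OF order_refl]] H_middle[OF fgB[OF order_refl]] by blast
  finally show ?thesis by (simp add: numeral_2_eq_2)
qed

end
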